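(* Let $H$ be a Hopf algebra over a field $\mathbb F$ with invertible antipode and with a Hopf pairing $\varphi$, and let $\chi$ be a $\tau$-twisted compatible map for a Hopf algebra endomorphism $\tau$ of $H$. Then there is a right $(H\otimes H)^\imath$-coaction $$\Psi:H^\imath_\tau\to H^\imath_\tau\otimes(H\otimes H)^\imath,\qquad a\mapsto\sum\varphi(\tau(a_{(4)}),a_{(2)})\,a_{(3)}\otimes(\tau(a_{(5)})\otimes a_{(1)})$$ such that $H^\imath_\tau$ is a comodule algebra. Moreover, $(\xi_{\tau,\chi}\otimes1\otimes1)\circ\Psi=\Delta^\imath\circ\xi_{\tau,\chi}$, where $\xi_{\tau,\chi}:H^\imath_\tau\to(H\otimes H)^\imath$ is the map $a\mapsto\sum\chi(a_{(2)})\,\tau(a_{(3)})\otimes a_{(1)}$.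
   Context: Sweedler notation: $\sum a_{(1)}\otimes\cdots\otimes a_{(n+1)}$ is the $n$-fold iterated coproduct. A Hopf pairing on $H$ is a bilinear form $\varphi:H\times H\to\mathbb F$ with $\varphi(a,1)=\varepsilon(a)$, $\varphi(1,b)=\varepsilon(b)$, $\varphi(a,bb')=\varphi(\Delta(a),b\otimes b')$, $\varphi(aa',b)=\varphi(a\otimes a',\Delta(b))$, $\varphi(a,S(b))=\varphi(S(a),b)$, where $\varphi(a\otimes a',b\otimes b')=\varphi(a,b)\varphi(a',b')$. $H^\imath_\tau$ is the vector space $H$ with the associative product $a\ast b=\sum\varphi(\tau(b_{(2)}),a_{(1)})\,a_{(2)}b_{(1)}$ and unit $1$. $(H\otimes H)^\imath$ is the vector space $H\otimes H$ with product $(a\otimes b)\ast(c\otimes d)=\sum\varphi(a_{(1)},d_{(2)})\varphi(c_{(2)},b_{(1)})\,a_{(2)}c_{(1)}\otimes b_{(2)}d_{(1)}$; it is a Hopf algebra with unit $1\otimes1$, coproduct $\Delta^\imath(a\otimes b)=\sum\varphi(a_{(2)},b_{(2)})(a_{(1)}\otimes b_{(3)})\otimes(a_{(3)}\otimes b_{(1)})$ and counit $\varepsilon^\imath(a\otimes b)=\varphi(a,S^{-1}(b))$. A linear map $\chi:H\to\mathbb F$ is $\tau$-twisted compatible if $\chi(ab)=\sum\chi(a_{(1)})\chi(b_{(2)})\varphi(\tau(a_{(2)}),b_{(1)})$ for all $a,b\in H$. A right comodule algebra over a bialgebra is an algebra with a right coaction (coassociative and counital) that is an algebra homomorphism. 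*)

theory Defs
  imports Complex_Main "HOL-Library.Function_Algebras"
begin

section \<open>Vector spaces and algebras on carriers\<close>

text \<open>
  The ground field is a type of class \<open>field\<close>. Vector spaces over it are records consisting of a
  carrier set and a scalar multiplication, where addition is that of the underlying type. Carriers
  are needed because tensor products depend on scalar multiplications, so that they cannot be types.
\<close>

record ('f, 'a) vspace =
  carrier :: "'a set"
  smult :: "'f \<Rightarrow> 'a \<Rightarrow> 'a"

record ('f, 'a) alg = "('f, 'a) vspace" +
  mult :: "'a \<Rightarrow> 'a \<Rightarrow> 'a"
  one :: 'a

locale vec_space =
  fixes V :: "('f::field, 'a::ab_group_add, 'z) vspace_scheme"
  assumes is_vector_space: "vector_space (smult V)"
    and is_subspace: "module.subspace (smult V) (carrier V)"

definition linear_on ::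
  "('f::field, 'a::ab_group_add, 'x) vspace_scheme \<Rightarrow> ('f, 'b::ab_group_add, 'y) vspace_scheme
    \<Rightarrow> ('a \<Rightarrow> 'b) \<Rightarrow> bool" where
  "linear_on V W f \<longleftrightarrow>
    (\<forall>x\<in>carrier V. f x \<in> carrier W) \<and>
    (\<forall>x\<in>carrier V. \<forall>y\<in>carrier V. f (x + y) = f x + f y) \<and>
    (\<forall>c. \<forall>x\<in>carrier V. f (smult V c x) = smult W c (f x))"

definition bilinear_on ::
  "('f::field, 'a::ab_group_add, 'x) vspace_scheme \<Rightarrow> ('f, 'b::ab_group_add, 'y) vspace_scheme
    \<Rightarrow> ('f, 'c::ab_group_add, 'z) vspace_scheme \<Rightarrow> ('a \<Rightarrow> 'b \<Rightarrow> 'c) \<Rightarrow> bool" where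
  "bilinear_on V W Z f \<longleftrightarrow>
    (\<forall>a\<in>carrier V. linear_on W Z (f a)) \<and> (\<forall>b\<in>carrier W. linear_on V Z (\<lambda>a. f a b))"

locale assoc_algebra = vec_space A
  for A :: "('f::field, 'a::ab_group_add, 'z) alg_scheme" +
  assumes mult_bilinear: "bilinear_on A A A (mult A)"
    and mult_assoc: "\<lbrakk>a \<in> carrier A; b \<in> carrier A; c \<in> carrier A\<rbrakk>
      \<Longrightarrow> mult A (mult A a b) c = mult A a (mult A b c)"
    and one_closed: "one A \<in> carrier A"
    and mult_one_left: "a \<in> carrier A \<Longrightarrow> mult A (one A) a = a"
    and mult_one_right: "a \<in> carrier A \<Longrightarrow> mult A a (one A) = a"

definition algebra_hom ::
  "('f::field, 'a::ab_group_add, 'x) alg_scheme \<Rightarrow> ('f, 'b::ab_group_add, 'y) alg_scheme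
    \<Rightarrow> ('a \<Rightarrow> 'b) \<Rightarrow> bool" where
  "algebra_hom A B f \<longleftrightarrow> linear_on A B f \<and> f (one A) = one B \<and>
    (\<forall>a\<in>carrier A. \<forall>b\<in>carrier A. f (mult A a b) = mult B (f a) (f b))"

definition ground :: "('f::field, 'f) alg" where
  "ground = \<lparr>carrier = UNIV, smult = (*), mult = (*), one = 1\<rparr>"


section \<open>Tensor products\<close>

text \<open>
  The tensor product of \<open>V\<close> and \<open>W\<close> is realised inside the dual of the space of bilinear forms
  on \<open>V \<times> W\<close>: a pure tensor is evaluation at a pair, and the tensor product consists of the finite
  sums of pure tensors. Theorem \<open>tensor_universal\<close> below is its universal property.
\<close>

type_synonym ('f, 'a, 'b) tensor = "('a \<Rightarrow> 'b \<Rightarrow> 'f) \<Rightarrow> 'f"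

definition pure_tensor ::
  "'a \<Rightarrow> ('f::field, 'a::ab_group_add, 'x) vspace_scheme \<Rightarrow>
    ('f, 'b::ab_group_add, 'y) vspace_scheme \<Rightarrow> 'b \<Rightarrow> ('f, 'a, 'b) tensor"
  ("(_ \<otimes>\<^bsub>_,_\<^esub>/ _)" [71, 0, 0, 70] 70) where
  "a \<otimes>\<^bsub>V,W\<^esub> b = (\<lambda>\<beta>. if bilinear_on V W ground \<beta> then \<beta> a b else 0)"

definition represents ::
  "('f::field, 'a::ab_group_add, 'x) vspace_scheme \<Rightarrow> ('f, 'b::ab_group_add, 'y) vspace_scheme
    \<Rightarrow> ('a \<times> 'b) list \<Rightarrow> ('f, 'a, 'b) tensor \<Rightarrow> bool" where
  "represents V W xs t \<longleftrightarrow>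
    set xs \<subseteq> carrier V \<times> carrier W \<and> t = (\<Sum>(a, b)\<leftarrow>xs. a \<otimes>\<^bsub>V,W\<^esub> b)"

definition tensor_space ::
  "('f::field, 'a::ab_group_add, 'x) vspace_scheme \<Rightarrow> ('f, 'b::ab_group_add, 'y) vspace_scheme
    \<Rightarrow> ('f, ('f, 'a, 'b) tensor) vspace"
  (infixr "\<Otimes>" 70) where
  "V \<Otimes> W = \<lparr>carrier = {t. \<exists>xs. represents V W xs t}, smult = (\<lambda>c t \<beta>. c * t \<beta>)\<rparr>"

text \<open>
  \<open>tensor_lift V W f t\<close> is the value at \<open>t\<close> of the linear map induced by a bilinear map \<open>f\<close>. It is
  computed from an arbitrary representation of \<open>t\<close> as a sum of pure tensors, and does not depend on
  that choice when \<open>f\<close> is bilinear (\<open>tensor_lift_eq\<close>).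
\<close>

definition tensor_lift ::
  "('f::field, 'a::ab_group_add, 'x) vspace_scheme \<Rightarrow> ('f, 'b::ab_group_add, 'y) vspace_scheme
    \<Rightarrow> ('a \<Rightarrow> 'b \<Rightarrow> 'c::ab_group_add) \<Rightarrow> ('f, 'a, 'b) tensor \<Rightarrow> 'c" where
  "tensor_lift V W f t = (\<Sum>(a, b)\<leftarrow>(SOME xs. represents V W xs t). f a b)"

definition tensor_map ::
  "('f::field, 'a::ab_group_add, 'x) vspace_scheme \<Rightarrow> ('f, 'b::ab_group_add, 'y) vspace_scheme
    \<Rightarrow> ('f, 'c::ab_group_add, 'z) vspace_scheme \<Rightarrow> ('f, 'd::ab_group_add, 'w) vspace_scheme
    \<Rightarrow> ('a \<Rightarrow> 'c) \<Rightarrow> ('b \<Rightarrow> 'd) \<Rightarrow> ('f, 'a, 'b) tensor \<Rightarrow> ('f, 'c, 'd) tensor" where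
  "tensor_map V W V' W' f g = tensor_lift V W (\<lambda>a b. f a \<otimes>\<^bsub>V',W'\<^esub> g b)"

definition tensor_assoc ::
  "('f::field, 'a::ab_group_add, 'x) vspace_scheme \<Rightarrow> ('f, 'b::ab_group_add, 'y) vspace_scheme
    \<Rightarrow> ('f, 'c::ab_group_add, 'z) vspace_scheme
    \<Rightarrow> ('f, ('f, 'a, 'b) tensor, 'c) tensor \<Rightarrow> ('f, 'a, ('f, 'b, 'c) tensor) tensor" where
  "tensor_assoc U V W = tensor_lift (U \<Otimes> V) W (\<lambda>t c.
    tensor_lift U V (\<lambda>a b. a \<otimes>\<^bsub>U,V \<Otimes> W\<^esub> (b \<otimes>\<^bsub>V,W\<^esub> c)) t)"

definition tensor_algebra ::
  "('f::field, 'a::ab_group_add, 'x) alg_scheme \<Rightarrow> ('f, 'b::ab_group_add, 'y) alg_scheme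
    \<Rightarrow> ('f, ('f, 'a, 'b) tensor) alg" where
  "tensor_algebra A B =
    \<lparr>carrier = carrier (A \<Otimes> B), smult = smult (A \<Otimes> B),
     mult = (\<lambda>s t. tensor_lift A B (\<lambda>a b. tensor_lift A B (\<lambda>c d.
       mult A a c \<otimes>\<^bsub>A,B\<^esub> mult B b d) t) s),
     one = one A \<otimes>\<^bsub>A,B\<^esub> one B\<rparr>"


subsection \<open>The universal property\<close>

lemma vec_space_ground: "vec_space (ground :: ('f::field, 'f) alg)"
proof -
  interpret v: vector_space "(*) :: 'f \<Rightarrow> 'f \<Rightarrow> 'f"
    by unfold_locales (auto simp: algebra_simps)
  show ?thesis
    by (rule vec_space.intro) (simp_all add: ground_def v.vector_space_axioms)
qed

lemma sum_list_fun_apply: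
  "(\<Sum>x\<leftarrow>xs. (g x :: 'b \<Rightarrow> 'f::ab_group_add)) \<beta> = (\<Sum>x\<leftarrow>xs. g x \<beta>)"
  by (induction xs) auto

lemma separating_functional:
  assumes "vector_space (s :: 'f::field \<Rightarrow> 'a::ab_group_add \<Rightarrow> 'a)" "z \<noteq> 0"
  shows "\<exists>l. Vector_Spaces.linear s ((*) :: 'f \<Rightarrow> 'f \<Rightarrow> 'f) l \<and> l z \<noteq> 0"
proof -
  interpret s: vector_space s by fact
  interpret f: vector_space "(*) :: 'f \<Rightarrow> 'f \<Rightarrow> 'f"
    by unfold_locales (auto simp: algebra_simps)
  interpret vector_space_pair s "(*) :: 'f \<Rightarrow> 'f \<Rightarrow> 'f" ..
  have "s.independent {z}" using assms(2) by simp
  from linear_independent_extend[OF this, of "\<lambda>_. 1"] show ?thesis by force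
qed

lemma represents_apply:
  assumes "represents V W xs t" "bilinear_on V W ground \<beta>"
  shows "t \<beta> = (\<Sum>(a, b)\<leftarrow>xs. \<beta> a b)"
  using assms unfolding represents_def
  by (auto simp: sum_list_fun_apply pure_tensor_def case_prod_unfold)

lemma representation_independent:
  assumes Z: "vec_space Z" and f: "bilinear_on V W Z f"
    and xs: "represents V W xs t" and ys: "represents V W ys t"
  shows "(\<Sum>(a, b)\<leftarrow>xs. f a b) = (\<Sum>(a, b)\<leftarrow>ys. f a b)"
proof (rule ccontr)
  assume ne: "\<not> ?thesis"
  define z where "z = (\<Sum>(a, b)\<leftarrow>xs. f a b) - (\<Sum>(a, b)\<leftarrow>ys. f a b)"
  from ne have "z \<noteq> 0" by (simp add: z_def)
  then obtain l where l: "Vector_Spaces.linear (smult Z) (*) l" "l z \<noteq> 0"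
    using separating_functional[OF vec_space.is_vector_space[OF Z]] by blast
  interpret l: Vector_Spaces.linear "smult Z" "(*)" l by fact
  have b: "bilinear_on V W ground (\<lambda>a b. l (f a b))"
    using f unfolding bilinear_on_def linear_on_def ground_def by (auto simp: l.add l.scale)
  have *: "l (\<Sum>(a, b)\<leftarrow>zs. f a b) = (\<Sum>(a, b)\<leftarrow>zs. l (f a b))" for zs
    by (induction zs) (auto simp: l.add l.zero)
  have "l z = 0"
    unfolding z_def l.diff * represents_apply[OF xs b, symmetric] represents_apply[OF ys b, symmetric]
    by simp
  with l show False by simp
qed

lemma tensor_lift_eq:
  assumes "vec_space Z" "bilinear_on V W Z f" "represents V W xs t"
  shows "tensor_lift V W f t = (\<Sum>(a, b)\<leftarrow>xs. f a b)"
  unfolding tensor_lift_def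
  by (rule representation_independent[OF assms(1,2) _ assms(3)]) (rule someI, fact)

lemma represents_Nil: "represents V W [] 0"
  by (simp add: represents_def)

lemma represents_append:
  "represents V W xs s \<Longrightarrow> represents V W ys t \<Longrightarrow> represents V W (xs @ ys) (s + t)"
  by (auto simp: represents_def)

lemma represents_single:
  "a \<in> carrier V \<Longrightarrow> b \<in> carrier W \<Longrightarrow> represents V W [(a, b)] (a \<otimes>\<^bsub>V,W\<^esub> b)"
  by (auto simp: represents_def)

lemma smult_closed: "vec_space V \<Longrightarrow> a \<in> carrier V \<Longrightarrow> smult V c a \<in> carrier V"
  unfolding vec_space_def module_iff_vector_space[symmetric] by (blast intro: module.subspace_scale)

lemma add_closed: "vec_space V \<Longrightarrow> a \<in> carrier V \<Longrightarrow> b \<in> carrier V \<Longrightarrow> a + b \<in> carrier V"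
  unfolding vec_space_def module_iff_vector_space[symmetric] by (blast intro: module.subspace_add)

lemma represents_smult:
  assumes V: "vec_space V" and "represents V W xs t"
  shows "represents V W (map (\<lambda>(a, b). (smult V c a, b)) xs) (\<lambda>\<beta>. c * t \<beta>)"
proof -
  have p: "smult V c a \<otimes>\<^bsub>V,W\<^esub> b = (\<lambda>\<beta>. c * (a \<otimes>\<^bsub>V,W\<^esub> b) \<beta>)"
    if "a \<in> carrier V" "b \<in> carrier W" for a b
    using that by (auto simp: pure_tensor_def bilinear_on_def linear_on_def ground_def fun_eq_iff)
  have "set xs \<subseteq> carrier V \<times> carrier W \<Longrightarrow>
    (\<lambda>\<beta>. c * (\<Sum>(a, b)\<leftarrow>xs. a \<otimes>\<^bsub>V,W\<^esub> b) \<beta>) =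
    (\<Sum>(a, b)\<leftarrow>map (\<lambda>(a, b). (smult V c a, b)) xs. a \<otimes>\<^bsub>V,W\<^esub> b)" for xs
    by (induction xs) (auto simp: p algebra_simps fun_eq_iff)
  with assms show ?thesis
    by (auto simp: represents_def intro: smult_closed)
qed

lemma vec_space_tensor:
  assumes "vec_space V"
  shows "vec_space (V \<Otimes> W)"
proof -
  interpret v: vector_space "\<lambda>c (t :: ('a, 'b, 'd) tensor) \<beta>. c * t \<beta>"
    by unfold_locales (auto simp: algebra_simps fun_eq_iff)
  have "v.subspace {t. \<exists>xs. represents V W xs t}"
    unfolding v.subspace_def mem_Collect_eq
    using represents_Nil represents_append represents_smult[OF assms] by blast
  then show ?thesis
    by (intro vec_space.intro) (simp_all add: tensor_space_def v.vector_space_axioms)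
qed

lemma pure_tensor_closed:
  "a \<in> carrier V \<Longrightarrow> b \<in> carrier W \<Longrightarrow> a \<otimes>\<^bsub>V,W\<^esub> b \<in> carrier (V \<Otimes> W)"
  using represents_single[of a V b W] by (auto simp: tensor_space_def)

lemma bilinear_pure_tensor:
  assumes V: "vec_space V" and W: "vec_space W"
  shows "bilinear_on V W (V \<Otimes> W) (\<lambda>a b. a \<otimes>\<^bsub>V,W\<^esub> b)"
proof -
  have 1: "(a + a') \<otimes>\<^bsub>V,W\<^esub> b = (a \<otimes>\<^bsub>V,W\<^esub> b) + (a' \<otimes>\<^bsub>V,W\<^esub> b)"
    if "a \<in> carrier V" "a' \<in> carrier V" "b \<in> carrier W" for a a' b
    using that by (auto simp: fun_eq_iff pure_tensor_def bilinear_on_def linear_on_def)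
  have 2: "smult V c a \<otimes>\<^bsub>V,W\<^esub> b = smult (V \<Otimes> W) c (a \<otimes>\<^bsub>V,W\<^esub> b)"
    if "a \<in> carrier V" "b \<in> carrier W" for a b c
    using that
    by (auto simp: fun_eq_iff pure_tensor_def bilinear_on_def linear_on_def ground_def tensor_space_def)
  have 3: "a \<otimes>\<^bsub>V,W\<^esub> (b + b') = (a \<otimes>\<^bsub>V,W\<^esub> b) + (a \<otimes>\<^bsub>V,W\<^esub> b')"
    if "a \<in> carrier V" "b \<in> carrier W" "b' \<in> carrier W" for a b b'
    using that by (auto simp: fun_eq_iff pure_tensor_def bilinear_on_def linear_on_def)
  have 4: "a \<otimes>\<^bsub>V,W\<^esub> smult W c b = smult (V \<Otimes> W) c (a \<otimes>\<^bsub>V,W\<^esub> b)"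
    if "a \<in> carrier V" "b \<in> carrier W" for a b c
    using that
    by (auto simp: fun_eq_iff pure_tensor_def bilinear_on_def linear_on_def ground_def tensor_space_def)
  show ?thesis
    unfolding bilinear_on_def linear_on_def
    by (intro conjI ballI allI) (rule pure_tensor_closed 1 2 3 4; assumption)+
qed

theorem tensor_universal:
  assumes V: "vec_space V" and W: "vec_space W" and Z: "vec_space Z" and f: "bilinear_on V W Z f"
  shows "linear_on (V \<Otimes> W) Z (tensor_lift V W f)"
    and "\<lbrakk>a \<in> carrier V; b \<in> carrier W\<rbrakk> \<Longrightarrow> tensor_lift V W f (a \<otimes>\<^bsub>V,W\<^esub> b) = f a b"
    and "\<lbrakk>linear_on (V \<Otimes> W) Z g; \<forall>a\<in>carrier V. \<forall>b\<in>carrier W. g (a \<otimes>\<^bsub>V,W\<^esub> b) = f a b;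
      t \<in> carrier (V \<Otimes> W)\<rbrakk> \<Longrightarrow> g t = tensor_lift V W f t"
proof -
  note lift = tensor_lift_eq[OF Z f]
  interpret Z: vector_space "smult Z" by (rule vec_space.is_vector_space[OF Z])
  have fZ: "f a b \<in> carrier Z" if "a \<in> carrier V" "b \<in> carrier W" for a b
    using f that by (auto simp: bilinear_on_def linear_on_def)
  have closed: "set xs \<subseteq> carrier V \<times> carrier W \<Longrightarrow> (\<Sum>(a, b)\<leftarrow>xs. f a b) \<in> carrier Z" for xs
    by (induction xs)
      (auto simp: fZ intro: add_closed[OF Z] Z.subspace_0[OF vec_space.is_subspace[OF Z]])
  have scale: "set xs \<subseteq> carrier V \<times> carrier W \<Longrightarrow>
      (\<Sum>(a, b)\<leftarrow>map (\<lambda>(a, b). (smult V c a, b)) xs. f a b) = smult Z c (\<Sum>(a, b)\<leftarrow>xs. f a b)"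
    for xs c
    using f by (induction xs)
      (auto simp: Z.scale_right_distrib bilinear_on_def linear_on_def)
  show "linear_on (V \<Otimes> W) Z (tensor_lift V W f)"
    unfolding linear_on_def
  proof (intro conjI ballI allI)
    fix s assume "s \<in> carrier (V \<Otimes> W)"
    then obtain xs where xs: "represents V W xs s" by (auto simp: tensor_space_def)
    show "tensor_lift V W f s \<in> carrier Z"
      unfolding lift[OF xs] using closed xs by (simp add: represents_def)
    show "tensor_lift V W f (smult (V \<Otimes> W) c s) = smult Z c (tensor_lift V W f s)" for c
      using lift[OF represents_smult[OF V xs, of c]] lift[OF xs] scale xs
      by (simp add: represents_def tensor_space_def)
    fix t assume "t \<in> carrier (V \<Otimes> W)"
    then obtain ys where ys: "represents V W ys t" by (auto simp: tensor_space_def)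
    show "tensor_lift V W f (s + t) = tensor_lift V W f s + tensor_lift V W f t"
      using lift[OF represents_append[OF xs ys]] lift[OF xs] lift[OF ys] by simp
  qed
  show "tensor_lift V W f (a \<otimes>\<^bsub>V,W\<^esub> b) = f a b" if "a \<in> carrier V" "b \<in> carrier W"
    using lift[OF represents_single[OF that]] by simp
  assume g: "linear_on (V \<Otimes> W) Z g" "\<forall>a\<in>carrier V. \<forall>b\<in>carrier W. g (a \<otimes>\<^bsub>V,W\<^esub> b) = f a b"
    and "t \<in> carrier (V \<Otimes> W)"
  then obtain xs where xs: "represents V W xs t" by (auto simp: tensor_space_def)
  have sumT: "set xs \<subseteq> carrier V \<times> carrier W \<Longrightarrow>
      (\<Sum>(a, b)\<leftarrow>xs. a \<otimes>\<^bsub>V,W\<^esub> b) \<in> carrier (V \<Otimes> W)" for xs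
    by (auto simp: tensor_space_def represents_def)
  have "0 \<in> carrier (V \<Otimes> W)" using sumT[of "[]"] by simp
  then have "g (0 + 0) = g 0 + g 0" using g(1) unfolding linear_on_def by blast
  then have g0: "g 0 = 0" by simp
  have "set xs \<subseteq> carrier V \<times> carrier W \<Longrightarrow>
      g (\<Sum>(a, b)\<leftarrow>xs. a \<otimes>\<^bsub>V,W\<^esub> b) = (\<Sum>(a, b)\<leftarrow>xs. f a b)" for xs
  proof (induction xs)
    case (Cons x xs)
    obtain a b where x: "x = (a, b)" by force
    with Cons have ab: "a \<in> carrier V" "b \<in> carrier W" and xs: "set xs \<subseteq> carrier V \<times> carrier W"
      by auto
    have "g ((a \<otimes>\<^bsub>V,W\<^esub> b) + (\<Sum>(a, b)\<leftarrow>xs. a \<otimes>\<^bsub>V,W\<^esub> b)) =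
        g (a \<otimes>\<^bsub>V,W\<^esub> b) + g (\<Sum>(a, b)\<leftarrow>xs. a \<otimes>\<^bsub>V,W\<^esub> b)"
      using g(1) pure_tensor_closed[OF ab] sumT[OF xs] unfolding linear_on_def by blast
    then show ?case unfolding x using Cons.IH[OF xs] g(2) ab by (simp del: plus_fun_apply)
  qed (simp add: g0)
  with xs show "g t = tensor_lift V W f t" by (simp add: lift[OF xs]) (simp add: represents_def)
qed


section \<open>Hopf algebras and comodule algebras\<close>

record ('f, 'a) bialg = "('f, 'a) alg" +
  comult :: "'a \<Rightarrow> ('f, 'a, 'a) tensor"
  counit :: "'a \<Rightarrow> 'f"

record ('f, 'a) hopf = "('f, 'a) bialg" +
  antipode :: "'a \<Rightarrow> 'a"

locale coalgebra = vec_space C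
  for C :: "('f::field, 'a::ab_group_add, 'z) bialg_scheme" +
  assumes comult_linear: "linear_on C (C \<Otimes> C) (comult C)"
    and counit_linear: "linear_on C ground (counit C)"
    and coassoc: "a \<in> carrier C \<Longrightarrow>
      tensor_assoc C C C (tensor_map C C (C \<Otimes> C) C (comult C) id (comult C a)) =
      tensor_map C C C (C \<Otimes> C) id (comult C) (comult C a)"
    and counit_left: "a \<in> carrier C \<Longrightarrow>
      tensor_lift C C (\<lambda>x y. smult C (counit C x) y) (comult C a) = a"
    and counit_right: "a \<in> carrier C \<Longrightarrow>
      tensor_lift C C (\<lambda>x y. smult C (counit C y) x) (comult C a) = a"

locale bialgebra = assoc_algebra B + coalgebra B
  for B :: "('f::field, 'a::ab_group_add, 'z) bialg_scheme" +
  assumes comult_hom: "algebra_hom B (tensor_algebra B B) (comult B)"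
    and counit_hom: "algebra_hom B ground (counit B)"

locale hopf_algebra = bialgebra H
  for H :: "('f::field, 'a::ab_group_add, 'z) hopf_scheme" +
  assumes antipode_linear: "linear_on H H (antipode H)"
    and antipode_left: "a \<in> carrier H \<Longrightarrow>
      tensor_lift H H (\<lambda>x y. mult H (antipode H x) y) (comult H a) = smult H (counit H a) (one H)"
    and antipode_right: "a \<in> carrier H \<Longrightarrow>
      tensor_lift H H (\<lambda>x y. mult H x (antipode H y)) (comult H a) = smult H (counit H a) (one H)"

definition hopf_endomorphism ::
  "('f::field, 'a::ab_group_add, 'z) hopf_scheme \<Rightarrow> ('a \<Rightarrow> 'a) \<Rightarrow> bool" where
  "hopf_endomorphism H \<tau> \<longleftrightarrow> algebra_hom H H \<tau> \<and>
    (\<forall>a\<in>carrier H. comult H (\<tau> a) = tensor_map H H H H \<tau> \<tau> (comult H a)) \<and>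
    (\<forall>a\<in>carrier H. counit H (\<tau> a) = counit H a) \<and>
    (\<forall>a\<in>carrier H. antipode H (\<tau> a) = \<tau> (antipode H a))"

locale comodule_algebra = A: assoc_algebra A + B: bialgebra B
  for A :: "('f::field, 'a::ab_group_add, 'x) alg_scheme"
    and B :: "('f, 'b::ab_group_add, 'y) bialg_scheme"
    and \<rho> :: "'a \<Rightarrow> ('f, 'a, 'b) tensor" +
  assumes coaction_hom: "algebra_hom A (tensor_algebra A B) \<rho>"
    and coaction_coassoc: "a \<in> carrier A \<Longrightarrow>
      tensor_assoc A B B (tensor_map A B (A \<Otimes> B) B \<rho> id (\<rho> a)) =
      tensor_map A B A (B \<Otimes> B) id (comult B) (\<rho> a)"
    and coaction_counit: "a \<in> carrier A \<Longrightarrow>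
      tensor_lift A B (\<lambda>x y. smult A (counit B y) x) (\<rho> a) = a"


section \<open>Sweedler notation\<close>

text \<open>
  For multilinear \<open>F\<close>, each \<open>sweedler\<close> operator below gives the sum of \<open>F a1 a2 \<dots>\<close>, where
  \<open>a1 \<otimes> a2 \<otimes> \<dots>\<close> runs through the iterated coproduct of \<open>a\<close>, formed by repeatedly applying the
  coproduct to the last tensor factor. The number is that of the tensor factors.
\<close>

definition sweedler2 :: "('f::field, 'a::ab_group_add, 'z) bialg_scheme \<Rightarrow>
    ('a \<Rightarrow> 'a \<Rightarrow> 'c::ab_group_add) \<Rightarrow> 'a \<Rightarrow> 'c" where
  "sweedler2 H F a = tensor_lift H H F (comult H a)"

definition sweedler3 :: "('f::field, 'a::ab_group_add, 'z) bialg_scheme \<Rightarrow>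
    ('a \<Rightarrow> 'a \<Rightarrow> 'a \<Rightarrow> 'c::ab_group_add) \<Rightarrow> 'a \<Rightarrow> 'c" where
  "sweedler3 H F a = sweedler2 H (\<lambda>x y. sweedler2 H (F x) y) a"

definition sweedler4 :: "('f::field, 'a::ab_group_add, 'z) bialg_scheme \<Rightarrow>
    ('a \<Rightarrow> 'a \<Rightarrow> 'a \<Rightarrow> 'a \<Rightarrow> 'c::ab_group_add) \<Rightarrow> 'a \<Rightarrow> 'c" where
  "sweedler4 H F a = sweedler2 H (\<lambda>x y. sweedler3 H (F x) y) a"

definition sweedler5 :: "('f::field, 'a::ab_group_add, 'z) bialg_scheme \<Rightarrow>
    ('a \<Rightarrow> 'a \<Rightarrow> 'a \<Rightarrow> 'a \<Rightarrow> 'a \<Rightarrow> 'c::ab_group_add) \<Rightarrow> 'a \<Rightarrow> 'c" where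
  "sweedler5 H F a = sweedler2 H (\<lambda>x y. sweedler4 H (F x) y) a"


section \<open>Hopf pairings, the twisted algebras and the coaction\<close>

definition hopf_pairing ::
  "('f::field, 'a::ab_group_add, 'z) hopf_scheme \<Rightarrow> ('a \<Rightarrow> 'a \<Rightarrow> 'f) \<Rightarrow> bool" where
  "hopf_pairing H \<phi> \<longleftrightarrow> bilinear_on H H ground \<phi> \<and>
    (\<forall>a\<in>carrier H. \<phi> a (one H) = counit H a) \<and>
    (\<forall>b\<in>carrier H. \<phi> (one H) b = counit H b) \<and>
    (\<forall>a\<in>carrier H. \<forall>b\<in>carrier H. \<forall>b'\<in>carrier H.
      \<phi> a (mult H b b') = sweedler2 H (\<lambda>a1 a2. \<phi> a1 b * \<phi> a2 b') a) \<and>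
    (\<forall>a\<in>carrier H. \<forall>a'\<in>carrier H. \<forall>b\<in>carrier H.
      \<phi> (mult H a a') b = sweedler2 H (\<lambda>b1 b2. \<phi> a b1 * \<phi> a' b2) b) \<and>
    (\<forall>a\<in>carrier H. \<forall>b\<in>carrier H. \<phi> a (antipode H b) = \<phi> (antipode H a) b)"

definition twisted_compatible ::
  "('f::field, 'a::ab_group_add, 'z) hopf_scheme \<Rightarrow> ('a \<Rightarrow> 'a \<Rightarrow> 'f) \<Rightarrow> ('a \<Rightarrow> 'a) \<Rightarrow> ('a \<Rightarrow> 'f)
    \<Rightarrow> bool" where
  "twisted_compatible H \<phi> \<tau> \<chi> \<longleftrightarrow> linear_on H ground \<chi> \<and>
    (\<forall>a\<in>carrier H. \<forall>b\<in>carrier H.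
      \<chi> (mult H a b) =
      sweedler2 H (\<lambda>a1 a2. sweedler2 H (\<lambda>b1 b2. \<chi> a1 * \<chi> b2 * \<phi> (\<tau> a2) b1) b) a)"

text \<open>The algebra \<open>H\<^sup>\<iota>\<^sub>\<tau>\<close>.\<close>

definition iota_algebra ::
  "('f::field, 'a::ab_group_add, 'z) hopf_scheme \<Rightarrow> ('a \<Rightarrow> 'a \<Rightarrow> 'f) \<Rightarrow> ('a \<Rightarrow> 'a)
    \<Rightarrow> ('f, 'a) alg" where
  "iota_algebra H \<phi> \<tau> =
    \<lparr>carrier = carrier H, smult = smult H,
     mult = (\<lambda>a b. sweedler2 H (\<lambda>a1 a2. sweedler2 H (\<lambda>b1 b2.
       smult H (\<phi> (\<tau> b2) a1) (mult H a2 b1)) b) a),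
     one = one H\<rparr>"

text \<open>The bialgebra \<open>(H \<otimes> H)\<^sup>\<iota>\<close>.\<close>

definition iota_double ::
  "('f::field, 'a::ab_group_add, 'z) hopf_scheme \<Rightarrow> ('a \<Rightarrow> 'a \<Rightarrow> 'f)
    \<Rightarrow> ('f, ('f, 'a, 'a) tensor) bialg" where
  "iota_double H \<phi> =
    \<lparr>carrier = carrier (H \<Otimes> H), smult = smult (H \<Otimes> H),
     mult = (\<lambda>s t. tensor_lift H H (\<lambda>a b. tensor_lift H H (\<lambda>c d.
       sweedler2 H (\<lambda>a1 a2. sweedler2 H (\<lambda>b1 b2. sweedler2 H (\<lambda>c1 c2. sweedler2 H (\<lambda>d1 d2.
         smult (H \<Otimes> H) (\<phi> a1 d2 * \<phi> c2 b1) (mult H a2 c1 \<otimes>\<^bsub>H,H\<^esub> mult H b2 d1))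
       d) c) b) a) t) s),
     one = one H \<otimes>\<^bsub>H,H\<^esub> one H,
     comult = tensor_lift H H (\<lambda>a b.
       sweedler3 H (\<lambda>a1 a2 a3. sweedler3 H (\<lambda>b1 b2 b3.
         smult ((H \<Otimes> H) \<Otimes> (H \<Otimes> H)) (\<phi> a2 b2)
           ((a1 \<otimes>\<^bsub>H,H\<^esub> b3) \<otimes>\<^bsub>H \<Otimes> H,H \<Otimes> H\<^esub> (a3 \<otimes>\<^bsub>H,H\<^esub> b1))) b) a),
     counit = tensor_lift H H (\<lambda>a b. \<phi> a (inv_into (carrier H) (antipode H) b))\<rparr>"

definition Psi ::
  "('f::field, 'a::ab_group_add, 'z) hopf_scheme \<Rightarrow> ('a \<Rightarrow> 'a \<Rightarrow> 'f) \<Rightarrow> ('a \<Rightarrow> 'a)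
    \<Rightarrow> 'a \<Rightarrow> ('f, 'a, ('f, 'a, 'a) tensor) tensor" where
  "Psi H \<phi> \<tau> = sweedler5 H (\<lambda>a1 a2 a3 a4 a5.
    smult (iota_algebra H \<phi> \<tau> \<Otimes> iota_double H \<phi>) (\<phi> (\<tau> a4) a2)
      (a3 \<otimes>\<^bsub>iota_algebra H \<phi> \<tau>,iota_double H \<phi>\<^esub> (\<tau> a5 \<otimes>\<^bsub>H,H\<^esub> a1)))"

definition xi ::
  "('f::field, 'a::ab_group_add, 'z) hopf_scheme \<Rightarrow> ('a \<Rightarrow> 'a) \<Rightarrow> ('a \<Rightarrow> 'f)
    \<Rightarrow> 'a \<Rightarrow> ('f, 'a, 'a) tensor" where
  "xi H \<tau> \<chi> = sweedler3 H (\<lambda>a1 a2 a3. smult (H \<Otimes> H) (\<chi> a2) (\<tau> a3 \<otimes>\<^bsub>H,H\<^esub> a1))"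

end

(*
  Sums over coproducts are finite sums, so they commute with each other and with linear maps, and
  two vectors are equal once all linear functionals agree on them. Every identity thereby becomes
  one between scalar Sweedler sums of a product of pairings and one multilinear form. By
  coassociativity such a nested sum only depends on the multilinear summand and on the number of
  factors into which each argument is split, not on the order of the splittings. After expanding
  the pairings of products, both sides of associativity, of coassociativity, of multiplicativity of
  the coproduct and of the coaction, and of the identity for xi turn out to have the same summand.
  The counit laws use that phi(a, S^-1(b)) is the convolution inverse of phi with respect to the
  coopposite coproduct in b, which rests on the antipode reversing products.
*)

theory Submission
  imports Defs
begin

section \<open>Linear and bilinear maps on carriers\<close>

text \<open>A form in up to twenty variables is encoded as a function from lists to the field: its
  type does not depend on the number of variables, so a single induction covers coassociativity in
  all arities. Passing to functionals is what permits this, because the vector identities live in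
  differently nested tensor types. In each calculation the splitting positions are read off the
  nesting of the sums on either side, and the summand \<open>F\<close> numbers the factors of the
  first argument, then those of the second, and so on; comparing the two sides becomes a computation
  with lists of numbers. The endomorphism is absorbed by observing that \<phi>(\<tau>(a), b) is
  again a pairing of bialgebras, so that the twisted product can be studied for an arbitrary such
  pairing. Identities in H \<otimes> H are proved on pure tensors and extended by linearity one
  argument at a time.\<close>

lemma vec_space_zero_closed: "vec_space V \<Longrightarrow> 0 \<in> carrier V"
  unfolding vec_space_def module_iff_vector_space[symmetric] by (blast intro: module.subspace_0)

lemma linear_onI:
  assumes "\<And>x. x \<in> carrier V \<Longrightarrow> f x \<in> carrier W"
    and "\<And>x y. x \<in> carrier V \<Longrightarrow> y \<in> carrier V \<Longrightarrow> f (x + y) = f x + f y"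
    and "\<And>c x. x \<in> carrier V \<Longrightarrow> f (smult V c x) = smult W c (f x)"
  shows "linear_on V W f"
  using assms unfolding linear_on_def by blast

lemma
  assumes "linear_on V W f"
  shows linear_on_closed: "x \<in> carrier V \<Longrightarrow> f x \<in> carrier W"
    and linear_on_add: "x \<in> carrier V \<Longrightarrow> y \<in> carrier V \<Longrightarrow> f (x + y) = f x + f y"
    and linear_on_smult: "x \<in> carrier V \<Longrightarrow> f (smult V c x) = smult W c (f x)"
  using assms unfolding linear_on_def by blast+

lemma linear_on_zero: "vec_space V \<Longrightarrow> linear_on V W f \<Longrightarrow> f 0 = 0"
  using linear_on_add[of V W f 0 0] vec_space_zero_closed[of V] by simp

lemma linear_on_compose: "linear_on U V g \<Longrightarrow> linear_on V W f \<Longrightarrow> linear_on U W (\<lambda>x. f (g x))"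
  unfolding linear_on_def by simp

lemma linear_on_ident: "linear_on V V (\<lambda>x. x)"
  unfolding linear_on_def by simp

lemma ground_simps [simp]: "smult ground = (*)" "carrier ground = UNIV"
    "one ground = 1" "mult ground = (*)"
  by (simp_all add: ground_def)

lemma linear_on_times_left: "linear_on V ground f \<Longrightarrow> linear_on V ground (\<lambda>x. f x * c)"
  unfolding linear_on_def by (simp add: algebra_simps)

lemma linear_on_times_right: "linear_on V ground f \<Longrightarrow> linear_on V ground (\<lambda>x. c * f x)"
  unfolding linear_on_def by (simp add: algebra_simps)

lemma linear_on_smult_left:
  "vec_space Z \<Longrightarrow> linear_on V ground f \<Longrightarrow> z \<in> carrier Z \<Longrightarrow> linear_on V Z (\<lambda>x. smult Z (f x) z)"
  unfolding linear_on_def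
  using vector_space.vector_space_assms(2,3)[OF vec_space.is_vector_space, of Z]
  by (auto simp: smult_closed)

lemma linear_on_smult_right:
  "vec_space Z \<Longrightarrow> linear_on V Z f \<Longrightarrow> linear_on V Z (\<lambda>x. smult Z c (f x))"
  unfolding linear_on_def
  using vector_space.vector_space_assms(1,3)[OF vec_space.is_vector_space, of Z]
  by (auto simp: smult_closed mult.commute)

lemma bilinear_onI:
  assumes "\<And>a. a \<in> carrier V \<Longrightarrow> linear_on W Z (f a)"
    and "\<And>b. b \<in> carrier W \<Longrightarrow> linear_on V Z (\<lambda>a. f a b)"
  shows "bilinear_on V W Z f"
  using assms unfolding bilinear_on_def by blast

lemma bilinear_on_left:
  "bilinear_on V W Z f \<Longrightarrow> linear_on U V g \<Longrightarrow> b \<in> carrier W \<Longrightarrow> linear_on U Z (\<lambda>x. f (g x) b)"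
  using linear_on_compose[of U V g Z "\<lambda>a. f a b"] unfolding bilinear_on_def by simp

lemma bilinear_on_right:
  "bilinear_on V W Z f \<Longrightarrow> linear_on U W g \<Longrightarrow> a \<in> carrier V \<Longrightarrow> linear_on U Z (\<lambda>x. f a (g x))"
  using linear_on_compose[of U W g Z "f a"] unfolding bilinear_on_def by simp

lemma bilinear_on_closed:
  "bilinear_on V W Z f \<Longrightarrow> a \<in> carrier V \<Longrightarrow> b \<in> carrier W \<Longrightarrow> f a b \<in> carrier Z"
  unfolding bilinear_on_def linear_on_def by blast

lemma bilinear_on_compose_linear:
  "bilinear_on V W Z f \<Longrightarrow> linear_on Z U L \<Longrightarrow> bilinear_on V W U (\<lambda>a b. L (f a b))"
  unfolding bilinear_on_def by (auto intro: linear_on_compose[where V = Z and f = L])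

text \<open>A functional that is nonzero on x - y exists on the ambient vector space, and its
  restriction to the carrier is still linear.\<close>

lemma functional_eqI:
  assumes Z: "vec_space Z" and xy: "x \<in> carrier Z" "y \<in> carrier Z"
    and eq: "\<And>L. linear_on Z ground L \<Longrightarrow> L x = L y"
  shows "x = y"
proof (rule ccontr)
  assume "x \<noteq> y"
  then obtain l where l: "Vector_Spaces.linear (smult Z) (*) l" "l (x - y) \<noteq> 0"
    using separating_functional[OF vec_space.is_vector_space[OF Z], of "x - y"] by auto
  interpret l: Vector_Spaces.linear "smult Z" "(*)" l by fact
  have "linear_on Z ground l"
    by (rule linear_onI) (auto simp: l.add l.scale)
  from eq[OF this] l(2) show False by (simp add: l.diff)
qed

section \<open>Sums over representations of tensors\<close>

text \<open>Naming the list chosen inside \<open>tensor_lift\<close> shows that all lifted maps at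
  one tensor are sums over the same list, whatever the summand is.\<close>

definition tensor_rep :: "('f::field, 'a::ab_group_add, 'x) vspace_scheme
    \<Rightarrow> ('f, 'b::ab_group_add, 'y) vspace_scheme \<Rightarrow> ('f, 'a, 'b) tensor \<Rightarrow> ('a \<times> 'b) list" where
  "tensor_rep V W t = (SOME xs. represents V W xs t)"

lemma tensor_lift_rep: "tensor_lift V W f t = (\<Sum>(a, b)\<leftarrow>tensor_rep V W t. f a b)"
  by (simp add: tensor_lift_def tensor_rep_def)

lemma represents_tensor_rep: "t \<in> carrier (V \<Otimes> W) \<Longrightarrow> represents V W (tensor_rep V W t) t"
  unfolding tensor_rep_def tensor_space_def by (auto intro: someI)

lemma set_tensor_rep: "t \<in> carrier (V \<Otimes> W) \<Longrightarrow> set (tensor_rep V W t) \<subseteq> carrier V \<times> carrier W"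
  using represents_tensor_rep[of t V W] by (simp add: represents_def)

lemma tensor_lift_cong:
  assumes "t \<in> carrier (V \<Otimes> W)"
    and "\<And>x y. x \<in> carrier V \<Longrightarrow> y \<in> carrier W \<Longrightarrow> f x y = g x y"
  shows "tensor_lift V W f t = tensor_lift V W g t"
  unfolding tensor_lift_rep using set_tensor_rep[OF assms(1)] assms(2)
  by (intro arg_cong[where f = sum_list] map_cong) auto

lemma sum_list_swap:
  "(\<Sum>p\<leftarrow>xs. \<Sum>q\<leftarrow>ys. g p q) = (\<Sum>q\<leftarrow>ys. \<Sum>p\<leftarrow>xs. (g p q :: 'a::ab_group_add))"
  by (induction xs) (auto simp: sum_list_addf)

text \<open>Both sides are double sums over the same two chosen lists, so this is an exchange of
  finite sums.\<close>

lemma tensor_lift_swap: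
  "tensor_lift V W (\<lambda>x y. tensor_lift V' W' (\<lambda>z w. f x y z w) t) s =
   tensor_lift V' W' (\<lambda>z w. tensor_lift V W (\<lambda>x y. f x y z w) s) t"
  unfolding tensor_lift_rep case_prod_unfold by (rule sum_list_swap)

lemma tensor_lift_distrib:
  fixes f :: "_ \<Rightarrow> _ \<Rightarrow> 'f::field"
  shows "c * tensor_lift V W f t = tensor_lift V W (\<lambda>x y. c * f x y) t"
    and "tensor_lift V W f t * c = tensor_lift V W (\<lambda>x y. f x y * c) t"
  unfolding tensor_lift_rep case_prod_unfold
  by (simp_all add: sum_list_const_mult sum_list_mult_const)

text \<open>Closure and linearity form one statement because additivity of L can only be used once
  the partial sum is known to lie in the carrier.\<close>

lemma linear_on_sum_list:
  assumes V: "vec_space V" and L: "linear_on V W L"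
  shows "set xs \<subseteq> P \<Longrightarrow> (\<And>x. x \<in> P \<Longrightarrow> f x \<in> carrier V) \<Longrightarrow>
    (\<Sum>x\<leftarrow>xs. f x) \<in> carrier V \<and> L (\<Sum>x\<leftarrow>xs. f x) = (\<Sum>x\<leftarrow>xs. L (f x))"
  by (induction xs)
    (auto simp: vec_space_zero_closed[OF V] linear_on_zero[OF V L] linear_on_add[OF L] add_closed[OF V])

lemma
  assumes "t \<in> carrier (V \<Otimes> W)" and "vec_space Z"
    and "\<And>x y. x \<in> carrier V \<Longrightarrow> y \<in> carrier W \<Longrightarrow> f x y \<in> carrier Z"
  shows tensor_lift_closed: "tensor_lift V W f t \<in> carrier Z"
    and linear_on_tensor_lift: "linear_on Z U L \<Longrightarrow>
      L (tensor_lift V W f t) = tensor_lift V W (\<lambda>x y. L (f x y)) t"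
  using linear_on_sum_list[OF assms(2) linear_on_ident set_tensor_rep[OF assms(1)], of "case_prod f"]
    linear_on_sum_list[OF assms(2) _ set_tensor_rep[OF assms(1)], of U L "case_prod f"] assms(3)
  unfolding tensor_lift_rep by (auto simp: case_prod_unfold)

lemma linear_on_sum_list_param:
  assumes Z: "vec_space Z"
  shows "set xs \<subseteq> P \<Longrightarrow> (\<And>x. x \<in> P \<Longrightarrow> linear_on U Z (\<lambda>z. f z x)) \<Longrightarrow>
    linear_on U Z (\<lambda>z. \<Sum>x\<leftarrow>xs. f z x)"
proof (induction xs)
  case Nil
  interpret Z: vector_space "smult Z" by (rule vec_space.is_vector_space[OF Z])
  show ?case by (rule linear_onI) (simp_all add: vec_space_zero_closed[OF Z])
next
  case (Cons x xs)
  interpret Z: vector_space "smult Z" by (rule vec_space.is_vector_space[OF Z])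
  have "linear_on U Z (\<lambda>z. f z x)" "linear_on U Z (\<lambda>z. \<Sum>x\<leftarrow>xs. f z x)"
    using Cons by auto
  then show ?case
    unfolding linear_on_def by (auto simp: Z.scale_right_distrib add_closed[OF Z])
qed

text \<open>Here t, and with it the list of summation, is fixed while the summand varies. The
  dependence on t is the matter of \<open>linear_on_tensor_lift_arg\<close>, where bilinearity of
  the summand makes up for the changing list.\<close>

lemma linear_on_tensor_lift_param:
  assumes "t \<in> carrier (V \<Otimes> W)" and "vec_space Z"
    and "\<And>x y. x \<in> carrier V \<Longrightarrow> y \<in> carrier W \<Longrightarrow> linear_on U Z (\<lambda>z. f z x y)"
  shows "linear_on U Z (\<lambda>z. tensor_lift V W (f z) t)"
  using linear_on_sum_list_param[OF assms(2) set_tensor_rep[OF assms(1)], of U "\<lambda>z. case_prod (f z)"]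
    assms(3)
  unfolding tensor_lift_rep by auto

lemma linear_on_tensor_lift_arg:
  assumes "vec_space V" "vec_space W" "vec_space Z" "bilinear_on V W Z f" "linear_on U (V \<Otimes> W) g"
  shows "linear_on U Z (\<lambda>z. tensor_lift V W f (g z))"
  by (rule linear_on_compose[OF assms(5) tensor_universal(1)[OF assms(1-4)]])

lemma linear_on_pure_left:
  assumes "vec_space V" "vec_space W" "linear_on U V g" "b \<in> carrier W"
  shows "linear_on U (V \<Otimes> W) (\<lambda>z. g z \<otimes>\<^bsub>V,W\<^esub> b)"
  by (rule bilinear_on_left[OF bilinear_pure_tensor[OF assms(1,2)] assms(3,4)])

lemma linear_on_pure_right:
  assumes "vec_space V" "vec_space W" "linear_on U W g" "a \<in> carrier V"
  shows "linear_on U (V \<Otimes> W) (\<lambda>z. a \<otimes>\<^bsub>V,W\<^esub> g z)"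
  by (rule bilinear_on_right[OF bilinear_pure_tensor[OF assms(1,2)] assms(3,4)])

text \<open>Both maps are the lift of one bilinear map, by the uniqueness clause of
  \<open>tensor_universal\<close>. This carries identities from pure tensors to the whole tensor
  product.\<close>

lemma linear_on_tensor_eqI:
  assumes V: "vec_space V" and W: "vec_space W" and Z: "vec_space Z"
    and f: "linear_on (V \<Otimes> W) Z f" and g: "linear_on (V \<Otimes> W) Z g"
    and eq: "\<And>a b. a \<in> carrier V \<Longrightarrow> b \<in> carrier W \<Longrightarrow> f (a \<otimes>\<^bsub>V,W\<^esub> b) = g (a \<otimes>\<^bsub>V,W\<^esub> b)"
    and t: "t \<in> carrier (V \<Otimes> W)"
  shows "f t = g t"
proof -
  have b: "bilinear_on V W Z (\<lambda>a b. g (a \<otimes>\<^bsub>V,W\<^esub> b))"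
    by (rule bilinear_on_compose_linear[OF bilinear_pure_tensor[OF V W] g])
  note u = tensor_universal(3)[OF V W Z b _ _ t]
  from u[OF f] u[OF g] eq show ?thesis by simp
qed

lemma
  assumes V: "vec_space V" and W: "vec_space W" and V': "vec_space V'" and W': "vec_space W'"
    and f: "linear_on V V' f" and g: "linear_on W W' g"
  shows linear_on_tensor_map: "linear_on (V \<Otimes> W) (V' \<Otimes> W') (tensor_map V W V' W' f g)"
    and tensor_map_pure: "a \<in> carrier V \<Longrightarrow> b \<in> carrier W \<Longrightarrow>
      tensor_map V W V' W' f g (a \<otimes>\<^bsub>V,W\<^esub> b) = f a \<otimes>\<^bsub>V',W'\<^esub> g b"
proof -
  have *: "bilinear_on V W (V' \<Otimes> W') (\<lambda>a b. f a \<otimes>\<^bsub>V',W'\<^esub> g b)"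
    by (intro bilinear_onI linear_on_pure_left linear_on_pure_right V' W' f g
        linear_on_closed[OF f] linear_on_closed[OF g])
  note u = tensor_universal[OF V W vec_space_tensor[OF V'] *]
  show "linear_on (V \<Otimes> W) (V' \<Otimes> W') (tensor_map V W V' W' f g)"
    unfolding tensor_map_def by (rule u(1))
  show "tensor_map V W V' W' f g (a \<otimes>\<^bsub>V,W\<^esub> b) = f a \<otimes>\<^bsub>V',W'\<^esub> g b"
    if "a \<in> carrier V" "b \<in> carrier W"
    unfolding tensor_map_def by (rule u(2)[OF that])
qed

lemma
  assumes U: "vec_space U" and V: "vec_space V" and W: "vec_space W"
  shows linear_on_tensor_assoc:
      "linear_on ((U \<Otimes> V) \<Otimes> W) (U \<Otimes> V \<Otimes> W) (tensor_assoc U V W)"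
    and tensor_assoc_pure: "a \<in> carrier U \<Longrightarrow> b \<in> carrier V \<Longrightarrow> c \<in> carrier W \<Longrightarrow>
      tensor_assoc U V W ((a \<otimes>\<^bsub>U,V\<^esub> b) \<otimes>\<^bsub>U \<Otimes> V,W\<^esub> c) =
      a \<otimes>\<^bsub>U,V \<Otimes> W\<^esub> (b \<otimes>\<^bsub>V,W\<^esub> c)"
proof -
  note UV = vec_space_tensor[OF U, of V] and VW = vec_space_tensor[OF V, of W]
    and UVW = vec_space_tensor[OF U, of "V \<Otimes> W"]
  have 1: "bilinear_on U V (U \<Otimes> V \<Otimes> W) (\<lambda>a b. a \<otimes>\<^bsub>U,V \<Otimes> W\<^esub> (b \<otimes>\<^bsub>V,W\<^esub> c))"
    if "c \<in> carrier W" for c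
    using that by (intro bilinear_onI linear_on_pure_left linear_on_pure_right U V W VW
        linear_on_ident pure_tensor_closed)
  have 2: "bilinear_on (U \<Otimes> V) W (U \<Otimes> V \<Otimes> W)
      (\<lambda>t c. tensor_lift U V (\<lambda>a b. a \<otimes>\<^bsub>U,V \<Otimes> W\<^esub> (b \<otimes>\<^bsub>V,W\<^esub> c)) t)"
    by (intro bilinear_onI tensor_universal(1)[OF U V UVW 1] linear_on_tensor_lift_param
        UVW linear_on_pure_right U V W VW linear_on_ident)
  show "linear_on ((U \<Otimes> V) \<Otimes> W) (U \<Otimes> V \<Otimes> W) (tensor_assoc U V W)"
    unfolding tensor_assoc_def by (rule tensor_universal(1)[OF UV W UVW 2])
  show "tensor_assoc U V W ((a \<otimes>\<^bsub>U,V\<^esub> b) \<otimes>\<^bsub>U \<Otimes> V,W\<^esub> c) =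
      a \<otimes>\<^bsub>U,V \<Otimes> W\<^esub> (b \<otimes>\<^bsub>V,W\<^esub> c)"
    if "a \<in> carrier U" "b \<in> carrier V" "c \<in> carrier W"
    unfolding tensor_assoc_def
    using that
    by (simp add: tensor_universal(2)[OF UV W UVW 2] tensor_universal(2)[OF U V UVW 1]
        pure_tensor_closed)
qed

text \<open>The products of \<open>tensor_algebra\<close> and of \<open>iota_double\<close> both
  have this shape: a quadrilinear map lifted first in its last two arguments and then in its first
  two.\<close>

lemma
  assumes V: "vec_space V" and W: "vec_space W" and Z: "vec_space Z"
    and f: "\<And>b c d. \<lbrakk>b \<in> carrier W; c \<in> carrier V; d \<in> carrier W\<rbrakk> \<Longrightarrow> linear_on V Z (\<lambda>a. f a b c d)"
      "\<And>a c d. \<lbrakk>a \<in> carrier V; c \<in> carrier V; d \<in> carrier W\<rbrakk> \<Longrightarrow> linear_on W Z (\<lambda>b. f a b c d)"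
      "\<And>a b d. \<lbrakk>a \<in> carrier V; b \<in> carrier W; d \<in> carrier W\<rbrakk> \<Longrightarrow> linear_on V Z (\<lambda>c. f a b c d)"
      "\<And>a b c. \<lbrakk>a \<in> carrier V; b \<in> carrier W; c \<in> carrier V\<rbrakk> \<Longrightarrow> linear_on W Z (\<lambda>d. f a b c d)"
  defines "F \<equiv> \<lambda>s t. tensor_lift V W (\<lambda>a b. tensor_lift V W (\<lambda>c d. f a b c d) t) s"
  shows tensor_lift2_bilinear: "bilinear_on (V \<Otimes> W) (V \<Otimes> W) Z F"
    and tensor_lift2_pure: "\<lbrakk>a \<in> carrier V; b \<in> carrier W; c \<in> carrier V; d \<in> carrier W\<rbrakk> \<Longrightarrow>
      F (a \<otimes>\<^bsub>V,W\<^esub> b) (c \<otimes>\<^bsub>V,W\<^esub> d) = f a b c d"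
proof -
  have 1: "bilinear_on V W Z (\<lambda>c d. f a b c d)" if "a \<in> carrier V" "b \<in> carrier W" for a b
    using that by (intro bilinear_onI f)
  have 2: "bilinear_on V W Z (\<lambda>a b. tensor_lift V W (\<lambda>c d. f a b c d) t)"
    if "t \<in> carrier (V \<Otimes> W)" for t
    using that by (intro bilinear_onI linear_on_tensor_lift_param Z f)
  show "bilinear_on (V \<Otimes> W) (V \<Otimes> W) Z F"
    unfolding F_def
    by (intro bilinear_onI tensor_universal(1)[OF V W Z 2] linear_on_tensor_lift_param Z
        tensor_universal(1)[OF V W Z 1])
  show "F (a \<otimes>\<^bsub>V,W\<^esub> b) (c \<otimes>\<^bsub>V,W\<^esub> d) = f a b c d"
    if "a \<in> carrier V" "b \<in> carrier W" "c \<in> carrier V" "d \<in> carrier W"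
    using that unfolding F_def
    by (simp add: tensor_universal(2)[OF V W Z 2] tensor_universal(2)[OF V W Z 1] pure_tensor_closed)
qed

text \<open>\<open>H\<^sup>\<iota>\<^sub>\<tau>\<close> and \<open>(H \<otimes> H)\<^sup>\<iota>\<close> are records different from \<open>H\<close> and \<open>H \<Otimes> H\<close> with the same underlying spaces.\<close>

definition same_space :: "('f::field, 'a::ab_group_add, 'x) vspace_scheme
    \<Rightarrow> ('f, 'a, 'y) vspace_scheme \<Rightarrow> bool" where
  "same_space V V' \<longleftrightarrow> carrier V = carrier V' \<and> smult V = smult V'"

lemma linear_on_same_space:
  "same_space V V' \<Longrightarrow> same_space W W' \<Longrightarrow> linear_on V W = linear_on V' W'"
  unfolding linear_on_def[abs_def] same_space_def by simp

lemma bilinear_on_same_space: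
  "same_space V V' \<Longrightarrow> same_space W W' \<Longrightarrow> same_space Z Z' \<Longrightarrow>
    bilinear_on V W Z = bilinear_on V' W' Z'"
  unfolding bilinear_on_def[abs_def] linear_on_def same_space_def by simp

text \<open>A pure tensor depends on the records only through the set of bilinear forms, which
  depends only on carriers and scalar multiplications. Hence the tensor constructions over both
  pairs of records are literally equal, not just isomorphic.\<close>

lemma pure_tensor_same_space:
  assumes "same_space V V'" "same_space W W'"
  shows "(a \<otimes>\<^bsub>V,W\<^esub> b) = (a \<otimes>\<^bsub>V',W'\<^esub> b)"
  unfolding pure_tensor_def bilinear_on_same_space[OF assms, of ground ground, unfolded same_space_def, simplified]
  ..

lemma represents_same_space:
  assumes "same_space V V'" "same_space W W'"
  shows "represents V W = represents V' W'"
  using assms unfolding represents_def[abs_def] pure_tensor_same_space[OF assms] same_space_def by simp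

lemma tensor_space_same_space:
  assumes "same_space V V'" "same_space W W'"
  shows "V \<Otimes> W = V' \<Otimes> W'"
  unfolding tensor_space_def represents_same_space[OF assms] ..

lemma tensor_lift_same_space:
  assumes "same_space V V'" "same_space W W'"
  shows "tensor_lift V W = tensor_lift V' W'"
  unfolding tensor_lift_def[abs_def] represents_same_space[OF assms] ..

lemma vec_space_same_space: "same_space V V' \<Longrightarrow> vec_space V = vec_space V'"
  unfolding vec_space_def same_space_def by simp

lemma tensor_map_same_space:
  assumes "same_space V V1" "same_space W W1" "same_space V' V1'" "same_space W' W1'"
  shows "tensor_map V W V' W' = tensor_map V1 W1 V1' W1'"
  unfolding tensor_map_def[abs_def] pure_tensor_same_space[OF assms(3,4)]
    tensor_lift_same_space[OF assms(1,2)] ..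

lemma tensor_assoc_same_space:
  assumes "same_space U U'" "same_space V V'" "same_space W W'"
  shows "tensor_assoc U V W = tensor_assoc U' V' W'"
proof -
  have *: "same_space (U \<Otimes> V) (U' \<Otimes> V')" "same_space (V \<Otimes> W) (V' \<Otimes> W')"
    by (simp_all add: same_space_def tensor_space_same_space[OF assms(1,2)] tensor_space_same_space[OF assms(2,3)])
  show ?thesis
    unfolding tensor_assoc_def pure_tensor_same_space[OF assms(1) *(2)] pure_tensor_same_space[OF assms(2,3)]
      tensor_lift_same_space[OF assms(1,2)] tensor_lift_same_space[OF *(1) assms(3)] ..
qed

lemma
  assumes A: "vec_space A" "bilinear_on A A A (mult A)" and B: "vec_space B" "bilinear_on B B B (mult B)"
  shows tensor_algebra_mult_bilinear:
      "bilinear_on (A \<Otimes> B) (A \<Otimes> B) (A \<Otimes> B) (mult (tensor_algebra A B))"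
    and tensor_algebra_mult_pure:
      "\<lbrakk>a \<in> carrier A; b \<in> carrier B; c \<in> carrier A; d \<in> carrier B\<rbrakk> \<Longrightarrow>
        mult (tensor_algebra A B) (a \<otimes>\<^bsub>A,B\<^esub> b) (c \<otimes>\<^bsub>A,B\<^esub> d) = mult A a c \<otimes>\<^bsub>A,B\<^esub> mult B b d"
proof -
  note lin = bilinear_on_left[OF A(2)] bilinear_on_right[OF A(2)] bilinear_on_left[OF B(2)]
    bilinear_on_right[OF B(2)] linear_on_pure_left[OF A(1) B(1)] linear_on_pure_right[OF A(1) B(1)]
    linear_on_ident bilinear_on_closed[OF A(2)] bilinear_on_closed[OF B(2)]
  have *: "mult (tensor_algebra A B) = (\<lambda>s t. tensor_lift A B (\<lambda>a b. tensor_lift A B (\<lambda>c d.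
       mult A a c \<otimes>\<^bsub>A,B\<^esub> mult B b d) t) s)"
    by (simp add: tensor_algebra_def)
  show "bilinear_on (A \<Otimes> B) (A \<Otimes> B) (A \<Otimes> B) (mult (tensor_algebra A B))"
    unfolding * by (rule tensor_lift2_bilinear[OF A(1) B(1) vec_space_tensor[OF A(1)]];
        intro lin; assumption)
  show "mult (tensor_algebra A B) (a \<otimes>\<^bsub>A,B\<^esub> b) (c \<otimes>\<^bsub>A,B\<^esub> d) = mult A a c \<otimes>\<^bsub>A,B\<^esub> mult B b d"
    if "a \<in> carrier A" "b \<in> carrier B" "c \<in> carrier A" "d \<in> carrier B"
    unfolding * by (rule tensor_lift2_pure[OF A(1) B(1) vec_space_tensor[OF A(1), of B],
          where f = "\<lambda>a b c d. mult A a c \<otimes>\<^bsub>A,B\<^esub> mult B b d"])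
      (intro lin that; assumption?)+
qed


section \<open>Sweedler sums\<close>

context coalgebra
begin

lemma vec_space_C: "vec_space C" ..

lemma vec_space_CC: "vec_space (C \<Otimes> C)"
  by (rule vec_space_tensor[OF vec_space_C])

lemma comult_closed: "a \<in> carrier C \<Longrightarrow> comult C a \<in> carrier (C \<Otimes> C)"
  by (rule linear_on_closed[OF comult_linear])

lemma sweedler2_cong:
  assumes "a \<in> carrier C"
    and "\<And>x y. x \<in> carrier C \<Longrightarrow> y \<in> carrier C \<Longrightarrow> F x y = G x y"
  shows "sweedler2 C F a = sweedler2 C G a"
  unfolding sweedler2_def by (rule tensor_lift_cong[OF comult_closed[OF assms(1)] assms(2)])

text \<open>Shaped as a congruence rule: below a Sweedler sum, rewriting may assume that the bound
  factors lie in the carrier, as almost all identities require.\<close>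

lemma sweedler2_cong_simp:
  assumes "a = b" and "b \<in> carrier C"
    and "\<And>x y. x \<in> carrier C \<Longrightarrow> y \<in> carrier C \<Longrightarrow> F x y = G x y"
  shows "sweedler2 C F a = sweedler2 C G b"
  unfolding assms(1) by (rule sweedler2_cong[OF assms(2,3)])

lemma sweedler2_swap:
  "sweedler2 C (\<lambda>x y. sweedler2 C (\<lambda>z w. F x y z w) b) a =
   sweedler2 C (\<lambda>z w. sweedler2 C (\<lambda>x y. F x y z w) a) b"
  unfolding sweedler2_def by (rule tensor_lift_swap)

lemma sweedler2_distrib:
  fixes F :: "_ \<Rightarrow> _ \<Rightarrow> 'f"
  shows "c * sweedler2 C F a = sweedler2 C (\<lambda>x y. c * F x y) a"
    and "sweedler2 C F a * c = sweedler2 C (\<lambda>x y. F x y * c) a"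
  unfolding sweedler2_def by (simp_all add: tensor_lift_distrib)

lemma sweedler2_closed:
  "a \<in> carrier C \<Longrightarrow> vec_space Z \<Longrightarrow>
    (\<And>x y. x \<in> carrier C \<Longrightarrow> y \<in> carrier C \<Longrightarrow> F x y \<in> carrier Z) \<Longrightarrow>
    sweedler2 C F a \<in> carrier Z"
  unfolding sweedler2_def by (rule tensor_lift_closed[OF comult_closed])

lemma linear_on_sweedler2:
  assumes "linear_on Z U L" "vec_space Z" "a \<in> carrier C"
    and "\<And>x y. x \<in> carrier C \<Longrightarrow> y \<in> carrier C \<Longrightarrow> F x y \<in> carrier Z"
  shows "L (sweedler2 C F a) = sweedler2 C (\<lambda>x y. L (F x y)) a"
  unfolding sweedler2_def
  by (rule linear_on_tensor_lift[OF comult_closed[OF assms(3)] assms(2,4,1)])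

lemma linear_on_sweedler2_param:
  assumes "vec_space Z" "a \<in> carrier C"
    and "\<And>x y. x \<in> carrier C \<Longrightarrow> y \<in> carrier C \<Longrightarrow> linear_on U Z (\<lambda>z. F z x y)"
  shows "linear_on U Z (\<lambda>z. sweedler2 C (F z) a)"
  unfolding sweedler2_def
  by (rule linear_on_tensor_lift_param[OF comult_closed[OF assms(2)] assms(1,3)])

lemma linear_on_sweedler2_arg:
  assumes "vec_space Z" "linear_on U C g"
    and "\<And>x. x \<in> carrier C \<Longrightarrow> linear_on C Z (\<lambda>y. F x y)"
    and "\<And>y. y \<in> carrier C \<Longrightarrow> linear_on C Z (\<lambda>x. F x y)"
  shows "linear_on U Z (\<lambda>z. sweedler2 C F (g z))"
  unfolding sweedler2_def
  by (rule linear_on_tensor_lift_arg[OF vec_space_C vec_space_C assms(1)])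
    (auto intro: bilinear_onI assms linear_on_compose[OF assms(2) comult_linear])

text \<open>The functional on C \<otimes> (C \<otimes> C) induced by F is applied to both sides of
  the coassociativity axiom.\<close>

lemma sweedler2_coassoc:
  fixes F :: "'a \<Rightarrow> 'a \<Rightarrow> 'a \<Rightarrow> 'f"
  assumes a: "a \<in> carrier C"
    and F1: "\<And>y z. y \<in> carrier C \<Longrightarrow> z \<in> carrier C \<Longrightarrow> linear_on C ground (\<lambda>x. F x y z)"
    and F2: "\<And>x z. x \<in> carrier C \<Longrightarrow> z \<in> carrier C \<Longrightarrow> linear_on C ground (\<lambda>y. F x y z)"
    and F3: "\<And>x y. x \<in> carrier C \<Longrightarrow> y \<in> carrier C \<Longrightarrow> linear_on C ground (\<lambda>z. F x y z)"
  shows "sweedler2 C (\<lambda>x y. sweedler2 C (\<lambda>u v. F u v y) x) a =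
    sweedler2 C (\<lambda>x y. sweedler2 C (\<lambda>u v. F x u v) y) a"
proof -
  note G = vec_space_ground
  have CCC: "vec_space (C \<Otimes> C \<Otimes> C)" "vec_space ((C \<Otimes> C) \<Otimes> C)"
    by (simp_all add: vec_space_tensor vec_space_C)
  have F_in: "bilinear_on C C ground (F x)" if "x \<in> carrier C" for x
    using that by (intro bilinear_onI F2 F3)
  define \<Phi> where "\<Phi> = tensor_lift C (C \<Otimes> C) (\<lambda>x t. tensor_lift C C (F x) t)"
  have bil: "bilinear_on C (C \<Otimes> C) ground (\<lambda>x t. tensor_lift C C (F x) t)"
    by (intro bilinear_onI tensor_universal(1)[OF vec_space_C vec_space_C G F_in] linear_on_tensor_lift_param G F1)
  have \<Phi>_lin: "linear_on (C \<Otimes> C \<Otimes> C) ground \<Phi>"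
    unfolding \<Phi>_def by (rule tensor_universal(1)[OF vec_space_C vec_space_CC G bil])
  have \<Phi>_pure: "\<Phi> (x \<otimes>\<^bsub>C,C \<Otimes> C\<^esub> t) = tensor_lift C C (F x) t"
    if "x \<in> carrier C" "t \<in> carrier (C \<Otimes> C)" for x t
    unfolding \<Phi>_def by (rule tensor_universal(2)[OF vec_space_C vec_space_CC G bil that])
  have "\<Phi> (tensor_assoc C C C (tensor_map C C (C \<Otimes> C) C (comult C) id (comult C a))) =
      tensor_lift C C (\<lambda>x y. \<Phi> (tensor_assoc C C C (comult C x \<otimes>\<^bsub>C \<Otimes> C,C\<^esub> y))) (comult C a)"
    unfolding tensor_map_def id_def
    by (rule linear_on_tensor_lift[where Z = "(C \<Otimes> C) \<Otimes> C" and U = ground])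
      (auto intro!: CCC comult_closed a pure_tensor_closed linear_on_compose[OF linear_on_tensor_assoc[OF vec_space_C vec_space_C vec_space_C] \<Phi>_lin])
  also have "\<dots> = sweedler2 C (\<lambda>x y. sweedler2 C (\<lambda>u v. F u v y) x) a"
    unfolding sweedler2_def
  proof (rule tensor_lift_cong[OF comult_closed[OF a]])
    fix x y assume xy: "x \<in> carrier C" "y \<in> carrier C"
    have "linear_on (C \<Otimes> C) ground (\<lambda>t. \<Phi> (tensor_assoc C C C (t \<otimes>\<^bsub>C \<Otimes> C,C\<^esub> y)))"
      by (intro linear_on_compose[OF _ \<Phi>_lin] linear_on_compose[OF _ linear_on_tensor_assoc[OF vec_space_C vec_space_C vec_space_C]]
          linear_on_pure_left vec_space_CC vec_space_C linear_on_ident xy)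
    moreover have "\<Phi> (tensor_assoc C C C ((u \<otimes>\<^bsub>C,C\<^esub> v) \<otimes>\<^bsub>C \<Otimes> C,C\<^esub> y)) = F u v y"
      if "u \<in> carrier C" "v \<in> carrier C" for u v
      using that xy by (simp add: tensor_assoc_pure[OF vec_space_C vec_space_C vec_space_C] \<Phi>_pure pure_tensor_closed
          tensor_universal(2)[OF vec_space_C vec_space_C G F_in])
    ultimately show "\<Phi> (tensor_assoc C C C (comult C x \<otimes>\<^bsub>C \<Otimes> C,C\<^esub> y)) =
      tensor_lift C C (\<lambda>u v. F u v y) (comult C x)"
      using xy by (intro tensor_universal(3)[OF vec_space_C vec_space_C G] bilinear_onI F1 F2 comult_closed) auto
  qed
  finally have 1: "sweedler2 C (\<lambda>x y. sweedler2 C (\<lambda>u v. F u v y) x) a =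
      \<Phi> (tensor_map C C C (C \<Otimes> C) id (comult C) (comult C a))"
    by (simp add: coassoc[OF a])
  have "\<dots> = tensor_lift C C (\<lambda>x y. \<Phi> (x \<otimes>\<^bsub>C,C \<Otimes> C\<^esub> comult C y)) (comult C a)"
    unfolding tensor_map_def id_def
    by (rule linear_on_tensor_lift[OF comult_closed[OF a] CCC(1) _ \<Phi>_lin])
      (auto intro!: comult_closed pure_tensor_closed)
  also have "\<dots> = sweedler2 C (\<lambda>x y. sweedler2 C (\<lambda>u v. F x u v) y) a"
    unfolding sweedler2_def
    by (rule tensor_lift_cong[OF comult_closed[OF a]]) (simp add: \<Phi>_pure comult_closed)
  finally show ?thesis using 1 by simp
qed

lemma sweedler2_counit:
  assumes a: "a \<in> carrier C" and F: "linear_on C ground F"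
  shows "sweedler2 C (\<lambda>x y. counit C x * F y) a = F a"
    and "sweedler2 C (\<lambda>x y. counit C y * F x) a = F a"
    and "sweedler2 C (\<lambda>x y. F y * counit C x) a = F a"
    and "sweedler2 C (\<lambda>x y. F x * counit C y) a = F a"
proof -
  have "F a = F (sweedler2 C (\<lambda>x y. smult C (counit C x) y) a)"
    using counit_left[OF a] by (simp add: sweedler2_def)
  also have "\<dots> = sweedler2 C (\<lambda>x y. F (smult C (counit C x) y)) a"
    by (rule linear_on_sweedler2[OF F vec_space_C a]) (simp add: smult_closed vec_space_C)
  also have "\<dots> = sweedler2 C (\<lambda>x y. counit C x * F y) a"
    by (rule sweedler2_cong[OF a]) (simp add: linear_on_smult[OF F])
  finally show 1: "sweedler2 C (\<lambda>x y. counit C x * F y) a = F a" ..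
  have "F a = F (sweedler2 C (\<lambda>x y. smult C (counit C y) x) a)"
    using counit_right[OF a] by (simp add: sweedler2_def)
  also have "\<dots> = sweedler2 C (\<lambda>x y. F (smult C (counit C y) x)) a"
    by (rule linear_on_sweedler2[OF F vec_space_C a]) (simp add: smult_closed vec_space_C)
  also have "\<dots> = sweedler2 C (\<lambda>x y. counit C y * F x) a"
    by (rule sweedler2_cong[OF a]) (simp add: linear_on_smult[OF F])
  finally show 2: "sweedler2 C (\<lambda>x y. counit C y * F x) a = F a" ..
  show "sweedler2 C (\<lambda>x y. F y * counit C x) a = F a" using 1 by (simp add: mult.commute)
  show "sweedler2 C (\<lambda>x y. F x * counit C y) a = F a" using 2 by (simp add: mult.commute)
qed

subsection \<open>Coassociativity for iterated splittings\<close>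

text \<open>Exhibiting the varying slot as \<open>us @ x # vs\<close> suits the inductions below,
  which peel factors off the front of the list.\<close>

definition multilinear :: "nat \<Rightarrow> ('a list \<Rightarrow> 'f) \<Rightarrow> bool" where
  "multilinear n F \<longleftrightarrow> (\<forall>us vs. set us \<subseteq> carrier C \<longrightarrow> set vs \<subseteq> carrier C \<longrightarrow> length us + length vs + 1 = n \<longrightarrow>
     linear_on C ground (\<lambda>x. F (us @ x # vs)))"

lemma multilinearD: "multilinear n F \<Longrightarrow> set us \<subseteq> carrier C \<Longrightarrow> set vs \<subseteq> carrier C \<Longrightarrow>
    length us + length vs + 1 = n \<Longrightarrow> linear_on C ground (\<lambda>x. F (us @ x # vs))"
  unfolding multilinear_def by blast

text \<open>Concrete summands are written with \<open>l ! i\<close>; for these, linearity is checked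
  by overwriting one position at a time.\<close>

lemma multilinear_nthI:
  assumes "\<And>i xs. i < n \<Longrightarrow> length xs = n \<Longrightarrow> (\<And>j. j < n \<Longrightarrow> xs ! j \<in> carrier C) \<Longrightarrow>
    linear_on C ground (\<lambda>x. F (xs[i := x]))"
  shows "multilinear n F"
  unfolding multilinear_def
proof (intro allI impI)
  fix us vs
  assume uv: "set us \<subseteq> carrier C" "set vs \<subseteq> carrier C" "length us + length vs + 1 = n"
  \<comment> \<open>Some element of the carrier has to occupy the open slot before it is
    overwritten; 0 serves as this filler.\<close>
  have "0 \<in> carrier C" by (rule vec_space_zero_closed[OF vec_space_C])
  with uv have "set (us @ 0 # vs) \<subseteq> carrier C" by auto
  then have "(us @ 0 # vs) ! j \<in> carrier C" if "j < n" for j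
    using that uv(3) by (intro subsetD[OF _ nth_mem]) auto
  moreover have "length (us @ 0 # vs) = n" using uv by simp
  ultimately have "linear_on C ground (\<lambda>x. F ((us @ 0 # vs)[length us := x]))"
    using uv(3) by (intro assms) auto
  then show "linear_on C ground (\<lambda>x. F (us @ x # vs))" by simp
qed

lemma multilinear_append:
  assumes "multilinear n F" "set l \<subseteq> carrier C" "n = length l + m"
  shows "multilinear m (\<lambda>l'. F (l @ l'))"
  unfolding multilinear_def
proof (intro allI impI)
  fix us vs
  assume "set us \<subseteq> carrier C" "set vs \<subseteq> carrier C" "length us + length vs + 1 = m"
  then show "linear_on C ground (\<lambda>x. F (l @ us @ x # vs))"
    using multilinearD[OF assms(1), of "l @ us" vs] assms(2,3) by simp
qed

lemma multilinear_Cons: "multilinear (Suc n) F \<Longrightarrow> x \<in> carrier C \<Longrightarrow> multilinear n (\<lambda>l. F (x # l))"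
  by (rule multilinear_append[of "Suc n" F "[x]" n, unfolded append_Cons append_Nil]) simp_all

text \<open>\<open>sweedler n F a\<close> sums over the iterated coproduct of \<open>a\<close> with \<open>n + 1\<close> tensor factors,
  which are passed to \<open>F\<close> as a list.\<close>

primrec sweedler :: "nat \<Rightarrow> ('a list \<Rightarrow> 'f) \<Rightarrow> 'a \<Rightarrow> 'f" where
  "sweedler 0 F a = F [a]"
| "sweedler (Suc n) F a = sweedler2 C (\<lambda>x y. sweedler n (\<lambda>l. F (x # l)) y) a"

lemma sweedler_cong:
  assumes "a \<in> carrier C"
    and "\<And>l. set l \<subseteq> carrier C \<Longrightarrow> length l = Suc n \<Longrightarrow> F l = G l"
  shows "sweedler n F a = sweedler n G a"
  using assms
proof (induction n arbitrary: F G a)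
  case (Suc n)
  show ?case unfolding sweedler.simps
    by (rule sweedler2_cong[OF Suc.prems(1)], rule Suc.IH) (auto intro!: Suc.prems(2))
qed simp

lemma linear_on_sweedler_param:
  assumes "a \<in> carrier C"
    and "\<And>l. set l \<subseteq> carrier C \<Longrightarrow> length l = Suc n \<Longrightarrow> linear_on U ground (\<lambda>z. F z l)"
  shows "linear_on U ground (\<lambda>z. sweedler n (F z) a)"
  using assms
proof (induction n arbitrary: F a)
  case (Suc n)
  show ?case unfolding sweedler.simps
    by (rule linear_on_sweedler2_param[OF vec_space_ground Suc.prems(1)], rule Suc.IH)
      (auto intro!: Suc.prems(2))
qed simp

lemma linear_on_sweedler:
  "multilinear (Suc n) F \<Longrightarrow> linear_on C ground (sweedler n F)"
proof (induction n arbitrary: F)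
  case 0
  then show ?case using multilinearD[of "Suc 0" F "[]" "[]"] by (simp add: linear_on_def)
next
  case (Suc n)
  have "linear_on C ground (\<lambda>z. sweedler2 C (\<lambda>x y. sweedler n (\<lambda>l. F (x # l)) y) z)"
    by (rule linear_on_sweedler2_arg[OF vec_space_ground linear_on_ident])
      (use multilinearD[OF Suc.prems, of "[]"] in
        \<open>auto intro!: Suc.IH multilinear_Cons[OF Suc.prems] linear_on_sweedler_param\<close>)
  then show ?case by (simp add: linear_on_def)
qed

lemma sweedler_swap:
  "sweedler2 C (\<lambda>x y. sweedler n (\<lambda>l. F x y l) b) a =
   sweedler n (\<lambda>l. sweedler2 C (\<lambda>x y. F x y l) a) b"
proof (induction n arbitrary: F b)
  case (Suc n)
  show ?case unfolding sweedler.simps sweedler2_swap[of _ b a] Suc.IH ..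
qed simp

text \<open>Coassociativity for an arbitrary first splitting: iterating the coproduct m times on one
  half and n times on the other gives m + n + 2 factors in the standard order. In the induction on
  m, \<open>sweedler2_coassoc\<close> detaches the first factor of the left half.\<close>

lemma sweedler_append:
  assumes "multilinear (m + n + 2) F" "a \<in> carrier C"
  shows "sweedler2 C (\<lambda>x y. sweedler m (\<lambda>l. sweedler n (\<lambda>l'. F (l @ l')) y) x) a =
    sweedler (Suc (m + n)) F a"
  using assms
proof (induction m arbitrary: F a)
  case (Suc m)
  have F: "linear_on C ground (\<lambda>x. sweedler m (\<lambda>l. sweedler n (\<lambda>l'. F (x # l @ l')) z) y)"
    if "y \<in> carrier C" "z \<in> carrier C" for y z
    using that multilinearD[OF Suc.prems(1), of "[]"] by (auto intro!: linear_on_sweedler_param)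
  have F': "multilinear (m + n + 2) (\<lambda>l. F (x # l))" if "x \<in> carrier C" for x
    using multilinear_Cons[OF _ that, of "m + n + 2" F] Suc.prems(1) by simp
  have G: "linear_on C ground (\<lambda>y. sweedler m (\<lambda>l. sweedler n (\<lambda>l'. F (x # l @ l')) z) y)"
    if "x \<in> carrier C" "z \<in> carrier C" for x z
    using that multilinearD[OF F', of x] by (auto intro!: linear_on_sweedler linear_on_sweedler_param simp: multilinear_def)
  have K: "linear_on C ground (\<lambda>z. sweedler m (\<lambda>l. sweedler n (\<lambda>l'. F (x # l @ l')) z) y)"
    if "x \<in> carrier C" "y \<in> carrier C" for x y
    using that by (auto intro!: linear_on_sweedler linear_on_sweedler_param multilinear_append[OF F'])
  show ?case
    using sweedler2_coassoc[OF Suc.prems(2) F G K] Suc.IH[OF F']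
    by (auto intro!: sweedler2_cong[OF Suc.prems(2)])
qed simp

text \<open>\<open>split_sum ops F env\<close> successively replaces the entry of the environment at each position in
  \<open>ops\<close> by the two factors of its coproduct, and finally evaluates \<open>F\<close>. Unfolding it gives nested
  Sweedler sums; the positions refer to the environment as enlarged by the preceding splittings.\<close>

primrec split_sum :: "nat list \<Rightarrow> ('a list \<Rightarrow> 'f) \<Rightarrow> 'a list \<Rightarrow> 'f" where
  "split_sum [] F env = F env"
| "split_sum (i # ops) F env =
    sweedler2 C (\<lambda>x y. split_sum ops F (take i env @ x # y # drop (Suc i) env)) (env ! i)"

text \<open>The normal form of a \<open>split_sum\<close>: the entry with count n is split into n +
  1 factors in one go, entries being treated from left to right.\<close>

primrec canonical_sum :: "nat list \<Rightarrow> ('a list \<Rightarrow> 'f) \<Rightarrow> 'a list \<Rightarrow> 'f" where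
  "canonical_sum [] F env = F env"
| "canonical_sum (n # ns) F env = sweedler n (\<lambda>l. canonical_sum ns (\<lambda>l'. F (l @ l')) (tl env)) (hd env)"

end

text \<open>Undoes one splitting on the level of counts: if the two factors of an entry are split m
  and n more times, the entry itself is split m + n + 1 times. The list is taken apart by
  \<open>hd\<close> and \<open>tl\<close>, so that evaluation only has to follow the
  position.\<close>

primrec merge_at :: "nat \<Rightarrow> nat list \<Rightarrow> nat list" where
  "merge_at 0 ns = Suc (hd ns + hd (tl ns)) # tl (tl ns)"
| "merge_at (Suc i) ns = hd ns # merge_at i (tl ns)"

lemma merge_at_numeral [simp]:
  "merge_at (numeral k) ns = hd ns # merge_at (pred_numeral k) (tl ns)"
  by (simp add: numeral_eq_Suc)

text \<open>\<open>split_counts ops k\<close> lists how often each of the \<open>k\<close> initial entries is split by \<open>ops\<close>.\<close>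

primrec split_counts :: "nat list \<Rightarrow> nat \<Rightarrow> nat list" where
  "split_counts [] k = replicate k 0"
| "split_counts (i # ops) k = merge_at i (split_counts ops (Suc k))"

primrec valid_splits :: "nat list \<Rightarrow> nat \<Rightarrow> bool" where
  "valid_splits [] k \<longleftrightarrow> True"
| "valid_splits (i # ops) k \<longleftrightarrow> i < k \<and> valid_splits ops (Suc k)"

lemma merge_at_properties:
  "i < k \<Longrightarrow> length ns = Suc k \<Longrightarrow>
    length (merge_at i ns) = k \<and> sum_list (merge_at i ns) = Suc (sum_list ns)"
proof (induction i arbitrary: ns k)
  case 0
  then obtain a b ns' where "ns = a # b # ns'" by (cases ns; cases "tl ns") auto
  with 0 show ?case by auto
next
  case (Suc i)
  then obtain a ns' k' where "ns = a # ns'" "k = Suc k'" by (cases ns; cases k) auto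
  with Suc show ?case by auto
qed

text \<open>Each splitting adds exactly one factor. So the counts determine the length of the final
  environment, which must equal the arity of the form.\<close>

lemma split_counts_properties:
  "valid_splits ops k \<Longrightarrow>
    length (split_counts ops k) = k \<and> sum_list (split_counts ops k) = length ops"
  by (induction ops arbitrary: k) (auto simp: merge_at_properties sum_list_replicate)

context coalgebra
begin

lemma linear_on_canonical_sum_param:
  assumes "length env = length ns" "set env \<subseteq> carrier C"
    and "\<And>l. set l \<subseteq> carrier C \<Longrightarrow> length l = sum_list ns + length ns \<Longrightarrow>
      linear_on U ground (\<lambda>z. F z l)"
  shows "linear_on U ground (\<lambda>z. canonical_sum ns (F z) env)"
  using assms
proof (induction ns arbitrary: F env)
  case (Cons n ns)
  then obtain x xs where env: "env = x # xs" by (cases env) auto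
  show ?case unfolding canonical_sum.simps env list.sel
    using Cons.prems
    by (intro linear_on_sweedler_param Cons.IH) (auto simp: env)
qed simp

text \<open>For i = 0 this is \<open>sweedler_append\<close>. For larger i the splitting commutes
  past the sum over the factors of the first entry, since it concerns a different entry.\<close>

lemma canonical_sum_merge:
  assumes "i < length env" "length ns = Suc (length env)" "set env \<subseteq> carrier C"
    and "multilinear (sum_list ns + length ns) F"
  shows "sweedler2 C (\<lambda>x y. canonical_sum ns F (take i env @ x # y # drop (Suc i) env)) (env ! i) =
    canonical_sum (merge_at i ns) F env"
  using assms
proof (induction i arbitrary: env ns F)
  case 0
  then obtain x xs m n ns' where env: "env = x # xs" and ns: "ns = m # n # ns'"
    by (cases env; cases ns; cases "tl ns") auto
  have "multilinear (m + n + 2) (\<lambda>l. canonical_sum ns' (\<lambda>l''. F (l @ l'')) xs)"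
    unfolding multilinear_def
    using 0 multilinearD[OF 0(4)] by (auto simp: env ns intro!: linear_on_canonical_sum_param)
  from sweedler_append[OF this, of x] 0 show ?case
    by (simp add: env ns)
next
  case (Suc i)
  then obtain x xs m ns' where env: "env = x # xs" and ns: "ns = m # ns'"
    by (cases env; cases ns) auto
  have "sweedler2 C (\<lambda>u v. canonical_sum ns' (\<lambda>l'. F (l @ l')) (take i xs @ u # v # drop (Suc i) xs))
      (xs ! i) = canonical_sum (merge_at i ns') (\<lambda>l'. F (l @ l')) xs"
    if "set l \<subseteq> carrier C" "length l = Suc m" for l
    using Suc.prems that by (intro Suc.IH multilinear_append[OF Suc.prems(4)]) (auto simp: env ns)
  then show ?case
    using Suc.prems
    by (auto simp: env ns sweedler_swap intro!: sweedler_cong)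
qed

text \<open>The operations are absorbed into the normal form from the last one backwards;
  \<open>canonical_sum_merge\<close> accounts for each.\<close>

lemma split_sum_canonical:
  assumes "valid_splits ops (length env)" "set env \<subseteq> carrier C"
    and "multilinear (length env + length ops) F"
  shows "split_sum ops F env = canonical_sum (split_counts ops (length env)) F env"
  using assms
proof (induction ops arbitrary: env)
  case Nil
  have "canonical_sum (replicate (length env) 0) F env = F env" for F :: "'a list \<Rightarrow> 'f"
    by (induction env arbitrary: F) auto
  then show ?case by simp
next
  case (Cons i ops)
  have i: "i < length env" and v: "valid_splits ops (Suc (length env))" using Cons.prems by auto
  have e: "env ! i \<in> carrier C" using i Cons.prems(2) by auto
  have "split_sum (i # ops) F env = sweedler2 C (\<lambda>x y. canonical_sum (split_counts ops (Suc (length env)))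
      F (take i env @ x # y # drop (Suc i) env)) (env ! i)"
    unfolding split_sum.simps
  proof (rule sweedler2_cong[OF e])
    fix x y assume xy: "x \<in> carrier C" "y \<in> carrier C"
    let ?e = "take i env @ x # y # drop (Suc i) env"
    have "set ?e \<subseteq> carrier C"
      using xy Cons.prems(2) set_take_subset[of i env] set_drop_subset[of "Suc i" env] by auto
    moreover have "length ?e = Suc (length env)" using i by auto
    ultimately show "split_sum ops F ?e = canonical_sum (split_counts ops (Suc (length env))) F ?e"
      using Cons.IH[of ?e] v Cons.prems(3) by (simp only: length_Cons add_Suc_right add_Suc)
  qed
  also have "\<dots> = canonical_sum (split_counts (i # ops) (length env)) F env"
    unfolding split_counts.simps
    using split_counts_properties[OF v] Cons.prems i
    by (intro canonical_sum_merge) (auto simp: add_ac)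
  finally show ?case .
qed

text \<open>The form in which generalised coassociativity is used. For concrete lists all premises
  except multilinearity and membership are evaluated numerically.\<close>

lemma split_sum_eqI:
  assumes "set env \<subseteq> carrier C" "multilinear n F"
    and "n = length env + length ops" "length ops = length ops'"
    and "valid_splits ops (length env)" "valid_splits ops' (length env)"
    and "split_counts ops (length env) = split_counts ops' (length env)"
  shows "split_sum ops F env = split_sum ops' F env"
  using assms split_sum_canonical[of ops env F] split_sum_canonical[of ops' env F] by simp

end

section \<open>Bialgebras and pairings\<close>

context assoc_algebra
begin

lemma mult_closed: "a \<in> carrier A \<Longrightarrow> b \<in> carrier A \<Longrightarrow> mult A a b \<in> carrier A"
  by (rule bilinear_on_closed[OF mult_bilinear])

lemmas linear_on_mult_left = bilinear_on_left[OF mult_bilinear]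
lemmas linear_on_mult_right = bilinear_on_right[OF mult_bilinear]

end

section \<open>Coproducts of products and of the unit\<close>

context bialgebra
begin

lemma counit_one: "counit B (one B) = 1"
  and counit_mult: "a \<in> carrier B \<Longrightarrow> b \<in> carrier B \<Longrightarrow> counit B (mult B a b) = counit B a * counit B b"
  using counit_hom by (auto simp: algebra_hom_def)

lemma comult_one: "comult B (one B) = one B \<otimes>\<^bsub>B,B\<^esub> one B"
  using comult_hom by (simp add: algebra_hom_def tensor_algebra_def)

lemma sweedler2_one:
  assumes "vec_space Z" "bilinear_on B B Z F"
  shows "sweedler2 B F (one B) = F (one B) (one B)"
  unfolding sweedler2_def comult_one
  by (rule tensor_universal(2)[OF vec_space_C vec_space_C assms one_closed one_closed])

lemma comult_mult:
  assumes "a \<in> carrier B" "b \<in> carrier B"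
  shows "comult B (mult B a b) =
    sweedler2 B (\<lambda>a1 a2. sweedler2 B (\<lambda>b1 b2. mult B a1 b1 \<otimes>\<^bsub>B,B\<^esub> mult B a2 b2) b) a"
  using comult_hom assms by (simp add: algebra_hom_def tensor_algebra_def sweedler2_def)

text \<open>The lift of F to the tensor square is pushed through the formula for the coproduct of a
  product.\<close>

lemma sweedler2_mult:
  assumes Z: "vec_space Z" and F1: "\<And>y. y \<in> carrier B \<Longrightarrow> linear_on B Z (\<lambda>x. F x y)"
    and F2: "\<And>x. x \<in> carrier B \<Longrightarrow> linear_on B Z (F x)"
    and ab: "a \<in> carrier B" "b \<in> carrier B"
  shows "sweedler2 B F (mult B a b) =
    sweedler2 B (\<lambda>a1 a2. sweedler2 B (\<lambda>b1 b2. F (mult B a1 b1) (mult B a2 b2)) b) a"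
proof -
  have F: "bilinear_on B B Z F" by (intro bilinear_onI F1 F2)
  note L = tensor_universal(1)[OF vec_space_C vec_space_C Z F]
  have "sweedler2 B F (mult B a b) = tensor_lift B B F
      (sweedler2 B (\<lambda>a1 a2. sweedler2 B (\<lambda>b1 b2. mult B a1 b1 \<otimes>\<^bsub>B,B\<^esub> mult B a2 b2) b) a)"
    unfolding sweedler2_def[of _ F] comult_mult[OF ab] ..
  also have "\<dots> = sweedler2 B (\<lambda>a1 a2. tensor_lift B B F
      (sweedler2 B (\<lambda>b1 b2. mult B a1 b1 \<otimes>\<^bsub>B,B\<^esub> mult B a2 b2) b)) a"
    by (rule linear_on_sweedler2[OF L vec_space_CC ab(1)])
      (intro sweedler2_closed ab vec_space_CC pure_tensor_closed mult_closed)
  also have "\<dots> = sweedler2 B (\<lambda>a1 a2. sweedler2 B (\<lambda>b1 b2.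
      tensor_lift B B F (mult B a1 b1 \<otimes>\<^bsub>B,B\<^esub> mult B a2 b2)) b) a"
    by (intro sweedler2_cong ab linear_on_sweedler2[OF L vec_space_CC ab(2)] pure_tensor_closed mult_closed)
  also have "\<dots> = sweedler2 B (\<lambda>a1 a2. sweedler2 B (\<lambda>b1 b2. F (mult B a1 b1) (mult B a2 b2)) b) a"
    by (intro sweedler2_cong ab tensor_universal(2)[OF vec_space_C vec_space_C Z F] mult_closed)
  finally show ?thesis .
qed

lemma sweedler_mult:
  assumes "multilinear (Suc n) F" "a \<in> carrier B" "b \<in> carrier B"
  shows "sweedler n F (mult B a b) = sweedler n (\<lambda>l. sweedler n (\<lambda>l'. F (map2 (mult B) l l')) b) a"
  using assms
proof (induction n arbitrary: F a b)
  case (Suc n)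
  have F': "multilinear (Suc n) (\<lambda>l. F (x # l))" if "x \<in> carrier B" for x
    by (rule multilinear_Cons[OF Suc.prems(1) that])
  have "sweedler (Suc n) F (mult B a b) = sweedler2 B (\<lambda>a1 a2. sweedler2 B (\<lambda>b1 b2.
      sweedler n (\<lambda>l. F (mult B a1 b1 # l)) (mult B a2 b2)) b) a"
    unfolding sweedler.simps
    using multilinearD[OF Suc.prems(1), of "[]"]
    by (intro sweedler2_mult[OF vec_space_ground] Suc.prems linear_on_sweedler F' linear_on_sweedler_param)
      auto
  also have "\<dots> = sweedler2 B (\<lambda>a1 a2. sweedler2 B (\<lambda>b1 b2.
      sweedler n (\<lambda>l. sweedler n (\<lambda>l'. F (mult B a1 b1 # map2 (mult B) l l')) b2) a2) b) a"
    by (intro sweedler2_cong Suc.prems Suc.IH F' mult_closed)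
  \<comment> \<open>The splitting of b moves inside the sum over the factors of a2; now all factors
    of a are summed outside those of b.\<close>
  also have "\<dots> = sweedler2 B (\<lambda>a1 a2. sweedler n (\<lambda>l. sweedler2 B (\<lambda>b1 b2.
      sweedler n (\<lambda>l'. F (mult B a1 b1 # map2 (mult B) l l')) b2) b) a2) a"
    unfolding sweedler_swap ..
  finally show ?case by simp
qed simp

lemma sweedler_one: "multilinear (Suc n) F \<Longrightarrow> sweedler n F (one B) = F (replicate (Suc n) (one B))"
proof (induction n arbitrary: F)
  case (Suc n)
  have "bilinear_on B B ground (\<lambda>x. sweedler n (\<lambda>l. F (x # l)))"
    using multilinearD[OF Suc.prems(1), of "[]"]
    by (intro bilinear_onI linear_on_sweedler multilinear_Cons[OF Suc.prems] linear_on_sweedler_param) auto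
  then have "sweedler (Suc n) F (one B) = sweedler n (\<lambda>l. F (one B # l)) (one B)"
    unfolding sweedler.simps by (rule sweedler2_one[OF vec_space_ground])
  also have "\<dots> = F (replicate (Suc (Suc n)) (one B))"
    using Suc.IH[OF multilinear_Cons[OF Suc.prems one_closed]] by simp
  finally show ?case .
qed simp

end

text \<open>Three factors occur in the coproduct of \<open>iota_double\<close> and five in the
  coaction. For these two cases the list version is unfolded into the nested sums that arise
  there.\<close>

lemma (in bialgebra) sweedler3_mult:
  fixes F :: "'a \<Rightarrow> 'a \<Rightarrow> 'a \<Rightarrow> 'f"
  assumes ab: "a \<in> carrier B" "b \<in> carrier B"
    and F1: "\<And>y z. y \<in> carrier B \<Longrightarrow> z \<in> carrier B \<Longrightarrow> linear_on B ground (\<lambda>x. F x y z)"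
    and F2: "\<And>x z. x \<in> carrier B \<Longrightarrow> z \<in> carrier B \<Longrightarrow> linear_on B ground (\<lambda>y. F x y z)"
    and F3: "\<And>x y. x \<in> carrier B \<Longrightarrow> y \<in> carrier B \<Longrightarrow> linear_on B ground (\<lambda>z. F x y z)"
  shows "sweedler2 B (\<lambda>x y. sweedler2 B (F x) y) (mult B a b) =
    sweedler2 B (\<lambda>a1 r. sweedler2 B (\<lambda>a2 a3. sweedler2 B (\<lambda>b1 s. sweedler2 B (\<lambda>b2 b3.
      F (mult B a1 b1) (mult B a2 b2) (mult B a3 b3)) s) b) r) a"
proof -
  have "multilinear (Suc 2) (\<lambda>l. F (l ! 0) (l ! 1) (l ! 2))"
    \<comment> \<open>The index is split into its finitely many values; in each case the overwritten
      list evaluates and only linearity of F in that slot remains.\<close>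
    by (rule multilinear_nthI, unfold numeral_nat, elim less_SucE less_zeroE; simp; auto intro!: F1 F2 F3)
  from sweedler_mult[OF this ab] show ?thesis
    by (simp add: numeral_nat)
qed

lemma (in bialgebra) sweedler3_one:
  fixes F :: "'a \<Rightarrow> 'a \<Rightarrow> 'a \<Rightarrow> 'f"
  assumes "\<And>y z. y \<in> carrier B \<Longrightarrow> z \<in> carrier B \<Longrightarrow> linear_on B ground (\<lambda>x. F x y z)"
    and "\<And>x z. x \<in> carrier B \<Longrightarrow> z \<in> carrier B \<Longrightarrow> linear_on B ground (\<lambda>y. F x y z)"
    and "\<And>x y. x \<in> carrier B \<Longrightarrow> y \<in> carrier B \<Longrightarrow> linear_on B ground (\<lambda>z. F x y z)"
  shows "sweedler2 B (\<lambda>x y. sweedler2 B (F x) y) (one B) = F (one B) (one B) (one B)"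
proof -
  have "multilinear (Suc 2) (\<lambda>l. F (l ! 0) (l ! 1) (l ! 2))"
    by (rule multilinear_nthI, unfold numeral_nat, elim less_SucE less_zeroE; simp; auto intro!: assms)
  from sweedler_one[OF this] show ?thesis
    by (simp add: numeral_nat)
qed

lemma (in bialgebra)
  fixes F :: "'a \<Rightarrow> 'a \<Rightarrow> 'a \<Rightarrow> 'a \<Rightarrow> 'a \<Rightarrow> 'f"
  assumes F: "\<And>x y z w. \<lbrakk>x \<in> carrier B; y \<in> carrier B; z \<in> carrier B; w \<in> carrier B\<rbrakk> \<Longrightarrow>
      linear_on B ground (\<lambda>u. F u x y z w)"
    "\<And>x y z w. \<lbrakk>x \<in> carrier B; y \<in> carrier B; z \<in> carrier B; w \<in> carrier B\<rbrakk> \<Longrightarrow>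
      linear_on B ground (\<lambda>u. F x u y z w)"
    "\<And>x y z w. \<lbrakk>x \<in> carrier B; y \<in> carrier B; z \<in> carrier B; w \<in> carrier B\<rbrakk> \<Longrightarrow>
      linear_on B ground (\<lambda>u. F x y u z w)"
    "\<And>x y z w. \<lbrakk>x \<in> carrier B; y \<in> carrier B; z \<in> carrier B; w \<in> carrier B\<rbrakk> \<Longrightarrow>
      linear_on B ground (\<lambda>u. F x y z u w)"
    "\<And>x y z w. \<lbrakk>x \<in> carrier B; y \<in> carrier B; z \<in> carrier B; w \<in> carrier B\<rbrakk> \<Longrightarrow>
      linear_on B ground (\<lambda>u. F x y z w u)"
  shows sweedler5_mult: "\<lbrakk>a \<in> carrier B; b \<in> carrier B\<rbrakk> \<Longrightarrow>
    sweedler2 B (\<lambda>x r. sweedler2 B (\<lambda>y r. sweedler2 B (\<lambda>z r. sweedler2 B (F x y z) r) r) r) (mult B a b) =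
    sweedler2 B (\<lambda>x1 r. sweedler2 B (\<lambda>x2 r. sweedler2 B (\<lambda>x3 r. sweedler2 B (\<lambda>x4 x5.
    sweedler2 B (\<lambda>y1 r. sweedler2 B (\<lambda>y2 r. sweedler2 B (\<lambda>y3 r. sweedler2 B (\<lambda>y4 y5.
      F (mult B x1 y1) (mult B x2 y2) (mult B x3 y3) (mult B x4 y4) (mult B x5 y5)) r) r) r) b) r) r) r) a"
    and sweedler5_one: "sweedler2 B (\<lambda>x r. sweedler2 B (\<lambda>y r. sweedler2 B (\<lambda>z r. sweedler2 B (F x y z) r) r) r)
      (one B) = F (one B) (one B) (one B) (one B) (one B)"
proof -
  have *: "multilinear (Suc 4) (\<lambda>l. F (l ! 0) (l ! 1) (l ! 2) (l ! 3) (l ! 4))"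
    by (rule multilinear_nthI, unfold numeral_nat, elim less_SucE less_zeroE; simp; auto intro!: F)
  show "sweedler2 B (\<lambda>x r. sweedler2 B (\<lambda>y r. sweedler2 B (\<lambda>z r. sweedler2 B (F x y z) r) r) r) (mult B a b) =
    sweedler2 B (\<lambda>x1 r. sweedler2 B (\<lambda>x2 r. sweedler2 B (\<lambda>x3 r. sweedler2 B (\<lambda>x4 x5.
    sweedler2 B (\<lambda>y1 r. sweedler2 B (\<lambda>y2 r. sweedler2 B (\<lambda>y3 r. sweedler2 B (\<lambda>y4 y5.
      F (mult B x1 y1) (mult B x2 y2) (mult B x3 y3) (mult B x4 y4) (mult B x5 y5)) r) r) r) b) r) r) r) a"
    if "a \<in> carrier B" "b \<in> carrier B"
    using sweedler_mult[OF * that] by (simp add: numeral_nat)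
  show "sweedler2 B (\<lambda>x r. sweedler2 B (\<lambda>y r. sweedler2 B (\<lambda>z r. sweedler2 B (F x y z) r) r) r)
      (one B) = F (one B) (one B) (one B) (one B) (one B)"
    using sweedler_one[OF *] by (simp add: numeral_nat)
qed

text \<open>The laws of a Hopf pairing that involve product, unit, coproduct and counit. Besides
  \<phi> itself, the form \<phi>(\<tau>(a), b) will be an instance.\<close>

locale bialgebra_pairing = bialgebra B
  for B :: "('f::field, 'a::ab_group_add, 'z) bialg_scheme" +
  fixes \<psi> :: "'a \<Rightarrow> 'a \<Rightarrow> 'f"
  assumes pairing_bilinear: "bilinear_on B B ground \<psi>"
    and pairing_one_right: "a \<in> carrier B \<Longrightarrow> \<psi> a (one B) = counit B a"
    and pairing_one_left: "b \<in> carrier B \<Longrightarrow> \<psi> (one B) b = counit B b"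
    and pairing_mult_right: "\<lbrakk>a \<in> carrier B; b \<in> carrier B; b' \<in> carrier B\<rbrakk> \<Longrightarrow>
      \<psi> a (mult B b b') = sweedler2 B (\<lambda>a1 a2. \<psi> a1 b * \<psi> a2 b') a"
    and pairing_mult_left: "\<lbrakk>a \<in> carrier B; a' \<in> carrier B; b \<in> carrier B\<rbrakk> \<Longrightarrow>
      \<psi> (mult B a a') b = sweedler2 B (\<lambda>b1 b2. \<psi> a b1 * \<psi> a' b2) b"
begin

lemmas linear_on_pairing_left = bilinear_on_left[OF pairing_bilinear]
lemmas linear_on_pairing_right = bilinear_on_right[OF pairing_bilinear]

lemmas pairing_linear_intros = linear_on_times_left linear_on_times_right
  linear_on_pairing_left linear_on_pairing_right linear_on_mult_left linear_on_mult_right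
  linear_on_ident mult_closed one_closed

text \<open>Expanding the right-hand product splits xy, by multiplicativity of the coproduct; the
  two resulting pairings are then expanded on the left.\<close>

lemma pairing_mult_mult:
  assumes "x \<in> carrier B" "y \<in> carrier B" "z \<in> carrier B" "w \<in> carrier B"
  shows "\<psi> (mult B x y) (mult B z w) =
    sweedler2 B (\<lambda>x1 x2. sweedler2 B (\<lambda>y1 y2. sweedler2 B (\<lambda>z1 z2. sweedler2 B (\<lambda>w1 w2.
      \<psi> x1 z1 * \<psi> y1 z2 * (\<psi> x2 w1 * \<psi> y2 w2)) w) z) y) x"
proof -
  have "\<psi> (mult B x y) (mult B z w) = sweedler2 B (\<lambda>x1 x2. sweedler2 B (\<lambda>y1 y2.
      \<psi> (mult B x1 y1) z * \<psi> (mult B x2 y2) w) y) x"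
    using assms by (simp add: pairing_mult_right mult_closed)
      (intro sweedler2_mult[OF vec_space_ground] pairing_linear_intros; assumption)
  also have "\<dots> = sweedler2 B (\<lambda>x1 x2. sweedler2 B (\<lambda>y1 y2.
      sweedler2 B (\<lambda>z1 z2. \<psi> x1 z1 * \<psi> y1 z2) z * sweedler2 B (\<lambda>w1 w2. \<psi> x2 w1 * \<psi> y2 w2) w) y) x"
    by (intro sweedler2_cong assms arg_cong2[where f = "(*)"] pairing_mult_left)
  finally show ?thesis by (simp only: sweedler2_distrib sweedler2_swap[of _ z w])
qed

section \<open>The product twisted by a bialgebra pairing\<close>

definition iota_mult :: "'a \<Rightarrow> 'a \<Rightarrow> 'a" where
  "iota_mult a b = sweedler2 B (\<lambda>a1 a2. sweedler2 B (\<lambda>b1 b2. smult B (\<psi> b2 a1) (mult B a2 b1)) b) a"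

lemma iota_mult_bilinear: "bilinear_on B B B iota_mult"
  unfolding iota_mult_def
  by (intro bilinear_onI linear_on_sweedler2_param linear_on_sweedler2_arg vec_space_C linear_on_ident
      linear_on_smult_left linear_on_smult_right pairing_linear_intros; assumption)

lemma iota_mult_closed: "a \<in> carrier B \<Longrightarrow> b \<in> carrier B \<Longrightarrow> iota_mult a b \<in> carrier B"
  by (rule bilinear_on_closed[OF iota_mult_bilinear])

text \<open>The first of several lemmas that evaluate a functional on a vector-valued construction
  and return a scalar Sweedler sum. They are what brings an identity into the scope of
  \<open>split_sum_eqI\<close>.\<close>

lemma linear_on_iota_mult:
  assumes L: "linear_on B ground L" and "a \<in> carrier B" "b \<in> carrier B"
  shows "L (iota_mult a b) = sweedler2 B (\<lambda>a1 a2. sweedler2 B (\<lambda>b1 b2. \<psi> b2 a1 * L (mult B a2 b1)) b) a"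
proof -
  have "L (iota_mult a b) = sweedler2 B (\<lambda>a1 a2. L (sweedler2 B (\<lambda>b1 b2.
      smult B (\<psi> b2 a1) (mult B a2 b1)) b)) a"
    unfolding iota_mult_def
    by (intro linear_on_sweedler2[OF L vec_space_C] sweedler2_closed assms vec_space_C smult_closed mult_closed)
  also have "\<dots> = sweedler2 B (\<lambda>a1 a2. sweedler2 B (\<lambda>b1 b2. L (smult B (\<psi> b2 a1) (mult B a2 b1))) b) a"
    by (intro sweedler2_cong linear_on_sweedler2[OF L vec_space_C] assms smult_closed vec_space_C mult_closed)
  finally show ?thesis
    using assms by (simp add: linear_on_smult[OF L] mult_closed cong: sweedler2_cong_simp)
qed

lemma iota_mult_one:
  assumes a: "a \<in> carrier B"
  shows "iota_mult (one B) a = a" and "iota_mult a (one B) = a"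
proof -
  note lin = linear_on_sweedler2_param[OF vec_space_ground]
    linear_on_sweedler2_arg[OF vec_space_ground] pairing_linear_intros
  show "iota_mult (one B) a = a"
  proof (rule functional_eqI[OF vec_space_C iota_mult_closed[OF one_closed a] a])
    fix L assume L: "linear_on B ground L"
    have "L (iota_mult (one B) a) =
      sweedler2 B (\<lambda>b1 b2. \<psi> b2 (one B) * L (mult B (one B) b1)) a"
      unfolding linear_on_iota_mult[OF L one_closed a]
      by (rule sweedler2_one[OF vec_space_ground])
        (intro bilinear_onI lin linear_on_compose[OF _ L] a; assumption)
    also have "\<dots> = L a"
      using a by (simp add: pairing_one_right mult_one_left sweedler2_counit[OF a L] cong: sweedler2_cong_simp)
    finally show "L (iota_mult (one B) a) = L a" .
  qed
  show "iota_mult a (one B) = a"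
  proof (rule functional_eqI[OF vec_space_C iota_mult_closed[OF a one_closed] a])
    fix L assume L: "linear_on B ground L"
    have "L (iota_mult a (one B)) = sweedler2 B (\<lambda>a1 a2. \<psi> (one B) a1 * L (mult B a2 (one B))) a"
      unfolding linear_on_iota_mult[OF L a one_closed]
      by (rule sweedler2_cong[OF a], rule sweedler2_one[OF vec_space_ground])
        (intro bilinear_onI lin linear_on_compose[OF _ L] a; assumption)
    also have "\<dots> = L a"
      using a by (simp add: pairing_one_left mult_one_right sweedler2_counit[OF a L] cong: sweedler2_cong_simp)
    finally show "L (iota_mult a (one B)) = L a" .
  qed
qed

lemma iota_mult_assoc:
  assumes abc: "a \<in> carrier B" "b \<in> carrier B" "c \<in> carrier B"
  shows "iota_mult (iota_mult a b) c = iota_mult a (iota_mult b c)"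
proof (rule functional_eqI[OF vec_space_C])
  show "iota_mult (iota_mult a b) c \<in> carrier B" "iota_mult a (iota_mult b c) \<in> carrier B"
    by (intro iota_mult_closed abc)+
  fix L assume L: "linear_on B ground L"
  note lin = linear_on_sweedler2_param[OF vec_space_ground]
    linear_on_sweedler2_arg[OF vec_space_ground] linear_on_compose[OF _ L] pairing_linear_intros
  \<comment> \<open>With a1, a2, a3 for the factors of a, and likewise for b and c, the common
    summand is \<psi>(b3, a1) \<psi>(c2, a2) \<psi>(c3, b1) L(a3 b2 c1). The first pairing comes
    from the inner product on the left side, the third from that on the right; the others come from
    pairing with a product.\<close>
  define F where "F l = \<psi> (l ! 5) (l ! 0) * (\<psi> (l ! 7) (l ! 1) * \<psi> (l ! 8) (l ! 3) *
      L (mult B (mult B (l ! 2) (l ! 4)) (l ! 6)))" for l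
  have F: "multilinear 9 F"
    by (rule multilinear_nthI, unfold numeral_nat F_def, elim less_SucE less_zeroE; simp;
      auto intro!: lin)
  have 1: "L (iota_mult (mult B x y) c) =
      sweedler2 B (\<lambda>x1 x2. sweedler2 B (\<lambda>y1 y2. sweedler2 B (\<lambda>c1 c2. sweedler2 B (\<lambda>z1 z2.
         \<psi> z1 x1 * \<psi> z2 y1 * L (mult B (mult B x2 y2) c1)) c2) c) y) x"
    if xy: "x \<in> carrier B" "y \<in> carrier B" for x y
  proof -
    have "L (iota_mult (mult B x y) c) = sweedler2 B (\<lambda>x1 x2. sweedler2 B (\<lambda>y1 y2. sweedler2 B (\<lambda>c1 c2.
        \<psi> c2 (mult B x1 y1) * L (mult B (mult B x2 y2) c1)) c) y) x"
      unfolding linear_on_iota_mult[OF L mult_closed[OF xy] abc(3)]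
      by (rule sweedler2_mult[OF vec_space_ground _ _ xy]; intro lin abc; assumption)
    also have "\<dots> = sweedler2 B (\<lambda>x1 x2. sweedler2 B (\<lambda>y1 y2. sweedler2 B (\<lambda>c1 c2. sweedler2 B (\<lambda>z1 z2.
        \<psi> z1 x1 * \<psi> z2 y1 * L (mult B (mult B x2 y2) c1)) c2) c) y) x"
      using xy abc by (simp add: pairing_mult_right sweedler2_distrib cong: sweedler2_cong_simp)
    finally show ?thesis .
  qed
  have 2: "L (iota_mult a (mult B x y)) =
      sweedler2 B (\<lambda>a1 a2. sweedler2 B (\<lambda>x1 x2. sweedler2 B (\<lambda>y1 y2. sweedler2 B (\<lambda>z1 z2.
         \<psi> x2 z1 * \<psi> y2 z2 * L (mult B a2 (mult B x1 y1))) a1) y) x) a"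
    if xy: "x \<in> carrier B" "y \<in> carrier B" for x y
  proof -
    have "L (iota_mult a (mult B x y)) = sweedler2 B (\<lambda>a1 a2. sweedler2 B (\<lambda>x1 x2. sweedler2 B (\<lambda>y1 y2.
        \<psi> (mult B x2 y2) a1 * L (mult B a2 (mult B x1 y1))) y) x) a"
      unfolding linear_on_iota_mult[OF L abc(1) mult_closed[OF xy]]
      by (rule sweedler2_cong[OF abc(1)], rule sweedler2_mult[OF vec_space_ground _ _ xy]; intro lin abc; assumption)
    also have "\<dots> = sweedler2 B (\<lambda>a1 a2. sweedler2 B (\<lambda>x1 x2. sweedler2 B (\<lambda>y1 y2. sweedler2 B (\<lambda>z1 z2.
         \<psi> x2 z1 * \<psi> y2 z2 * L (mult B a2 (mult B x1 y1))) a1) y) x) a"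
      using xy abc by (simp add: pairing_mult_left sweedler2_distrib cong: sweedler2_cong_simp)
    finally show ?thesis .
  qed
  have "L (iota_mult (iota_mult a b) c) =
      sweedler2 B (\<lambda>a1 a2. sweedler2 B (\<lambda>b1 b2. \<psi> b2 a1 * L (iota_mult (mult B a2 b1) c)) b) a"
    by (intro linear_on_iota_mult abc linear_on_compose[OF bilinear_on_left[OF iota_mult_bilinear linear_on_ident abc(3)] L])
  \<comment> \<open>Each entry is the position, in the environment reached so far, of the argument
    of the next inner sum: here a, b, the second factor of a, the first factor of b, c, and the
    second factor of c.\<close>
  also have "\<dots> = split_sum [0,2,1,3,6,7] F [a,b,c]"
    using abc by (simp add: 1 F_def sweedler2_distrib cong: sweedler2_cong_simp)
  also have "\<dots> = split_sum [1,3,0,3,5,0] F [a,b,c]"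
    by (rule split_sum_eqI[OF _ F]) (simp_all add: abc)
  also have "\<dots> = sweedler2 B (\<lambda>b1 b2. sweedler2 B (\<lambda>c1 c2. \<psi> c2 b1 * L (iota_mult a (mult B b2 c1))) c) b"
    using abc by (simp add: 2 F_def sweedler2_distrib mult_assoc mult_closed mult_ac cong: sweedler2_cong_simp)
  also have "\<dots> = L (iota_mult a (iota_mult b c))"
    by (intro linear_on_iota_mult[symmetric] abc linear_on_compose[OF bilinear_on_right[OF iota_mult_bilinear linear_on_ident abc(1)] L])
  finally show "L (iota_mult (iota_mult a b) c) = L (iota_mult a (iota_mult b c))" .
qed

end

section \<open>The antipode and its inverse\<close>

context hopf_algebra
begin

lemma antipode_closed: "a \<in> carrier H \<Longrightarrow> antipode H a \<in> carrier H"
  by (rule linear_on_closed[OF antipode_linear])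

lemma functional_antipode:
  assumes L: "linear_on H ground L" and a: "a \<in> carrier H"
  shows "sweedler2 H (\<lambda>x y. L (mult H (antipode H x) y)) a = counit H a * L (one H)"
    and "sweedler2 H (\<lambda>x y. L (mult H x (antipode H y))) a = counit H a * L (one H)"
proof -
  have *: "counit H a * L (one H) = L (smult H (counit H a) (one H))"
    by (simp add: linear_on_smult[OF L one_closed])
  show "sweedler2 H (\<lambda>x y. L (mult H (antipode H x) y)) a = counit H a * L (one H)"
    unfolding * antipode_left[OF a, symmetric] sweedler2_def[symmetric]
    by (intro linear_on_sweedler2[OF L vec_space_C a, symmetric] mult_closed antipode_closed)
  show "sweedler2 H (\<lambda>x y. L (mult H x (antipode H y))) a = counit H a * L (one H)"
    unfolding * antipode_right[OF a, symmetric] sweedler2_def[symmetric]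
    by (intro linear_on_sweedler2[OF L vec_space_C a, symmetric] mult_closed antipode_closed)
qed

text \<open>The coproduct of 1 is 1 \<otimes> 1, so the antipode axiom at 1 reads S(1) 1 =
  1.\<close>

lemma antipode_one: "antipode H (one H) = one H"
proof -
  have "bilinear_on H H H (\<lambda>x y. mult H (antipode H x) y)"
    by (intro bilinear_onI linear_on_mult_left linear_on_mult_right antipode_linear linear_on_ident
        antipode_closed)
  from antipode_left[OF one_closed, folded sweedler2_def, unfolded sweedler2_one[OF vec_space_C this]]
  show ?thesis
    using vector_space.vector_space_assms(4)[OF is_vector_space]
    by (simp add: mult_one_right antipode_closed one_closed counit_one)
qed

text \<open>Both sides arise from \<open>S(a\<^sub>1 b\<^sub>1) a\<^sub>2 b\<^sub>2 S(b\<^sub>3) S(a\<^sub>3)\<close>.\<close>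

lemma antipode_mult:
  assumes ab: "a \<in> carrier H" "b \<in> carrier H"
  shows "antipode H (mult H a b) = mult H (antipode H b) (antipode H a)"
proof (rule functional_eqI[OF vec_space_C])
  show "antipode H (mult H a b) \<in> carrier H" "mult H (antipode H b) (antipode H a) \<in> carrier H"
    by (intro antipode_closed mult_closed ab)+
  fix L assume L: "linear_on H ground L"
  note lin = linear_on_sweedler2_param[OF vec_space_ground]
    linear_on_sweedler2_arg[OF vec_space_ground] linear_on_compose[OF _ L]
    linear_on_mult_left linear_on_mult_right linear_on_compose[OF _ antipode_linear]
    linear_on_ident mult_closed one_closed antipode_closed
  define F where "F l = L (mult H (antipode H (mult H (l ! 0) (l ! 3)))
      (mult H (mult H (l ! 1) (l ! 4)) (mult H (antipode H (l ! 5)) (antipode H (l ! 2)))))" for l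
  have F: "multilinear 6 F"
    by (rule multilinear_nthI, unfold numeral_nat F_def, elim less_SucE less_zeroE; simp;
      auto intro!: lin)
  have "L (mult H (antipode H b) (antipode H a)) = sweedler2 H (\<lambda>a1 a2. sweedler2 H (\<lambda>b1 b2.
      counit H b1 * (counit H a1 * L (mult H (antipode H b2) (antipode H a2)))) b) a"
  proof -
    have "sweedler2 H (\<lambda>b1 b2. counit H b1 * (counit H a1 * L (mult H (antipode H b2) (antipode H a2)))) b
      = counit H a1 * L (mult H (antipode H b) (antipode H a2))" if "a1 \<in> carrier H" "a2 \<in> carrier H" for a1 a2
      by (rule sweedler2_counit[OF ab(2)])
        (use that ab in \<open>auto intro!: lin linear_on_times_right\<close>)
    moreover have "sweedler2 H (\<lambda>a1 a2. counit H a1 * L (mult H (antipode H b) (antipode H a2))) a =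
        L (mult H (antipode H b) (antipode H a))"
      by (rule sweedler2_counit[OF ab(1)]) (use ab in \<open>auto intro!: lin linear_on_times_right\<close>)
    ultimately show ?thesis using ab by (simp cong: sweedler2_cong_simp)
  qed
  \<comment> \<open>A and B stand for the parts of a and b that are still to be split in two. The
    counit of the product AB is replaced by S((AB)_1) (AB)_2.\<close>
  also have "\<dots> = sweedler2 H (\<lambda>A a3. sweedler2 H (\<lambda>B b3. sweedler2 H (\<lambda>x y.
      L (mult H (antipode H x) (mult H y (mult H (antipode H b3) (antipode H a3))))) (mult H A B)) b) a"
  proof (intro sweedler2_cong ab)
    fix A a3 B b3 assume c: "A \<in> carrier H" "a3 \<in> carrier H" "B \<in> carrier H" "b3 \<in> carrier H"
    then have "linear_on H ground (\<lambda>x. L (mult H x (mult H (antipode H b3) (antipode H a3))))"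
      by (auto intro!: lin)
    from functional_antipode(1)[OF this, of "mult H A B"] c
    show "counit H B * (counit H A * L (mult H (antipode H b3) (antipode H a3))) =
      sweedler2 H (\<lambda>x y. L (mult H (antipode H x) (mult H y (mult H (antipode H b3) (antipode H a3)))))
        (mult H A B)"
      by (simp add: mult_assoc mult_closed antipode_closed mult_one_left counit_mult mult_ac
          cong: sweedler2_cong_simp)
  qed
  also have "\<dots> = split_sum [0,2,0,3] F [a,b]"
  proof -
    have "sweedler2 H (\<lambda>x y. L (mult H (antipode H x) (mult H y (mult H (antipode H b3) (antipode H a3)))))
        (mult H A B) = sweedler2 H (\<lambda>x x'. sweedler2 H (\<lambda>y y'.
        L (mult H (antipode H (mult H x y)) (mult H (mult H x' y') (mult H (antipode H b3) (antipode H a3))))) B) A"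
      if "A \<in> carrier H" "a3 \<in> carrier H" "B \<in> carrier H" "b3 \<in> carrier H" for A a3 B b3
      using that by (intro sweedler2_mult[OF vec_space_ground] lin)
    then show ?thesis using ab by (simp add: F_def cong: sweedler2_cong_simp)
  qed
  also have "\<dots> = split_sum [0,2,1,4] F [a,b]"
    by (rule split_sum_eqI[OF _ F]) (simp_all add: ab)
  \<comment> \<open>Collapsing from the other side: b2 S(b3) is innermost and goes first, which
    brings a2 and S(a3) together for the next step.\<close>
  also have "\<dots> = sweedler2 H (\<lambda>a1 R. sweedler2 H (\<lambda>b1 Q. sweedler2 H (\<lambda>a2 a3.
      counit H Q * L (mult H (antipode H (mult H a1 b1)) (mult H a2 (antipode H a3)))) R) b) a"
  proof -
    have "sweedler2 H (\<lambda>b2 b3. L (mult H (antipode H (mult H a1 b1))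
        (mult H (mult H a2 b2) (mult H (antipode H b3) (antipode H a3))))) Q =
        counit H Q * L (mult H (antipode H (mult H a1 b1)) (mult H a2 (antipode H a3)))"
      if c: "a1 \<in> carrier H" "b1 \<in> carrier H" "a2 \<in> carrier H" "a3 \<in> carrier H" "Q \<in> carrier H"
      for a1 b1 a2 a3 Q
    proof -
      have "linear_on H ground (\<lambda>x. L (mult H (antipode H (mult H a1 b1))
        (mult H a2 (mult H x (antipode H a3)))))"
        using c by (auto intro!: lin)
      from functional_antipode(2)[OF this c(5)] c show ?thesis
        by (simp add: mult_assoc mult_closed antipode_closed mult_one_left cong: sweedler2_cong_simp)
    qed
    then show ?thesis using ab by (simp add: F_def cong: sweedler2_cong_simp)
  qed
  also have "\<dots> = sweedler2 H (\<lambda>a1 R. sweedler2 H (\<lambda>b1 Q.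
      counit H Q * (counit H R * L (antipode H (mult H a1 b1)))) b) a"
  proof -
    have "sweedler2 H (\<lambda>a2 a3. L (mult H (antipode H (mult H a1 b1)) (mult H a2 (antipode H a3)))) R =
        counit H R * L (antipode H (mult H a1 b1))"
      if c: "a1 \<in> carrier H" "b1 \<in> carrier H" "R \<in> carrier H" for a1 b1 R
    proof -
      have "linear_on H ground (\<lambda>x. L (mult H (antipode H (mult H a1 b1)) x))"
        using c by (auto intro!: lin)
      from functional_antipode(2)[OF this c(3)] c show ?thesis
        by (simp add: mult_closed antipode_closed mult_one_right)
    qed
    then show ?thesis using ab by (simp add: sweedler2_distrib[symmetric] cong: sweedler2_cong_simp)
  qed
  also have "\<dots> = L (antipode H (mult H a b))"
  proof -
    have "sweedler2 H (\<lambda>b1 Q. counit H Q * (counit H R * L (antipode H (mult H a1 b1)))) b =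
        counit H R * L (antipode H (mult H a1 b))" if "a1 \<in> carrier H" "R \<in> carrier H" for a1 R
      by (rule sweedler2_counit[OF ab(2)])
        (use that ab in \<open>auto intro!: lin linear_on_times_right\<close>)
    moreover have "sweedler2 H (\<lambda>a1 R. counit H R * L (antipode H (mult H a1 b))) a =
        L (antipode H (mult H a b))"
      by (rule sweedler2_counit[OF ab(1)]) (use ab in \<open>auto intro!: lin\<close>)
    ultimately show ?thesis using ab by (simp cong: sweedler2_cong_simp)
  qed
  finally show "L (antipode H (mult H a b)) = L (mult H (antipode H b) (antipode H a))" ..
qed

end

section \<open>The inverse of the antipode\<close>

locale hopf_algebra_bij_antipode = hopf_algebra +
  assumes antipode_bij: "bij_betw (antipode H) (carrier H) (carrier H)"
begin

definition inv_antipode :: "'b \<Rightarrow> 'b" where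
  "inv_antipode = inv_into (carrier H) (antipode H)"

lemma
  assumes "a \<in> carrier H"
  shows inv_antipode_closed: "inv_antipode a \<in> carrier H"
    and antipode_inv: "antipode H (inv_antipode a) = a"
    and inv_antipode_antipode: "inv_antipode (antipode H a) = a"
  unfolding inv_antipode_def
  using assms bij_betw_inv_into_right[OF antipode_bij] bij_betw_inv_into_left[OF antipode_bij]
    bij_betwE[OF bij_betw_inv_into[OF antipode_bij]] by auto

lemma inv_antipode_eqI: "b \<in> carrier H \<Longrightarrow> antipode H b = a \<Longrightarrow> inv_antipode a = b"
  using inv_antipode_antipode by blast

lemma inv_antipode_linear: "linear_on H H inv_antipode"
  by (rule linear_onI)
    (auto intro!: inv_antipode_eqI
      simp: inv_antipode_closed add_closed[OF vec_space_C] smult_closed[OF vec_space_C] antipode_inv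
        linear_on_add[OF antipode_linear] linear_on_smult[OF antipode_linear])

lemma inv_antipode_one: "inv_antipode (one H) = one H"
  by (rule inv_antipode_eqI) (simp_all add: one_closed antipode_one)

lemma inv_antipode_mult:
  assumes "a \<in> carrier H" "b \<in> carrier H"
  shows "inv_antipode (mult H a b) = mult H (inv_antipode b) (inv_antipode a)"
  using assms by (intro inv_antipode_eqI)
    (simp_all add: mult_closed inv_antipode_closed antipode_mult antipode_inv)

text \<open>Apply the inverse antipode to the two antipode axioms. It reverses products, so the
  factors meet in the flipped order: the inverse is an antipode for the coopposite
  coproduct.\<close>

lemma functional_inv_antipode:
  assumes L: "linear_on H ground L" and a: "a \<in> carrier H"
  shows "sweedler2 H (\<lambda>x y. L (mult H (inv_antipode y) x)) a = counit H a * L (one H)"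
    and "sweedler2 H (\<lambda>x y. L (mult H y (inv_antipode x))) a = counit H a * L (one H)"
proof -
  have *: "mult H (inv_antipode y) x = inv_antipode (mult H (antipode H x) y)"
    "mult H y (inv_antipode x) = inv_antipode (mult H x (antipode H y))"
    if "x \<in> carrier H" "y \<in> carrier H" for x y
    using that by (simp_all add: inv_antipode_mult antipode_closed inv_antipode_antipode)
  have K: "linear_on H ground (\<lambda>x. L (inv_antipode x))"
    by (rule linear_on_compose[OF inv_antipode_linear L])
  show "sweedler2 H (\<lambda>x y. L (mult H (inv_antipode y) x)) a = counit H a * L (one H)"
    "sweedler2 H (\<lambda>x y. L (mult H y (inv_antipode x))) a = counit H a * L (one H)"
    using functional_antipode[OF K a] a by (simp_all add: * inv_antipode_one cong: sweedler2_cong_simp)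
qed

end

section \<open>A Hopf pairing and its convolution inverse\<close>

locale hopf_pairing_setup = hopf_algebra_bij_antipode H
  for H :: "('f::field, 'a::ab_group_add, 'z) hopf_scheme" +
  fixes \<phi> :: "'a \<Rightarrow> 'a \<Rightarrow> 'f"
  assumes pairing: "hopf_pairing H \<phi>"
begin

sublocale bialgebra_pairing H \<phi>
  using pairing by unfold_locales (simp_all add: hopf_pairing_def)

text \<open>The convolution inverse of \<open>\<phi>\<close> with respect to the coopposite coproduct in the second
  argument.\<close>

definition \<eta> :: "'a \<Rightarrow> 'a \<Rightarrow> 'f" where
  "\<eta> a b = \<phi> a (inv_antipode b)"

lemma eta_bilinear: "bilinear_on H H ground \<eta>"
  unfolding \<eta>_def
  by (intro bilinear_onI linear_on_pairing_left linear_on_pairing_right linear_on_ident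
      inv_antipode_linear inv_antipode_closed)

lemmas linear_on_eta_left = bilinear_on_left[OF eta_bilinear]
lemmas linear_on_eta_right = bilinear_on_right[OF eta_bilinear]

lemma eta_one_right: "a \<in> carrier H \<Longrightarrow> \<eta> a (one H) = counit H a"
  by (simp add: \<eta>_def inv_antipode_one pairing_one_right)

text \<open>Insert the preimages of a and b under the antipode into \<phi>(a, S(b)) = \<phi>(S(a),
  b). With this, \<eta> reverses the factors for products in either argument.\<close>

lemma eta_eq_left: "a \<in> carrier H \<Longrightarrow> b \<in> carrier H \<Longrightarrow> \<eta> a b = \<phi> (inv_antipode a) b"
  using pairing inv_antipode_closed antipode_inv unfolding \<eta>_def hopf_pairing_def by metis

lemma eta_mult_right:
  "a \<in> carrier H \<Longrightarrow> b \<in> carrier H \<Longrightarrow> b' \<in> carrier H \<Longrightarrow>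
    \<eta> a (mult H b b') = sweedler2 H (\<lambda>a1 a2. \<eta> a1 b' * \<eta> a2 b) a"
  by (simp add: \<eta>_def inv_antipode_mult pairing_mult_right inv_antipode_closed)

lemma eta_mult_left:
  "a \<in> carrier H \<Longrightarrow> a' \<in> carrier H \<Longrightarrow> b \<in> carrier H \<Longrightarrow>
    \<eta> (mult H a a') b = sweedler2 H (\<lambda>b1 b2. \<eta> a b2 * \<eta> a' b1) b"
  by (simp add: eta_eq_left mult_closed inv_antipode_mult pairing_mult_left inv_antipode_closed
      mult.commute cong: sweedler2_cong_simp)

text \<open>Pair a with the identities b2 S^-1(b1) = \<epsilon>(b) 1 and S^-1(b2) b1 = \<epsilon>(b)
  1, and expand the product in the second argument.\<close>

lemma pairing_eta:
  assumes ab: "a \<in> carrier H" "b \<in> carrier H"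
  shows "sweedler2 H (\<lambda>a1 a2. sweedler2 H (\<lambda>b1 b2. \<phi> a1 b2 * \<eta> a2 b1) b) a = counit H a * counit H b"
    and "sweedler2 H (\<lambda>a1 a2. sweedler2 H (\<lambda>b1 b2. \<eta> a1 b2 * \<phi> a2 b1) b) a = counit H a * counit H b"
proof -
  note L = linear_on_pairing_right[OF linear_on_ident ab(1)]
  from functional_inv_antipode[OF L ab(2)]
  have "sweedler2 H (\<lambda>b1 b2. \<phi> a (mult H b2 (inv_antipode b1))) b = counit H a * counit H b"
    "sweedler2 H (\<lambda>b1 b2. \<phi> a (mult H (inv_antipode b2) b1)) b = counit H a * counit H b"
    using ab by (simp_all add: pairing_one_right)
  then show "sweedler2 H (\<lambda>a1 a2. sweedler2 H (\<lambda>b1 b2. \<phi> a1 b2 * \<eta> a2 b1) b) a = counit H a * counit H b"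
    "sweedler2 H (\<lambda>a1 a2. sweedler2 H (\<lambda>b1 b2. \<eta> a1 b2 * \<phi> a2 b1) b) a = counit H a * counit H b"
    using ab unfolding sweedler2_swap[of _ b a]
    by (simp_all add: pairing_mult_right inv_antipode_closed \<eta>_def cong: sweedler2_cong_simp)
qed

end

section \<open>The bialgebra \<open>(H \<otimes> H)\<^sup>\<iota>\<close>\<close>

context hopf_pairing_setup
begin

abbreviation "T \<equiv> H \<Otimes> H"
abbreviation "D \<equiv> iota_double H \<phi>"

lemma vec_space_T: "vec_space T" and vec_space_TT: "vec_space (T \<Otimes> T)"
  by (simp_all add: vec_space_tensor vec_space_C)

text \<open>The calculations work over T, and the results are transferred to D through this
  fact.\<close>

lemma D_space: "same_space D T"
  by (simp add: same_space_def iota_double_def)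

lemma D_vec_space: "vec_space D"
  using vec_space_same_space[OF D_space] vec_space_T by simp

lemma D_carrier: "carrier D = carrier T" and D_smult: "smult D = smult T"
  using D_space by (simp_all add: same_space_def)

section \<open>Product and unit of \<open>iota_double\<close>\<close>

definition double_mult :: "'a \<Rightarrow> 'a \<Rightarrow> 'a \<Rightarrow> 'a \<Rightarrow> ('f, 'a, 'a) tensor" where
  "double_mult a b c d =
     sweedler2 H (\<lambda>a1 a2. sweedler2 H (\<lambda>b1 b2. sweedler2 H (\<lambda>c1 c2. sweedler2 H (\<lambda>d1 d2.
       smult T (\<phi> a1 d2 * \<phi> c2 b1) (mult H a2 c1 \<otimes>\<^bsub>H,H\<^esub> mult H b2 d1)) d) c) b) a"

lemma double_mult_linear:
  assumes "a \<in> carrier H" "b \<in> carrier H" "c \<in> carrier H" "d \<in> carrier H"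
  shows "linear_on H T (\<lambda>a. double_mult a b c d)"
    and "linear_on H T (\<lambda>b. double_mult a b c d)"
    and "linear_on H T (\<lambda>c. double_mult a b c d)"
    and "linear_on H T (\<lambda>d. double_mult a b c d)"
  unfolding double_mult_def
  by (intro linear_on_sweedler2_param linear_on_sweedler2_arg vec_space_T vec_space_C
      linear_on_smult_left linear_on_smult_right linear_on_pure_left linear_on_pure_right
      pairing_linear_intros pure_tensor_closed assms; assumption)+

lemma mult_D_bilinear: "bilinear_on T T T (mult D)"
  and mult_D_pure: "\<lbrakk>a \<in> carrier H; b \<in> carrier H; c \<in> carrier H; d \<in> carrier H\<rbrakk> \<Longrightarrow>
    mult D (a \<otimes>\<^bsub>H,H\<^esub> b) (c \<otimes>\<^bsub>H,H\<^esub> d) = double_mult a b c d"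
proof -
  have *: "mult D = (\<lambda>s t. tensor_lift H H (\<lambda>a b. tensor_lift H H (double_mult a b) t) s)"
    by (simp add: iota_double_def double_mult_def[abs_def])
  show "bilinear_on T T T (mult D)"
    unfolding * by (rule tensor_lift2_bilinear[OF vec_space_C vec_space_C vec_space_T]) (rule double_mult_linear; assumption)+
  show "mult D (a \<otimes>\<^bsub>H,H\<^esub> b) (c \<otimes>\<^bsub>H,H\<^esub> d) = double_mult a b c d"
    if "a \<in> carrier H" "b \<in> carrier H" "c \<in> carrier H" "d \<in> carrier H"
    unfolding * by (rule tensor_lift2_pure[OF vec_space_C vec_space_C vec_space_T]) (rule double_mult_linear that; assumption)+
qed

lemma mult_D_closed: "s \<in> carrier T \<Longrightarrow> t \<in> carrier T \<Longrightarrow> mult D s t \<in> carrier T"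
  by (rule bilinear_on_closed[OF mult_D_bilinear])

lemma linear_on_mult_D:
  assumes L: "linear_on T ground L"
    and "a \<in> carrier H" "b \<in> carrier H" "c \<in> carrier H" "d \<in> carrier H"
  shows "L (mult D (a \<otimes>\<^bsub>H,H\<^esub> b) (c \<otimes>\<^bsub>H,H\<^esub> d)) =
     sweedler2 H (\<lambda>a1 a2. sweedler2 H (\<lambda>b1 b2. sweedler2 H (\<lambda>c1 c2. sweedler2 H (\<lambda>d1 d2.
       \<phi> a1 d2 * \<phi> c2 b1 * L (mult H a2 c1 \<otimes>\<^bsub>H,H\<^esub> mult H b2 d1)) d) c) b) a"
  using assms unfolding double_mult_def
  by (simp add: mult_D_pure double_mult_def linear_on_sweedler2[OF L vec_space_T] sweedler2_closed[OF _ vec_space_T]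
      smult_closed[OF vec_space_T] pure_tensor_closed mult_closed linear_on_smult[OF L]
      cong: sweedler2_cong_simp)

lemmas scalar_linear_intros = linear_on_sweedler2_param[OF vec_space_ground]
  linear_on_sweedler2_arg[OF vec_space_ground] pairing_linear_intros
  linear_on_pure_left linear_on_pure_right vec_space_C vec_space_T pure_tensor_closed

text \<open>A product of pure tensors in D is a combination of tensors whose legs are products in H.
  Associativity requires multiplying such a tensor once more, here from the right and in
  \<open>linear_on_mult_D_right\<close> from the left.\<close>

lemma linear_on_mult_D_left:
  assumes L: "linear_on T ground L" and cl: "x \<in> carrier H" "y \<in> carrier H"
    "z \<in> carrier H" "w \<in> carrier H" "c \<in> carrier H" "d \<in> carrier H"
  shows "L (mult D (mult H x y \<otimes>\<^bsub>H,H\<^esub> mult H z w) (c \<otimes>\<^bsub>H,H\<^esub> d)) =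
     sweedler2 H (\<lambda>x1 x2. sweedler2 H (\<lambda>y1 y2. sweedler2 H (\<lambda>z1 z2. sweedler2 H (\<lambda>w1 w2.
       sweedler2 H (\<lambda>c1 c2. sweedler2 H (\<lambda>d1 d2. sweedler2 H (\<lambda>c3 c4. sweedler2 H (\<lambda>d3 d4.
       \<phi> x1 d3 * \<phi> y1 d4 * (\<phi> c3 z1 * \<phi> c4 w1 *
       L (mult H (mult H x2 y2) c1 \<otimes>\<^bsub>H,H\<^esub> mult H (mult H z2 w2) d1))) d2) c2) d) c) w) z) y) x"
proof -
  have "L (mult D (mult H x y \<otimes>\<^bsub>H,H\<^esub> mult H z w) (c \<otimes>\<^bsub>H,H\<^esub> d)) =
    sweedler2 H (\<lambda>x1 x2. sweedler2 H (\<lambda>y1 y2. sweedler2 H (\<lambda>b1 b2. sweedler2 H (\<lambda>c1 c2. sweedler2 H (\<lambda>d1 d2.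
       \<phi> (mult H x1 y1) d2 * \<phi> c2 b1 * L (mult H (mult H x2 y2) c1 \<otimes>\<^bsub>H,H\<^esub> mult H b2 d1)) d) c)
       (mult H z w)) y) x"
    unfolding linear_on_mult_D[OF L mult_closed[OF cl(1,2)] mult_closed[OF cl(3,4)] cl(5,6)]
    by (rule sweedler2_mult[OF vec_space_ground _ _ cl(1,2)];
        intro scalar_linear_intros linear_on_compose[OF _ L] cl; assumption)
  also have "\<dots> = sweedler2 H (\<lambda>x1 x2. sweedler2 H (\<lambda>y1 y2. sweedler2 H (\<lambda>z1 z2. sweedler2 H (\<lambda>w1 w2.
      sweedler2 H (\<lambda>c1 c2. sweedler2 H (\<lambda>d1 d2. \<phi> (mult H x1 y1) d2 * \<phi> c2 (mult H z1 w1) *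
        L (mult H (mult H x2 y2) c1 \<otimes>\<^bsub>H,H\<^esub> mult H (mult H z2 w2) d1)) d) c) w) z) y) x"
    by (rule sweedler2_cong[OF cl(1)], rule sweedler2_cong[OF cl(2)],
        rule sweedler2_mult[OF vec_space_ground _ _ cl(3,4)];
        intro scalar_linear_intros linear_on_compose[OF _ L] cl; assumption)
  finally show ?thesis
    using cl by (simp add: pairing_mult_left pairing_mult_right sweedler2_distrib mult_ac
        cong: sweedler2_cong_simp)
qed

lemma linear_on_mult_D_right:
  assumes L: "linear_on T ground L" and cl: "x \<in> carrier H" "y \<in> carrier H"
    "z \<in> carrier H" "w \<in> carrier H" "a \<in> carrier H" "b \<in> carrier H"
  shows "L (mult D (a \<otimes>\<^bsub>H,H\<^esub> b) (mult H x y \<otimes>\<^bsub>H,H\<^esub> mult H z w)) =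
     sweedler2 H (\<lambda>a1 a2. sweedler2 H (\<lambda>b1 b2. sweedler2 H (\<lambda>x1 x2. sweedler2 H (\<lambda>y1 y2.
       sweedler2 H (\<lambda>z1 z2. sweedler2 H (\<lambda>w1 w2. sweedler2 H (\<lambda>a3 a4. sweedler2 H (\<lambda>b3 b4.
       \<phi> a3 z2 * \<phi> a4 w2 * (\<phi> x2 b3 * \<phi> y2 b4 *
       L (mult H a2 (mult H x1 y1) \<otimes>\<^bsub>H,H\<^esub> mult H b2 (mult H z1 w1)))) b1) a1) w) z) y) x) b) a"
proof -
  have "L (mult D (a \<otimes>\<^bsub>H,H\<^esub> b) (mult H x y \<otimes>\<^bsub>H,H\<^esub> mult H z w)) =
    sweedler2 H (\<lambda>a1 a2. sweedler2 H (\<lambda>b1 b2. sweedler2 H (\<lambda>x1 x2. sweedler2 H (\<lambda>y1 y2. sweedler2 H (\<lambda>d1 d2.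
       \<phi> a1 d2 * \<phi> (mult H x2 y2) b1 * L (mult H a2 (mult H x1 y1) \<otimes>\<^bsub>H,H\<^esub> mult H b2 d1))
       (mult H z w)) y) x) b) a"
    unfolding linear_on_mult_D[OF L cl(5,6) mult_closed[OF cl(1,2)] mult_closed[OF cl(3,4)]]
    by (rule sweedler2_cong[OF cl(5)], rule sweedler2_cong[OF cl(6)],
        rule sweedler2_mult[OF vec_space_ground _ _ cl(1,2)];
        intro scalar_linear_intros linear_on_compose[OF _ L] cl; assumption)
  also have "\<dots> = sweedler2 H (\<lambda>a1 a2. sweedler2 H (\<lambda>b1 b2. sweedler2 H (\<lambda>x1 x2. sweedler2 H (\<lambda>y1 y2.
      sweedler2 H (\<lambda>z1 z2. sweedler2 H (\<lambda>w1 w2. \<phi> a1 (mult H z2 w2) * \<phi> (mult H x2 y2) b1 *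
        L (mult H a2 (mult H x1 y1) \<otimes>\<^bsub>H,H\<^esub> mult H b2 (mult H z1 w1))) w) z) y) x) b) a"
    by (rule sweedler2_cong[OF cl(5)], rule sweedler2_cong[OF cl(6)],
        rule sweedler2_cong[OF cl(1)], rule sweedler2_cong[OF cl(2)],
        rule sweedler2_mult[OF vec_space_ground _ _ cl(3,4)];
        intro scalar_linear_intros linear_on_compose[OF _ L] cl; assumption)
  finally show ?thesis
    using cl by (simp add: pairing_mult_left pairing_mult_right sweedler2_distrib mult_ac
        cong: sweedler2_cong_simp)
qed

lemma mult_D_assoc_pure:
  assumes cl: "a \<in> carrier H" "b \<in> carrier H" "c \<in> carrier H" "d \<in> carrier H"
    "e \<in> carrier H" "f \<in> carrier H"
  shows "mult D (mult D (a \<otimes>\<^bsub>H,H\<^esub> b) (c \<otimes>\<^bsub>H,H\<^esub> d)) (e \<otimes>\<^bsub>H,H\<^esub> f) =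
    mult D (a \<otimes>\<^bsub>H,H\<^esub> b) (mult D (c \<otimes>\<^bsub>H,H\<^esub> d) (e \<otimes>\<^bsub>H,H\<^esub> f))" (is "?lhs = ?rhs")
proof (rule functional_eqI[OF vec_space_T])
  show "?lhs \<in> carrier T" "?rhs \<in> carrier T"
    by (intro mult_D_closed pure_tensor_closed cl)+
  fix L assume L: "linear_on T ground L"
  \<comment> \<open>Three factors per argument: \<phi>(a1, d3) \<phi>(c3, b1) \<phi>(a2, f2)
    \<phi>(c1, f3) \<phi>(e2, b2) \<phi>(e3, d1) times L(a3 c2 e1 \<otimes> b3 d2 f1). On the left
    the first two pairings come from the inner product; on the right those of c with f and of e with
    d do.\<close>
  define F where "F l = \<phi> (l ! 0) (l ! 11) * (\<phi> (l ! 8) (l ! 3) * (\<phi> (l ! 1) (l ! 16) *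
      (\<phi> (l ! 6) (l ! 17) * (\<phi> (l ! 13) (l ! 4) * (\<phi> (l ! 14) (l ! 9) *
      L (mult H (mult H (l ! 2) (l ! 7)) (l ! 12) \<otimes>\<^bsub>H,H\<^esub> mult H (mult H (l ! 5) (l ! 10)) (l ! 15)))))))" for l
  have F: "multilinear 18 F"
    by (rule multilinear_nthI, unfold numeral_nat F_def, elim less_SucE less_zeroE; simp;
      auto intro!: scalar_linear_intros linear_on_compose[OF _ L])
  have "L ?lhs = split_sum [0,2,4,6,1,5,4,9,12,14,13,16] F [a,b,c,d,e,f]"
    unfolding linear_on_mult_D[OF linear_on_compose[OF bilinear_on_left[OF mult_D_bilinear linear_on_ident
        pure_tensor_closed[OF cl(5,6)]] L] cl(1-4)]
    using cl by (simp add: linear_on_mult_D_left[OF L] F_def sweedler2_distrib mult_ac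
        cong: sweedler2_cong_simp)
  also have "\<dots> = split_sum [2,4,6,8,0,2,5,9,8,13,0,3] F [a,b,c,d,e,f]"
    by (rule split_sum_eqI[OF _ F]) (simp_all add: cl)
  also have "\<dots> = L ?rhs"
    unfolding linear_on_mult_D[OF linear_on_compose[OF bilinear_on_right[OF mult_D_bilinear linear_on_ident
        pure_tensor_closed[OF cl(1,2)]] L] cl(3-6)]
    using cl by (simp add: linear_on_mult_D_right[OF L] F_def sweedler2_distrib mult_ac mult_assoc mult_closed
        cong: sweedler2_cong_simp)
  finally show "L ?lhs = L ?rhs" .
qed


lemma one_D: "one D = one H \<otimes>\<^bsub>H,H\<^esub> one H"
  by (simp add: iota_double_def)

lemma one_D_closed: "one D \<in> carrier T"
  unfolding one_D by (intro pure_tensor_closed one_closed)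

lemma mult_D_one_pure:
  assumes cl: "a \<in> carrier H" "b \<in> carrier H"
  shows "mult D (one D) (a \<otimes>\<^bsub>H,H\<^esub> b) = a \<otimes>\<^bsub>H,H\<^esub> b" (is "?lhs = _")
    and "mult D (a \<otimes>\<^bsub>H,H\<^esub> b) (one D) = a \<otimes>\<^bsub>H,H\<^esub> b" (is "?rhs = _")
proof -
  note ab = pure_tensor_closed[OF cl]
  note lin = scalar_linear_intros cl one_closed bilinear_onI
  have c: "sweedler2 H (\<lambda>x y. counit H y * G x) u = G u" "sweedler2 H (\<lambda>x y. counit H x * G y) u = G u"
    if "linear_on H ground G" "u \<in> carrier H" for G u
    using sweedler2_counit[OF that(2,1)] by simp_all
  show "?lhs = a \<otimes>\<^bsub>H,H\<^esub> b"
  proof (rule functional_eqI[OF vec_space_T mult_D_closed[OF one_D_closed ab] ab])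
    fix L assume L: "linear_on T ground L"
    note lin = lin linear_on_compose[OF _ L]
    have "L ?lhs = sweedler2 H (\<lambda>b1 b2. sweedler2 H (\<lambda>c1 c2. sweedler2 H (\<lambda>d1 d2.
       \<phi> (one H) d2 * \<phi> c2 b1 * L (mult H (one H) c1 \<otimes>\<^bsub>H,H\<^esub> mult H b2 d1)) b) a) (one H)"
      unfolding one_D linear_on_mult_D[OF L one_closed one_closed cl]
      by (rule sweedler2_one[OF vec_space_ground]) (intro lin; assumption)
    also have "\<dots> = sweedler2 H (\<lambda>c1 c2. sweedler2 H (\<lambda>d1 d2.
       \<phi> (one H) d2 * \<phi> c2 (one H) * L (mult H (one H) c1 \<otimes>\<^bsub>H,H\<^esub> mult H (one H) d1)) b) a"
      by (rule sweedler2_one[OF vec_space_ground]) (intro lin; assumption)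
    also have "\<dots> = sweedler2 H (\<lambda>c1 c2. counit H c2 * sweedler2 H (\<lambda>d1 d2.
       counit H d2 * L (c1 \<otimes>\<^bsub>H,H\<^esub> d1)) b) a"
      using cl by (simp add: pairing_one_left pairing_one_right mult_one_left sweedler2_distrib mult_ac
          cong: sweedler2_cong_simp)
    also have "\<dots> = L (a \<otimes>\<^bsub>H,H\<^esub> b)"
      using cl by (subst c) (auto intro!: lin c)
    finally show "L ?lhs = L (a \<otimes>\<^bsub>H,H\<^esub> b)" .
  qed
  show "?rhs = a \<otimes>\<^bsub>H,H\<^esub> b"
  proof (rule functional_eqI[OF vec_space_T mult_D_closed[OF ab one_D_closed] ab])
    fix L assume L: "linear_on T ground L"
    note lin = lin linear_on_compose[OF _ L]
    have "L ?rhs = sweedler2 H (\<lambda>a1 a2. sweedler2 H (\<lambda>b1 b2. sweedler2 H (\<lambda>d1 d2.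
       \<phi> a1 d2 * \<phi> (one H) b1 * L (mult H a2 (one H) \<otimes>\<^bsub>H,H\<^esub> mult H b2 d1)) (one H)) b) a"
      unfolding one_D linear_on_mult_D[OF L cl one_closed one_closed]
      by (rule sweedler2_cong[OF cl(1)], rule sweedler2_cong[OF cl(2)],
          rule sweedler2_one[OF vec_space_ground]) (intro lin; assumption)
    also have "\<dots> = sweedler2 H (\<lambda>a1 a2. sweedler2 H (\<lambda>b1 b2.
       \<phi> a1 (one H) * \<phi> (one H) b1 * L (mult H a2 (one H) \<otimes>\<^bsub>H,H\<^esub> mult H b2 (one H))) b) a"
      by (rule sweedler2_cong[OF cl(1)], rule sweedler2_cong[OF cl(2)],
          rule sweedler2_one[OF vec_space_ground]) (intro lin; assumption)
    also have "\<dots> = sweedler2 H (\<lambda>a1 a2. counit H a1 * sweedler2 H (\<lambda>b1 b2.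
       counit H b1 * L (a2 \<otimes>\<^bsub>H,H\<^esub> b2)) b) a"
      using cl by (simp add: pairing_one_left pairing_one_right mult_one_right sweedler2_distrib mult_ac
          cong: sweedler2_cong_simp)
    also have "\<dots> = L (a \<otimes>\<^bsub>H,H\<^esub> b)"
      using cl by (subst c) (auto intro!: lin c)
    finally show "L ?rhs = L (a \<otimes>\<^bsub>H,H\<^esub> b)" .
  qed
qed

lemmas mult_D_linear_left = bilinear_on_left[OF mult_D_bilinear]
lemmas mult_D_linear_right = bilinear_on_right[OF mult_D_bilinear]

text \<open>Pure tensors are replaced by general ones in the last argument, then the middle one,
  then the first.\<close>

lemma mult_D_assoc:
  assumes r: "r \<in> carrier T" and s: "s \<in> carrier T" and t: "t \<in> carrier T"
  shows "mult D (mult D r s) t = mult D r (mult D s t)"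
proof -
  note lin = mult_D_linear_left mult_D_linear_right linear_on_ident mult_D_closed pure_tensor_closed
  note eqI = linear_on_tensor_eqI[OF vec_space_C vec_space_C vec_space_T]
  have 1: "mult D (mult D (a \<otimes>\<^bsub>H,H\<^esub> b) (c \<otimes>\<^bsub>H,H\<^esub> d)) t =
      mult D (a \<otimes>\<^bsub>H,H\<^esub> b) (mult D (c \<otimes>\<^bsub>H,H\<^esub> d) t)"
    if "a \<in> carrier H" "b \<in> carrier H" "c \<in> carrier H" "d \<in> carrier H" for a b c d
    by (rule eqI[where f = "\<lambda>t. mult D (mult D (a \<otimes>\<^bsub>H,H\<^esub> b) (c \<otimes>\<^bsub>H,H\<^esub> d)) t"
          and g = "\<lambda>t. mult D (a \<otimes>\<^bsub>H,H\<^esub> b) (mult D (c \<otimes>\<^bsub>H,H\<^esub> d) t)"])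
      (intro lin that t mult_D_assoc_pure; assumption)+
  have 2: "mult D (mult D (a \<otimes>\<^bsub>H,H\<^esub> b) s) t = mult D (a \<otimes>\<^bsub>H,H\<^esub> b) (mult D s t)"
    if "a \<in> carrier H" "b \<in> carrier H" for a b
    by (rule eqI[where f = "\<lambda>s. mult D (mult D (a \<otimes>\<^bsub>H,H\<^esub> b) s) t"
          and g = "\<lambda>s. mult D (a \<otimes>\<^bsub>H,H\<^esub> b) (mult D s t)"])
      (intro lin that s t 1; assumption)+
  show ?thesis
    by (rule eqI[where f = "\<lambda>r. mult D (mult D r s) t" and g = "\<lambda>r. mult D r (mult D s t)"])
      (intro lin r s t 2; assumption)+
qed

lemma D_assoc_algebra: "assoc_algebra D"
proof (intro assoc_algebra.intro assoc_algebra_axioms.intro)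
  show "vec_space D" by (rule D_vec_space)
  show "bilinear_on D D D (mult D)"
    using mult_D_bilinear by (simp add: bilinear_on_same_space[OF D_space D_space D_space])
  note eqI = linear_on_tensor_eqI[OF vec_space_C vec_space_C vec_space_T]
  show "mult D (one D) a = a" "mult D a (one D) = a" if "a \<in> carrier D" for a
  proof -
    have a: "a \<in> carrier T" using that by (simp add: D_carrier)
    show "mult D (one D) a = a"
      by (rule eqI[where f = "mult D (one D)" and g = "\<lambda>a. a"])
        (intro mult_D_linear_right[where g = "\<lambda>a. a"] linear_on_ident one_D_closed mult_D_one_pure a; assumption)+
    show "mult D a (one D) = a"
      by (rule eqI[where f = "\<lambda>a. mult D a (one D)" and g = "\<lambda>a. a"])
        (intro mult_D_linear_left linear_on_ident one_D_closed mult_D_one_pure a; assumption)+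
  qed
qed (simp_all add: D_carrier mult_D_assoc one_D_closed)

section \<open>Coproduct of \<open>iota_double\<close>\<close>

definition double_comult :: "'a \<Rightarrow> 'a \<Rightarrow> ('f, ('f, 'a, 'a) tensor, ('f, 'a, 'a) tensor) tensor" where
  "double_comult a b =
     sweedler3 H (\<lambda>a1 a2 a3. sweedler3 H (\<lambda>b1 b2 b3. smult (T \<Otimes> T) (\<phi> a2 b2)
       ((a1 \<otimes>\<^bsub>H,H\<^esub> b3) \<otimes>\<^bsub>T,T\<^esub> (a3 \<otimes>\<^bsub>H,H\<^esub> b1))) b) a"

lemma double_comult_bilinear: "bilinear_on H H (T \<Otimes> T) double_comult"
  unfolding double_comult_def sweedler3_def
  by (intro bilinear_onI linear_on_sweedler2_param linear_on_sweedler2_arg vec_space_TT vec_space_T vec_space_C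
      linear_on_smult_left linear_on_smult_right linear_on_pure_left linear_on_pure_right
      pairing_linear_intros pure_tensor_closed; assumption)

lemma comult_D_eq: "comult D = tensor_lift H H double_comult"
  by (simp add: iota_double_def double_comult_def[abs_def])

lemma comult_D_linear: "linear_on T (T \<Otimes> T) (comult D)"
  unfolding comult_D_eq by (rule tensor_universal(1)[OF vec_space_C vec_space_C vec_space_TT double_comult_bilinear])

lemma comult_D_closed: "t \<in> carrier T \<Longrightarrow> comult D t \<in> carrier (T \<Otimes> T)"
  by (rule linear_on_closed[OF comult_D_linear])

lemma comult_D_pure: "a \<in> carrier H \<Longrightarrow> b \<in> carrier H \<Longrightarrow>
    comult D (a \<otimes>\<^bsub>H,H\<^esub> b) = double_comult a b"
  unfolding comult_D_eq by (rule tensor_universal(2)[OF vec_space_C vec_space_C vec_space_TT double_comult_bilinear])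

lemma linear_on_comult_D:
  assumes L: "linear_on (T \<Otimes> T) ground L" and "a \<in> carrier H" "b \<in> carrier H"
  shows "L (comult D (a \<otimes>\<^bsub>H,H\<^esub> b)) =
    sweedler2 H (\<lambda>a1 r. sweedler2 H (\<lambda>a2 a3. sweedler2 H (\<lambda>b1 s. sweedler2 H (\<lambda>b2 b3. \<phi> a2 b2 *
      L ((a1 \<otimes>\<^bsub>H,H\<^esub> b3) \<otimes>\<^bsub>T,T\<^esub> (a3 \<otimes>\<^bsub>H,H\<^esub> b1))) s) b) r) a"
  using assms
  by (simp add: comult_D_pure double_comult_def sweedler3_def linear_on_sweedler2[OF L vec_space_TT]
      sweedler2_closed[OF _ vec_space_TT] smult_closed[OF vec_space_TT] pure_tensor_closed linear_on_smult[OF L]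
      cong: sweedler2_cong_simp)

lemma comult_D_coassoc_pure:
  assumes cl: "a \<in> carrier H" "b \<in> carrier H"
  shows "tensor_assoc T T T (tensor_map T T (T \<Otimes> T) T (comult D) id (comult D (a \<otimes>\<^bsub>H,H\<^esub> b))) =
    tensor_map T T T (T \<Otimes> T) id (comult D) (comult D (a \<otimes>\<^bsub>H,H\<^esub> b))" (is "?lhs = ?rhs")
proof (rule functional_eqI[OF vec_space_tensor[OF vec_space_T]])
  note ab = pure_tensor_closed[OF cl]
  have idT: "linear_on T T id" using linear_on_ident by (simp add: id_def)
  note map1 = linear_on_tensor_map[OF vec_space_T vec_space_T vec_space_TT vec_space_T comult_D_linear idT]
  note map2 = linear_on_tensor_map[OF vec_space_T vec_space_T vec_space_T vec_space_TT idT comult_D_linear]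
  note assoc = linear_on_tensor_assoc[OF vec_space_T vec_space_T vec_space_T]
  show "?lhs \<in> carrier (T \<Otimes> T \<Otimes> T)"
    by (intro linear_on_closed[OF assoc] linear_on_closed[OF map1] comult_D_closed ab)
  show "?rhs \<in> carrier (T \<Otimes> T \<Otimes> T)"
    by (intro linear_on_closed[OF map2] comult_D_closed ab)
  fix L assume L: "linear_on (T \<Otimes> T \<Otimes> T) ground L"
  have L1: "L (tensor_assoc T T T (comult D (x \<otimes>\<^bsub>H,H\<^esub> y) \<otimes>\<^bsub>T \<Otimes> T,T\<^esub> t)) =
      sweedler2 H (\<lambda>a1 r. sweedler2 H (\<lambda>a2 a3. sweedler2 H (\<lambda>b1 s. sweedler2 H (\<lambda>b2 b3. \<phi> a2 b2 *
      L ((a1 \<otimes>\<^bsub>H,H\<^esub> b3) \<otimes>\<^bsub>T,T \<Otimes> T\<^esub> ((a3 \<otimes>\<^bsub>H,H\<^esub> b1) \<otimes>\<^bsub>T,T\<^esub> t))) s) y) r) x"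
    if "x \<in> carrier H" "y \<in> carrier H" "t \<in> carrier T" for x y t
  proof -
    have "linear_on (T \<Otimes> T) ground (\<lambda>s. L (tensor_assoc T T T (s \<otimes>\<^bsub>T \<Otimes> T,T\<^esub> t)))"
      by (intro linear_on_compose[OF _ L] linear_on_compose[OF _ assoc] linear_on_pure_left
          vec_space_TT vec_space_T linear_on_ident that)
    from linear_on_comult_D[OF this that(1,2)] show ?thesis
      using that by (simp add: tensor_assoc_pure[OF vec_space_T vec_space_T vec_space_T] pure_tensor_closed cong: sweedler2_cong_simp)
  qed
  have L2: "L (s \<otimes>\<^bsub>T,T \<Otimes> T\<^esub> comult D (x \<otimes>\<^bsub>H,H\<^esub> y)) =
      sweedler2 H (\<lambda>a1 r. sweedler2 H (\<lambda>a2 a3. sweedler2 H (\<lambda>b1 q. sweedler2 H (\<lambda>b2 b3. \<phi> a2 b2 *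
      L (s \<otimes>\<^bsub>T,T \<Otimes> T\<^esub> ((a1 \<otimes>\<^bsub>H,H\<^esub> b3) \<otimes>\<^bsub>T,T\<^esub> (a3 \<otimes>\<^bsub>H,H\<^esub> b1)))) q) y) r) x"
    if "x \<in> carrier H" "y \<in> carrier H" "s \<in> carrier T" for x y s
  proof -
    have "linear_on (T \<Otimes> T) ground (\<lambda>t. L (s \<otimes>\<^bsub>T,T \<Otimes> T\<^esub> t))"
      by (intro linear_on_compose[OF _ L] linear_on_pure_right vec_space_TT vec_space_T linear_on_ident that)
    from linear_on_comult_D[OF this that(1,2)] show ?thesis .
  qed
  \<comment> \<open>Five factors each: \<phi>(a4, b2) \<phi>(a2, b4) and the blocks a1 \<otimes> b5,
    a3 \<otimes> b3, a5 \<otimes> b1. The factors of a run upwards and those of b downwards, with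
    one pairing between neighbouring blocks; repeating the coproduct on either leg inserts the
    missing pairing.\<close>
  define F where "F l = \<phi> (l ! 3) (l ! 6) * (\<phi> (l ! 1) (l ! 8) *
    L ((l ! 0 \<otimes>\<^bsub>H,H\<^esub> l ! 9) \<otimes>\<^bsub>T,T \<Otimes> T\<^esub> ((l ! 2 \<otimes>\<^bsub>H,H\<^esub> l ! 7) \<otimes>\<^bsub>T,T\<^esub> (l ! 4 \<otimes>\<^bsub>H,H\<^esub> l ! 5))))" for l
  have F: "multilinear 10 F"
    by (rule multilinear_nthI, unfold numeral_nat F_def, elim less_SucE less_zeroE; simp;
      auto intro!: scalar_linear_intros linear_on_compose[OF _ L] vec_space_TT)
  have "L ?lhs = split_sum [0,1,3,4,0,1,7,8] F [a,b]"
    unfolding linear_on_comult_D[OF linear_on_compose[OF map1 linear_on_compose[OF assoc L]] cl]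
    using cl by (simp add: tensor_map_pure[OF vec_space_T vec_space_T vec_space_TT vec_space_T comult_D_linear idT] pure_tensor_closed L1
        F_def sweedler2_distrib mult_ac cong: sweedler2_cong_simp)
  also have "\<dots> = split_sum [0,1,3,4,2,3,5,6] F [a,b]"
    by (rule split_sum_eqI[OF _ F]) (simp_all add: cl)
  also have "\<dots> = L ?rhs"
    unfolding linear_on_comult_D[OF linear_on_compose[OF map2 L] cl]
    using cl by (simp add: tensor_map_pure[OF vec_space_T vec_space_T vec_space_T vec_space_TT idT comult_D_linear] pure_tensor_closed L2
        F_def sweedler2_distrib mult_ac cong: sweedler2_cong_simp)
  finally show "L ?lhs = L ?rhs" .
qed

section \<open>Counit of \<open>iota_double\<close>\<close>

lemma counit_D_eq: "counit D = tensor_lift H H \<eta>"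
  by (simp add: iota_double_def \<eta>_def[abs_def] inv_antipode_def)

lemma counit_D_linear: "linear_on T ground (counit D)"
  unfolding counit_D_eq by (rule tensor_universal(1)[OF vec_space_C vec_space_C vec_space_ground eta_bilinear])

lemma counit_D_pure: "a \<in> carrier H \<Longrightarrow> b \<in> carrier H \<Longrightarrow> counit D (a \<otimes>\<^bsub>H,H\<^esub> b) = \<eta> a b"
  unfolding counit_D_eq by (rule tensor_universal(2)[OF vec_space_C vec_space_C vec_space_ground eta_bilinear])

lemmas eta_linear_intros = linear_on_eta_left linear_on_eta_right

lemma counit_left_bilinear: "bilinear_on T T T (\<lambda>x y. smult T (counit D x) y)"
  and counit_right_bilinear: "bilinear_on T T T (\<lambda>x y. smult T (counit D y) x)"
  by (intro bilinear_onI linear_on_smult_left linear_on_smult_right vec_space_T counit_D_linear linear_on_ident;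
      assumption)+

lemma counit_D_pure_laws:
  assumes cl: "a \<in> carrier H" "b \<in> carrier H"
  shows "tensor_lift T T (\<lambda>x y. smult T (counit D x) y) (comult D (a \<otimes>\<^bsub>H,H\<^esub> b)) = a \<otimes>\<^bsub>H,H\<^esub> b"
      (is "?lhs = _")
    and "tensor_lift T T (\<lambda>x y. smult T (counit D y) x) (comult D (a \<otimes>\<^bsub>H,H\<^esub> b)) = a \<otimes>\<^bsub>H,H\<^esub> b"
      (is "?rhs = _")
proof -
  note ab = pure_tensor_closed[OF cl]
  note l = tensor_universal[OF vec_space_T vec_space_T vec_space_T counit_left_bilinear]
    and r = tensor_universal[OF vec_space_T vec_space_T vec_space_T counit_right_bilinear]
  have c: "sweedler2 H (\<lambda>x y. counit H y * G x) u = G u" "sweedler2 H (\<lambda>x y. counit H x * G y) u = G u"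
    if "linear_on H ground G" "u \<in> carrier H" for G u
    using sweedler2_counit[OF that(2,1)] by simp_all
  note lin = scalar_linear_intros eta_linear_intros cl
  show "?lhs = a \<otimes>\<^bsub>H,H\<^esub> b"
  proof (rule functional_eqI[OF vec_space_T linear_on_closed[OF l(1) comult_D_closed[OF ab]] ab])
    fix L assume L: "linear_on T ground L"
    define F where "F l = \<phi> (l ! 1) (l ! 4) * (\<eta> (l ! 0) (l ! 5) * L (l ! 2 \<otimes>\<^bsub>H,H\<^esub> l ! 3))" for l
    have F: "multilinear 6 F"
      by (rule multilinear_nthI, unfold numeral_nat F_def, elim less_SucE less_zeroE; simp;
        auto intro!: lin linear_on_compose[OF _ L])
    have "L ?lhs = split_sum [0,1,3,4] F [a,b]"
      unfolding linear_on_comult_D[OF linear_on_compose[OF l(1) L] cl]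
      using cl by (simp add: l(2) pure_tensor_closed counit_D_pure linear_on_smult[OF L]
          F_def sweedler2_distrib mult_ac cong: sweedler2_cong_simp)
    \<comment> \<open>Regrouped so that a1, a2 are the factors of one element A and b2, b3 those of
      one element B. Then \<eta>(a1, b3) \<phi>(a2, b2) collapses by the second law of
      \<open>pairing_eta\<close>.\<close>
    also have "\<dots> = split_sum [0,2,0,4] F [a,b]"
      by (rule split_sum_eqI[OF _ F]) (simp_all add: cl)
    also have "\<dots> = sweedler2 H (\<lambda>A a3. sweedler2 H (\<lambda>b1 B. sweedler2 H (\<lambda>a1 a2. sweedler2 H (\<lambda>b2 b3.
        \<eta> a1 b3 * \<phi> a2 b2) B) A * L (a3 \<otimes>\<^bsub>H,H\<^esub> b1)) b) a"
      using cl by (simp add: F_def sweedler2_distrib mult_ac cong: sweedler2_cong_simp)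
    also have "\<dots> = sweedler2 H (\<lambda>A a3. sweedler2 H (\<lambda>b1 B. counit H A * counit H B * L (a3 \<otimes>\<^bsub>H,H\<^esub> b1)) b) a"
      using cl by (simp add: pairing_eta cong: sweedler2_cong_simp)
    also have "\<dots> = sweedler2 H (\<lambda>A a3. counit H A * sweedler2 H (\<lambda>b1 B. counit H B * L (a3 \<otimes>\<^bsub>H,H\<^esub> b1)) b) a"
      by (simp add: sweedler2_distrib mult.assoc)
    also have "\<dots> = L (a \<otimes>\<^bsub>H,H\<^esub> b)"
      using cl by (subst c) (auto intro!: lin linear_on_compose[OF _ L] linear_on_times_right c)
    finally show "L ?lhs = L (a \<otimes>\<^bsub>H,H\<^esub> b)" .
  qed
  show "?rhs = a \<otimes>\<^bsub>H,H\<^esub> b"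
  proof (rule functional_eqI[OF vec_space_T linear_on_closed[OF r(1) comult_D_closed[OF ab]] ab])
    fix L assume L: "linear_on T ground L"
    define F where "F l = \<phi> (l ! 1) (l ! 4) * (\<eta> (l ! 2) (l ! 3) * L (l ! 0 \<otimes>\<^bsub>H,H\<^esub> l ! 5))" for l
    have F: "multilinear 6 F"
      by (rule multilinear_nthI, unfold numeral_nat F_def, elim less_SucE less_zeroE; simp;
        auto intro!: lin linear_on_compose[OF _ L])
    have "L ?rhs = split_sum [0,1,3,4] F [a,b]"
      unfolding linear_on_comult_D[OF linear_on_compose[OF r(1) L] cl]
      using cl by (simp add: r(2) pure_tensor_closed counit_D_pure linear_on_smult[OF L]
          F_def sweedler2_distrib mult_ac cong: sweedler2_cong_simp)
    \<comment> \<open>Now a2, a3 and b1, b2 are grouped, and \<phi>(a2, b2) \<eta>(a3, b1) collapses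
      by the first law.\<close>
    also have "\<dots> = split_sum [0,2,1,3] F [a,b]"
      by (rule split_sum_eqI[OF _ F]) (simp_all add: cl)
    also have "\<dots> = sweedler2 H (\<lambda>a1 A. sweedler2 H (\<lambda>B b3. sweedler2 H (\<lambda>a2 a3. sweedler2 H (\<lambda>b1 b2.
        \<phi> a2 b2 * \<eta> a3 b1) B) A * L (a1 \<otimes>\<^bsub>H,H\<^esub> b3)) b) a"
      using cl by (simp add: F_def sweedler2_distrib mult_ac cong: sweedler2_cong_simp)
    also have "\<dots> = sweedler2 H (\<lambda>a1 A. sweedler2 H (\<lambda>B b3. counit H A * counit H B * L (a1 \<otimes>\<^bsub>H,H\<^esub> b3)) b) a"
      using cl by (simp add: pairing_eta cong: sweedler2_cong_simp)
    also have "\<dots> = sweedler2 H (\<lambda>a1 A. counit H A * sweedler2 H (\<lambda>B b3. counit H B * L (a1 \<otimes>\<^bsub>H,H\<^esub> b3)) b) a"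
      by (simp add: sweedler2_distrib mult.assoc)
    also have "\<dots> = L (a \<otimes>\<^bsub>H,H\<^esub> b)"
      using cl by (subst c) (auto intro!: lin linear_on_compose[OF _ L] linear_on_times_right c)
    finally show "L ?rhs = L (a \<otimes>\<^bsub>H,H\<^esub> b)" .
  qed
qed


section \<open>Multiplicativity of coproduct and counit of \<open>iota_double\<close>\<close>

lemma D_tensor: "D \<Otimes> D = T \<Otimes> T"
  by (rule tensor_space_same_space[OF D_space D_space])

lemma linear_on_comult_D_mult:
  assumes L: "linear_on (T \<Otimes> T) ground L" and cl: "x \<in> carrier H" "y \<in> carrier H"
    "z \<in> carrier H" "w \<in> carrier H"
  shows "L (comult D (mult H x y \<otimes>\<^bsub>H,H\<^esub> mult H z w)) =
    sweedler2 H (\<lambda>x1 x'. sweedler2 H (\<lambda>x2 x3. sweedler2 H (\<lambda>y1 y'. sweedler2 H (\<lambda>y2 y3.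
    sweedler2 H (\<lambda>z1 z'. sweedler2 H (\<lambda>z2 z3. sweedler2 H (\<lambda>w1 w'. sweedler2 H (\<lambda>w2 w3.
    sweedler2 H (\<lambda>x4 x5. sweedler2 H (\<lambda>y4 y5. sweedler2 H (\<lambda>z4 z5. sweedler2 H (\<lambda>w4 w5.
      \<phi> x4 z4 * \<phi> y4 z5 * (\<phi> x5 w4 * \<phi> y5 w5) *
      L ((mult H x1 y1 \<otimes>\<^bsub>H,H\<^esub> mult H z3 w3) \<otimes>\<^bsub>T,T\<^esub> (mult H x3 y3 \<otimes>\<^bsub>H,H\<^esub> mult H z1 w1)))
      w2) z2) y2) x2) w') w) z') z) y') y) x') x"
proof -
  note lin = scalar_linear_intros linear_on_compose[OF _ L] cl
  have "L (comult D (mult H x y \<otimes>\<^bsub>H,H\<^esub> mult H z w)) =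
    sweedler2 H (\<lambda>x1 x'. sweedler2 H (\<lambda>x2 x3. sweedler2 H (\<lambda>y1 y'. sweedler2 H (\<lambda>y2 y3.
    sweedler2 H (\<lambda>b1 s. sweedler2 H (\<lambda>b2 b3. \<phi> (mult H x2 y2) b2 *
      L ((mult H x1 y1 \<otimes>\<^bsub>H,H\<^esub> b3) \<otimes>\<^bsub>T,T\<^esub> (mult H x3 y3 \<otimes>\<^bsub>H,H\<^esub> b1))) s) (mult H z w)) y') y) x') x"
    unfolding linear_on_comult_D[OF L mult_closed[OF cl(1,2)] mult_closed[OF cl(3,4)]]
    by (rule sweedler3_mult[OF cl(1,2)]; intro lin; assumption)
  also have "\<dots> =
    sweedler2 H (\<lambda>x1 x'. sweedler2 H (\<lambda>x2 x3. sweedler2 H (\<lambda>y1 y'. sweedler2 H (\<lambda>y2 y3.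
    sweedler2 H (\<lambda>z1 z'. sweedler2 H (\<lambda>z2 z3. sweedler2 H (\<lambda>w1 w'. sweedler2 H (\<lambda>w2 w3.
      \<phi> (mult H x2 y2) (mult H z2 w2) *
      L ((mult H x1 y1 \<otimes>\<^bsub>H,H\<^esub> mult H z3 w3) \<otimes>\<^bsub>T,T\<^esub> (mult H x3 y3 \<otimes>\<^bsub>H,H\<^esub> mult H z1 w1)))
      w') w) z') z) y') y) x') x"
    by (rule sweedler2_cong[OF cl(1)], rule sweedler2_cong, assumption, rule sweedler2_cong[OF cl(2)],
        rule sweedler2_cong, assumption, rule sweedler3_mult[OF cl(3,4)]; intro lin; assumption)
  finally show ?thesis
    using cl by (simp add: pairing_mult_mult sweedler2_distrib cong: sweedler2_cong_simp)
qed

lemma comult_D_mult_pure: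
  assumes cl: "a \<in> carrier H" "b \<in> carrier H" "c \<in> carrier H" "d \<in> carrier H"
  shows "comult D (mult D (a \<otimes>\<^bsub>H,H\<^esub> b) (c \<otimes>\<^bsub>H,H\<^esub> d)) =
    mult (tensor_algebra D D) (comult D (a \<otimes>\<^bsub>H,H\<^esub> b)) (comult D (c \<otimes>\<^bsub>H,H\<^esub> d))" (is "?lhs = ?rhs")
proof (rule functional_eqI[OF vec_space_TT])
  note mD = tensor_algebra_mult_bilinear[OF D_vec_space assoc_algebra.mult_bilinear[OF D_assoc_algebra]
      D_vec_space assoc_algebra.mult_bilinear[OF D_assoc_algebra], unfolded D_tensor]
  note mD_pure = tensor_algebra_mult_pure[OF D_vec_space assoc_algebra.mult_bilinear[OF D_assoc_algebra]
      D_vec_space assoc_algebra.mult_bilinear[OF D_assoc_algebra], unfolded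
      pure_tensor_same_space[OF D_space D_space] D_carrier]
  note ab = pure_tensor_closed[OF cl(1,2)] and cd = pure_tensor_closed[OF cl(3,4)]
  show "?lhs \<in> carrier (T \<Otimes> T)" by (intro comult_D_closed mult_D_closed ab cd)
  show "?rhs \<in> carrier (T \<Otimes> T)" by (intro bilinear_on_closed[OF mD] comult_D_closed ab cd)
  fix L assume L: "linear_on (T \<Otimes> T) ground L"
  \<comment> \<open>Five factors per argument, with the tensor (a2 c1 \<otimes> b5 d4) \<otimes> (a5
    c4 \<otimes> b2 d1). On the left, \<phi>(a1, d5) \<phi>(c5, b1) come from the product and the
    other four pairings from pairing the middle parts of ac and bd. On the right, \<phi>(a3, b3) and
    \<phi>(c3, d3) come from the two coproducts and the other four from the products in the two
    legs.\<close>
  define F where "F l = \<phi> (l ! 0) (l ! 19) * (\<phi> (l ! 14) (l ! 5) * (\<phi> (l ! 2) (l ! 7) *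
    (\<phi> (l ! 11) (l ! 8) * (\<phi> (l ! 3) (l ! 16) * (\<phi> (l ! 12) (l ! 17) *
    L ((mult H (l ! 1) (l ! 10) \<otimes>\<^bsub>H,H\<^esub> mult H (l ! 9) (l ! 18)) \<otimes>\<^bsub>T,T\<^esub>
       (mult H (l ! 4) (l ! 13) \<otimes>\<^bsub>H,H\<^esub> mult H (l ! 6) (l ! 15))))))))" for l
  have F: "multilinear 20 F"
    by (rule multilinear_nthI, unfold numeral_nat F_def, elim less_SucE less_zeroE; simp;
      auto intro!: scalar_linear_intros linear_on_compose[OF _ L] vec_space_TT)
  have "L ?lhs = split_sum [0,2,4,6,1,2,6,7,5,6,12,13,2,10,7,16] F [a,b,c,d]"
    unfolding linear_on_mult_D[OF linear_on_compose[OF comult_D_linear L] cl]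
    using cl by (simp add: linear_on_comult_D_mult[OF L] F_def sweedler2_distrib mult_ac
        cong: sweedler2_cong_simp)
  also have "\<dots> = split_sum [0,1,3,4,6,7,9,10,0,6,8,14,3,5,13,15] F [a,b,c,d]"
    by (rule split_sum_eqI[OF _ F]) (simp_all add: cl)
  also have "\<dots> = L ?rhs"
  proof -
    have R1: "L (mult (tensor_algebra D D) s (comult D (c \<otimes>\<^bsub>H,H\<^esub> d))) =
      sweedler2 H (\<lambda>a1 r. sweedler2 H (\<lambda>a2 a3. sweedler2 H (\<lambda>b1 q. sweedler2 H (\<lambda>b2 b3. \<phi> a2 b2 *
      L (mult (tensor_algebra D D) s ((a1 \<otimes>\<^bsub>H,H\<^esub> b3) \<otimes>\<^bsub>T,T\<^esub> (a3 \<otimes>\<^bsub>H,H\<^esub> b1)))) q) d) r) c"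
      if "s \<in> carrier (T \<Otimes> T)" for s
      by (intro linear_on_comult_D linear_on_compose[OF _ L] bilinear_on_right[OF mD] linear_on_ident that cl)
    have R2: "L (mult D (x \<otimes>\<^bsub>H,H\<^esub> y) (z \<otimes>\<^bsub>H,H\<^esub> w) \<otimes>\<^bsub>T,T\<^esub> t) =
      sweedler2 H (\<lambda>a1 a2. sweedler2 H (\<lambda>b1 b2. sweedler2 H (\<lambda>c1 c2. sweedler2 H (\<lambda>d1 d2.
       \<phi> a1 d2 * \<phi> c2 b1 * L ((mult H a2 c1 \<otimes>\<^bsub>H,H\<^esub> mult H b2 d1) \<otimes>\<^bsub>T,T\<^esub> t)) w) z) y) x"
      if "x \<in> carrier H" "y \<in> carrier H" "z \<in> carrier H" "w \<in> carrier H" "t \<in> carrier T" for x y z w t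
      by (intro linear_on_mult_D linear_on_compose[OF _ L] linear_on_pure_left vec_space_T linear_on_ident that)
    have R3: "L (t \<otimes>\<^bsub>T,T\<^esub> mult D (x \<otimes>\<^bsub>H,H\<^esub> y) (z \<otimes>\<^bsub>H,H\<^esub> w)) =
      sweedler2 H (\<lambda>a1 a2. sweedler2 H (\<lambda>b1 b2. sweedler2 H (\<lambda>c1 c2. sweedler2 H (\<lambda>d1 d2.
       \<phi> a1 d2 * \<phi> c2 b1 * L (t \<otimes>\<^bsub>T,T\<^esub> (mult H a2 c1 \<otimes>\<^bsub>H,H\<^esub> mult H b2 d1))) w) z) y) x"
      if "x \<in> carrier H" "y \<in> carrier H" "z \<in> carrier H" "w \<in> carrier H" "t \<in> carrier T" for x y z w t
      by (intro linear_on_mult_D linear_on_compose[OF _ L] linear_on_pure_right vec_space_T linear_on_ident that)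
    show ?thesis
      unfolding linear_on_comult_D[OF linear_on_compose[OF bilinear_on_left[OF mD linear_on_ident
          comult_D_closed[OF cd]] L] cl(1,2)]
      \<comment> \<open>The product in the left leg is expanded before the one in the right leg;
        this fixes the order of the sums that the list of positions encodes.\<close>
      using cl by (simp add: R1 R2 mD_pure pure_tensor_closed mult_D_closed mult_closed
          cong: sweedler2_cong_simp)
        (simp add: R3 pure_tensor_closed mult_closed F_def sweedler2_distrib mult_ac
          cong: sweedler2_cong_simp)
  qed
  finally show "L ?lhs = L ?rhs" .
qed

text \<open>Expanding \<eta>(ac, bd) gives four values of \<eta>. The two that mix the tensors
  cancel against the two pairings \<phi> from the product.\<close>

lemma counit_D_mult_pure:
  assumes cl: "a \<in> carrier H" "b \<in> carrier H" "c \<in> carrier H" "d \<in> carrier H"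
  shows "counit D (mult D (a \<otimes>\<^bsub>H,H\<^esub> b) (c \<otimes>\<^bsub>H,H\<^esub> d)) =
    counit D (a \<otimes>\<^bsub>H,H\<^esub> b) * counit D (c \<otimes>\<^bsub>H,H\<^esub> d)"
proof -
  note lin = scalar_linear_intros eta_linear_intros cl
  have c: "sweedler2 H (\<lambda>x y. counit H y * G x) u = G u" "sweedler2 H (\<lambda>x y. counit H x * G y) u = G u"
    if "linear_on H ground G" "u \<in> carrier H" for G u
    using sweedler2_counit[OF that(2,1)] by simp_all
  have eta4: "\<eta> (mult H x y) (mult H z w) =
    sweedler2 H (\<lambda>x1 x2. sweedler2 H (\<lambda>y1 y2. sweedler2 H (\<lambda>z1 z2. sweedler2 H (\<lambda>w1 w2.
      \<eta> x1 w2 * \<eta> y1 w1 * (\<eta> x2 z2 * \<eta> y2 z1)) w) z) y) x"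
    if "x \<in> carrier H" "y \<in> carrier H" "z \<in> carrier H" "w \<in> carrier H" for x y z w
  proof -
    have "\<eta> (mult H x y) (mult H z w) = sweedler2 H (\<lambda>x1 x2. sweedler2 H (\<lambda>y1 y2.
        \<eta> (mult H x1 y1) w * \<eta> (mult H x2 y2) z) y) x"
      using that by (simp add: eta_mult_right mult_closed)
        (intro sweedler2_mult[OF vec_space_ground] lin; assumption)
    also have "\<dots> = sweedler2 H (\<lambda>x1 x2. sweedler2 H (\<lambda>y1 y2.
        sweedler2 H (\<lambda>w1 w2. \<eta> x1 w2 * \<eta> y1 w1) w * sweedler2 H (\<lambda>z1 z2. \<eta> x2 z2 * \<eta> y2 z1) z) y) x"
      by (intro sweedler2_cong that arg_cong2[where f = "(*)"] eta_mult_left)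
    finally show ?thesis by (simp only: sweedler2_distrib sweedler2_swap[of _ z w])
  qed
  \<comment> \<open>The cancelling pairs are \<phi>(a1, d3) \<eta>(a2, d2) and \<eta>(c2, b2)
    \<phi>(c3, b1); what survives is \<eta>(a3, b3) \<eta>(c1, d1).\<close>
  define F where "F l = \<phi> (l ! 0) (l ! 11) * (\<eta> (l ! 1) (l ! 10) * (\<eta> (l ! 7) (l ! 4) *
    (\<phi> (l ! 8) (l ! 3) * (\<eta> (l ! 2) (l ! 5) * \<eta> (l ! 6) (l ! 9)))))" for l
  have F: "multilinear 12 F"
    by (rule multilinear_nthI, unfold numeral_nat F_def, elim less_SucE less_zeroE; simp;
      auto intro!: lin)
  have "counit D (mult D (a \<otimes>\<^bsub>H,H\<^esub> b) (c \<otimes>\<^bsub>H,H\<^esub> d)) = split_sum [0,2,4,6,1,5,4,9] F [a,b,c,d]"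
    unfolding linear_on_mult_D[OF counit_D_linear cl]
    using cl by (simp add: counit_D_pure mult_closed eta4 F_def sweedler2_distrib mult_ac
        cong: sweedler2_cong_simp)
  \<comment> \<open>The adjacent factors of each cancelling pair are made to come from a single
    element, as \<open>pairing_eta\<close> demands.\<close>
  also have "\<dots> = split_sum [0,2,4,6,5,2,0,10] F [a,b,c,d]"
    by (rule split_sum_eqI[OF _ F]) (simp_all add: cl)
  also have "\<dots> = sweedler2 H (\<lambda>A a3. sweedler2 H (\<lambda>B b3. sweedler2 H (\<lambda>c1 C. sweedler2 H (\<lambda>d1 D'.
      sweedler2 H (\<lambda>a1 a2. sweedler2 H (\<lambda>d2 d3. \<phi> a1 d3 * \<eta> a2 d2) D') A *
      (sweedler2 H (\<lambda>c2 c3. sweedler2 H (\<lambda>b1 b2. \<eta> c2 b2 * \<phi> c3 b1) B) C *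
      (\<eta> a3 b3 * \<eta> c1 d1))) d) c) b) a"
    using cl by (simp add: F_def sweedler2_distrib mult_ac cong: sweedler2_cong_simp)
  also have "\<dots> = sweedler2 H (\<lambda>A a3. sweedler2 H (\<lambda>B b3. sweedler2 H (\<lambda>c1 C. sweedler2 H (\<lambda>d1 D'.
      counit H A * counit H D' * (counit H C * counit H B * (\<eta> a3 b3 * \<eta> c1 d1))) d) c) b) a"
    using cl by (simp add: pairing_eta cong: sweedler2_cong_simp)
  also have "\<dots> = sweedler2 H (\<lambda>A a3. counit H A * sweedler2 H (\<lambda>B b3. counit H B * (\<eta> a3 b3 *
      sweedler2 H (\<lambda>c1 C. counit H C * sweedler2 H (\<lambda>d1 D'. counit H D' * \<eta> c1 d1) d) c)) b) a"
    by (simp add: sweedler2_distrib mult_ac)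
  also have "sweedler2 H (\<lambda>c1 C. counit H C * sweedler2 H (\<lambda>d1 D'. counit H D' * \<eta> c1 d1) d) c = \<eta> c d"
    using cl by (subst c) (auto intro!: lin c linear_on_times_right)
  also have "sweedler2 H (\<lambda>A a3. counit H A * sweedler2 H (\<lambda>B b3. counit H B * (\<eta> a3 b3 * \<eta> c d)) b) a =
      \<eta> a b * \<eta> c d"
    using cl by (subst c) (auto intro!: lin c linear_on_times_right)
  finally show ?thesis using cl by (simp add: counit_D_pure)
qed


lemma comult_D_one: "comult D (one D) = one D \<otimes>\<^bsub>T,T\<^esub> one D"
proof (rule functional_eqI[OF vec_space_TT])
  show "comult D (one D) \<in> carrier (T \<Otimes> T)" "one D \<otimes>\<^bsub>T,T\<^esub> one D \<in> carrier (T \<Otimes> T)"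
    by (intro comult_D_closed pure_tensor_closed one_D_closed)+
  fix L assume L: "linear_on (T \<Otimes> T) ground L"
  note lin = scalar_linear_intros linear_on_compose[OF _ L]
  have "L (comult D (one D)) =
    sweedler2 H (\<lambda>b1 s. sweedler2 H (\<lambda>b2 b3. \<phi> (one H) b2 *
      L ((one H \<otimes>\<^bsub>H,H\<^esub> b3) \<otimes>\<^bsub>T,T\<^esub> (one H \<otimes>\<^bsub>H,H\<^esub> b1))) s) (one H)"
    unfolding one_D linear_on_comult_D[OF L one_closed one_closed]
    by (rule sweedler3_one; intro lin; assumption)
  also have "\<dots> = \<phi> (one H) (one H) *
      L ((one H \<otimes>\<^bsub>H,H\<^esub> one H) \<otimes>\<^bsub>T,T\<^esub> (one H \<otimes>\<^bsub>H,H\<^esub> one H))"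
    by (rule sweedler3_one; intro lin; assumption)
  finally show "L (comult D (one D)) = L (one D \<otimes>\<^bsub>T,T\<^esub> one D)"
    by (simp add: one_D pairing_one_left one_closed counit_one)
qed

lemma comult_D_mult:
  assumes s: "s \<in> carrier T" and t: "t \<in> carrier T"
  shows "comult D (mult D s t) = mult (tensor_algebra D D) (comult D s) (comult D t)"
proof -
  note mD = tensor_algebra_mult_bilinear[OF D_vec_space assoc_algebra.mult_bilinear[OF D_assoc_algebra]
      D_vec_space assoc_algebra.mult_bilinear[OF D_assoc_algebra], unfolded D_tensor]
  note lin = linear_on_compose[OF _ comult_D_linear] mult_D_linear_left mult_D_linear_right
    bilinear_on_left[OF mD] bilinear_on_right[OF mD] comult_D_linear linear_on_ident
    comult_D_closed pure_tensor_closed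
  note eqI = linear_on_tensor_eqI[OF vec_space_C vec_space_C vec_space_TT]
  have 1: "comult D (mult D (a \<otimes>\<^bsub>H,H\<^esub> b) t) =
      mult (tensor_algebra D D) (comult D (a \<otimes>\<^bsub>H,H\<^esub> b)) (comult D t)"
    if "a \<in> carrier H" "b \<in> carrier H" for a b
    by (rule eqI[where f = "\<lambda>t. comult D (mult D (a \<otimes>\<^bsub>H,H\<^esub> b) t)"
          and g = "\<lambda>t. mult (tensor_algebra D D) (comult D (a \<otimes>\<^bsub>H,H\<^esub> b)) (comult D t)"])
      (intro lin that t comult_D_mult_pure; assumption)+
  show ?thesis
    by (rule eqI[where f = "\<lambda>s. comult D (mult D s t)"
          and g = "\<lambda>s. mult (tensor_algebra D D) (comult D s) (comult D t)"])
      (intro lin s t 1; assumption)+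
qed

lemma counit_D_mult:
  assumes s: "s \<in> carrier T" and t: "t \<in> carrier T"
  shows "counit D (mult D s t) = counit D s * counit D t"
proof -
  note lin = linear_on_compose[OF _ counit_D_linear] mult_D_linear_left mult_D_linear_right
    counit_D_linear linear_on_ident linear_on_times_left linear_on_times_right pure_tensor_closed
  note eqI = linear_on_tensor_eqI[OF vec_space_C vec_space_C vec_space_ground]
  have 1: "counit D (mult D (a \<otimes>\<^bsub>H,H\<^esub> b) t) = counit D (a \<otimes>\<^bsub>H,H\<^esub> b) * counit D t"
    if "a \<in> carrier H" "b \<in> carrier H" for a b
    by (rule eqI[where f = "\<lambda>t. counit D (mult D (a \<otimes>\<^bsub>H,H\<^esub> b) t)"
          and g = "\<lambda>t. counit D (a \<otimes>\<^bsub>H,H\<^esub> b) * counit D t"])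
      (intro linear_on_times_right lin that t counit_D_mult_pure; assumption)+
  show ?thesis
    by (rule eqI[where f = "\<lambda>s. counit D (mult D s t)" and g = "\<lambda>s. counit D s * counit D t"])
      (intro linear_on_times_left lin s t 1; assumption)+
qed

section \<open>Transfer to the record \<open>iota_double\<close>\<close>

lemma D_coalgebra: "coalgebra D"
proof (intro coalgebra.intro coalgebra_axioms.intro)
  show "vec_space D" by (rule D_vec_space)
  show "linear_on D (D \<Otimes> D) (comult D)"
    using comult_D_linear linear_on_same_space[OF D_space, of "T \<Otimes> T" "T \<Otimes> T"]
    by (simp add: D_tensor same_space_def)
  show "linear_on D ground (counit D)"
    using counit_D_linear linear_on_same_space[OF D_space, of ground ground] by (simp add: same_space_def)
  have idT: "linear_on T T id" using linear_on_ident by (simp add: id_def)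
  note map1 = linear_on_tensor_map[OF vec_space_T vec_space_T vec_space_TT vec_space_T comult_D_linear idT]
  note map2 = linear_on_tensor_map[OF vec_space_T vec_space_T vec_space_T vec_space_TT idT comult_D_linear]
  note TTT = vec_space_tensor[OF vec_space_T, of "T \<Otimes> T"]
  have TT_space: "same_space (D \<Otimes> D) (T \<Otimes> T)" by (simp add: same_space_def D_tensor)
  fix t assume "t \<in> carrier D"
  then have t: "t \<in> carrier T" by (simp add: D_carrier)
  have "tensor_assoc T T T (tensor_map T T (T \<Otimes> T) T (comult D) id (comult D t)) =
      tensor_map T T T (T \<Otimes> T) id (comult D) (comult D t)"
    by (rule linear_on_tensor_eqI[OF vec_space_C vec_space_C TTT,
          where f = "\<lambda>t. tensor_assoc T T T (tensor_map T T (T \<Otimes> T) T (comult D) id (comult D t))"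
            and g = "\<lambda>t. tensor_map T T T (T \<Otimes> T) id (comult D) (comult D t)"])
      (intro linear_on_compose[OF comult_D_linear] linear_on_compose[OF map1]
        linear_on_tensor_assoc[OF vec_space_T vec_space_T vec_space_T] map2 comult_D_coassoc_pure t; assumption)+
  then show "tensor_assoc D D D (tensor_map D D (D \<Otimes> D) D (comult D) id (comult D t)) =
      tensor_map D D D (D \<Otimes> D) id (comult D) (comult D t)"
    by (simp add: tensor_assoc_same_space[OF D_space D_space D_space]
        tensor_map_same_space[OF D_space D_space D_space TT_space]
        tensor_map_same_space[OF D_space D_space TT_space D_space])
  have "tensor_lift T T (\<lambda>x y. smult T (counit D x) y) (comult D t) = t"
    by (rule linear_on_tensor_eqI[OF vec_space_C vec_space_C vec_space_T,
          where f = "\<lambda>t. tensor_lift T T (\<lambda>x y. smult T (counit D x) y) (comult D t)" and g = "\<lambda>t. t"])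
      (intro linear_on_compose[OF comult_D_linear] linear_on_ident counit_D_pure_laws t
        tensor_universal(1)[OF vec_space_T vec_space_T vec_space_T counit_left_bilinear]; assumption)+
  then show "tensor_lift D D (\<lambda>x y. smult D (counit D x) y) (comult D t) = t"
    by (simp add: tensor_lift_same_space[OF D_space D_space] D_smult)
  have "tensor_lift T T (\<lambda>x y. smult T (counit D y) x) (comult D t) = t"
    by (rule linear_on_tensor_eqI[OF vec_space_C vec_space_C vec_space_T,
          where f = "\<lambda>t. tensor_lift T T (\<lambda>x y. smult T (counit D y) x) (comult D t)" and g = "\<lambda>t. t"])
      (intro linear_on_compose[OF comult_D_linear] linear_on_ident counit_D_pure_laws t
        tensor_universal(1)[OF vec_space_T vec_space_T vec_space_T counit_right_bilinear]; assumption)+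
  then show "tensor_lift D D (\<lambda>x y. smult D (counit D y) x) (comult D t) = t"
    by (simp add: tensor_lift_same_space[OF D_space D_space] D_smult)
qed

lemma D_bialgebra: "bialgebra D"
proof (intro bialgebra.intro bialgebra_axioms.intro D_assoc_algebra D_coalgebra)
  have "linear_on D (tensor_algebra D D) (comult D)"
    using comult_D_linear linear_on_same_space[OF D_space, of "tensor_algebra D D" "T \<Otimes> T"]
    by (simp add: same_space_def tensor_algebra_def D_tensor)
  moreover have "comult D (one D) = one (tensor_algebra D D)"
    by (simp add: comult_D_one tensor_algebra_def pure_tensor_same_space[OF D_space D_space])
  ultimately show "algebra_hom D (tensor_algebra D D) (comult D)"
    unfolding algebra_hom_def using comult_D_mult by (simp add: D_carrier)
  have "counit D (one D) = 1"
    by (simp add: one_D counit_D_pure one_closed eta_one_right counit_one)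
  then show "algebra_hom D ground (counit D)"
    unfolding algebra_hom_def using counit_D_mult coalgebra.counit_linear[OF D_coalgebra]
    by (simp add: D_carrier)
qed

end

section \<open>The coaction \<open>\<Psi>\<close>\<close>

locale twisted_setup = hopf_pairing_setup H \<phi>
  for H :: "('f::field, 'a::ab_group_add, 'z) hopf_scheme" and \<phi> +
  fixes \<tau> :: "'a \<Rightarrow> 'a"
  assumes endo: "hopf_endomorphism H \<tau>"
begin

section \<open>The pairing twisted by the endomorphism\<close>

lemma tau_linear: "linear_on H H \<tau>"
  and tau_one: "\<tau> (one H) = one H"
  and tau_mult: "a \<in> carrier H \<Longrightarrow> b \<in> carrier H \<Longrightarrow> \<tau> (mult H a b) = mult H (\<tau> a) (\<tau> b)"
  and tau_counit: "a \<in> carrier H \<Longrightarrow> counit H (\<tau> a) = counit H a"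
  and tau_comult: "a \<in> carrier H \<Longrightarrow> comult H (\<tau> a) = tensor_map H H H H \<tau> \<tau> (comult H a)"
  using endo by (simp_all add: hopf_endomorphism_def algebra_hom_def)

lemma tau_closed: "a \<in> carrier H \<Longrightarrow> \<tau> a \<in> carrier H"
  by (rule linear_on_closed[OF tau_linear])

lemma sweedler2_tau:
  assumes Z: "vec_space Z" and a: "a \<in> carrier H"
    and F1: "\<And>y. y \<in> carrier H \<Longrightarrow> linear_on H Z (\<lambda>x. F x y)"
    and F2: "\<And>x. x \<in> carrier H \<Longrightarrow> linear_on H Z (F x)"
  shows "sweedler2 H F (\<tau> a) = sweedler2 H (\<lambda>x y. F (\<tau> x) (\<tau> y)) a"
proof -
  note u = tensor_universal[OF vec_space_C vec_space_C Z bilinear_onI[OF F2 F1]]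
  have "sweedler2 H F (\<tau> a) = sweedler2 H (\<lambda>x y. tensor_lift H H F (\<tau> x \<otimes>\<^bsub>H,H\<^esub> \<tau> y)) a"
    unfolding sweedler2_def tau_comult[OF a] tensor_map_def
    by (rule linear_on_tensor_lift[OF comult_closed[OF a] vec_space_CC _ u(1)])
      (intro pure_tensor_closed tau_closed)
  also have "\<dots> = sweedler2 H (\<lambda>x y. F (\<tau> x) (\<tau> y)) a"
    by (intro sweedler2_cong a u(2) tau_closed)
  finally show ?thesis .
qed

text \<open>Since \<tau> respects product, unit, coproduct and counit, this is again a pairing of
  bialgebras. The product of \<open>iota_algebra\<close> is \<open>iota_mult\<close> for it, so its
  associativity and unit laws are already available.\<close>

definition \<psi> :: "'a \<Rightarrow> 'a \<Rightarrow> 'f" where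
  "\<psi> a b = \<phi> (\<tau> a) b"

sublocale psi: bialgebra_pairing H \<psi>
proof (unfold_locales)
  show "bilinear_on H H ground \<psi>"
    unfolding \<psi>_def
    by (intro bilinear_onI linear_on_pairing_left linear_on_pairing_right tau_linear linear_on_ident tau_closed)
  show "\<psi> a (one H) = counit H a" if "a \<in> carrier H" for a
    using that by (simp add: \<psi>_def pairing_one_right tau_closed tau_counit)
  show "\<psi> (one H) b = counit H b" if "b \<in> carrier H" for b
    using that by (simp add: \<psi>_def pairing_one_left tau_one)
  show "\<psi> a (mult H b b') = sweedler2 H (\<lambda>a1 a2. \<psi> a1 b * \<psi> a2 b') a"
    if "a \<in> carrier H" "b \<in> carrier H" "b' \<in> carrier H" for a b b'
    using that unfolding \<psi>_def
    by (simp add: pairing_mult_right tau_closed)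
      (intro sweedler2_tau[OF vec_space_ground] pairing_linear_intros; assumption)
  show "\<psi> (mult H a a') b = sweedler2 H (\<lambda>b1 b2. \<psi> a b1 * \<psi> a' b2) b"
    if "a \<in> carrier H" "a' \<in> carrier H" "b \<in> carrier H" for a a' b
    using that by (simp add: \<psi>_def pairing_mult_left tau_closed tau_mult)
qed

lemmas psi_linear_intros = scalar_linear_intros psi.linear_on_pairing_left psi.linear_on_pairing_right
  linear_on_compose[OF _ tau_linear] tau_closed eta_linear_intros

text \<open>This is \<open>pairing_eta\<close> at \<tau>(a): as \<tau> is a coalgebra map, the
  factors of \<tau>(a) are the images of those of a.\<close>

lemma psi_eta:
  assumes "a \<in> carrier H" "b \<in> carrier H"
  shows "sweedler2 H (\<lambda>a1 a2. sweedler2 H (\<lambda>b1 b2. \<psi> a1 b2 * \<eta> (\<tau> a2) b1) b) a = counit H a * counit H b"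
proof -
  have "sweedler2 H (\<lambda>a1 a2. sweedler2 H (\<lambda>b1 b2. \<phi> a1 b2 * \<eta> a2 b1) b) (\<tau> a) =
      sweedler2 H (\<lambda>a1 a2. sweedler2 H (\<lambda>b1 b2. \<psi> a1 b2 * \<eta> (\<tau> a2) b1) b) a"
    unfolding \<psi>_def
    by (rule sweedler2_tau[OF vec_space_ground assms(1)]; intro psi_linear_intros assms; assumption)
  then show ?thesis
    using pairing_eta(1)[OF tau_closed[OF assms(1)] assms(2)] assms(1) by (simp add: tau_counit)
qed

text \<open>The coaction and \<xi> only produce pure tensors with first leg in the image of \<tau>.
  For these the pairings of D can be written in terms of \<psi>, with \<tau> otherwise confined to
  the argument of L.\<close>

lemma linear_on_mult_D_tau:
  assumes L: "linear_on T ground L"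
    and cl: "a \<in> carrier H" "b \<in> carrier H" "c \<in> carrier H" "d \<in> carrier H"
  shows "L (mult D (\<tau> a \<otimes>\<^bsub>H,H\<^esub> b) (\<tau> c \<otimes>\<^bsub>H,H\<^esub> d)) =
     sweedler2 H (\<lambda>a1 a2. sweedler2 H (\<lambda>b1 b2. sweedler2 H (\<lambda>c1 c2. sweedler2 H (\<lambda>d1 d2.
       \<psi> a1 d2 * \<psi> c2 b1 * L (mult H (\<tau> a2) (\<tau> c1) \<otimes>\<^bsub>H,H\<^esub> mult H b2 d1)) d) c) b) a"
proof -
  note lin = psi_linear_intros linear_on_compose[OF _ L] cl
  have "L (mult D (\<tau> a \<otimes>\<^bsub>H,H\<^esub> b) (\<tau> c \<otimes>\<^bsub>H,H\<^esub> d)) =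
     sweedler2 H (\<lambda>a1 a2. sweedler2 H (\<lambda>b1 b2. sweedler2 H (\<lambda>c1 c2. sweedler2 H (\<lambda>d1 d2.
       \<phi> (\<tau> a1) d2 * \<phi> c2 b1 * L (mult H (\<tau> a2) c1 \<otimes>\<^bsub>H,H\<^esub> mult H b2 d1)) d) (\<tau> c)) b) a"
    unfolding linear_on_mult_D[OF L tau_closed[OF cl(1)] cl(2) tau_closed[OF cl(3)] cl(4)]
    by (rule sweedler2_tau[OF vec_space_ground cl(1)]; intro lin; assumption)
  also have "\<dots> = sweedler2 H (\<lambda>a1 a2. sweedler2 H (\<lambda>b1 b2. sweedler2 H (\<lambda>c1 c2. sweedler2 H (\<lambda>d1 d2.
       \<psi> a1 d2 * \<psi> c2 b1 * L (mult H (\<tau> a2) (\<tau> c1) \<otimes>\<^bsub>H,H\<^esub> mult H b2 d1)) d) c) b) a"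
    unfolding \<psi>_def
    by (rule sweedler2_cong[OF cl(1)], rule sweedler2_cong[OF cl(2)],
        rule sweedler2_tau[OF vec_space_ground cl(3)]; intro lin; assumption)
  finally show ?thesis .
qed

lemma linear_on_comult_D_tau:
  assumes L: "linear_on (T \<Otimes> T) ground L" and cl: "a \<in> carrier H" "b \<in> carrier H"
  shows "L (comult D (\<tau> a \<otimes>\<^bsub>H,H\<^esub> b)) =
    sweedler2 H (\<lambda>a1 r. sweedler2 H (\<lambda>a2 a3. sweedler2 H (\<lambda>b1 s. sweedler2 H (\<lambda>b2 b3. \<psi> a2 b2 *
      L ((\<tau> a1 \<otimes>\<^bsub>H,H\<^esub> b3) \<otimes>\<^bsub>T,T\<^esub> (\<tau> a3 \<otimes>\<^bsub>H,H\<^esub> b1))) s) b) r) a"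
proof -
  note lin = psi_linear_intros linear_on_compose[OF _ L] cl
  have "L (comult D (\<tau> a \<otimes>\<^bsub>H,H\<^esub> b)) =
    sweedler2 H (\<lambda>a1 r. sweedler2 H (\<lambda>a2 a3. sweedler2 H (\<lambda>b1 s. sweedler2 H (\<lambda>b2 b3. \<phi> a2 b2 *
      L ((\<tau> a1 \<otimes>\<^bsub>H,H\<^esub> b3) \<otimes>\<^bsub>T,T\<^esub> (a3 \<otimes>\<^bsub>H,H\<^esub> b1))) s) b) (\<tau> r)) a"
    unfolding linear_on_comult_D[OF L tau_closed[OF cl(1)] cl(2)]
    by (rule sweedler2_tau[OF vec_space_ground cl(1)]; intro lin; assumption)
  also have "\<dots> = sweedler2 H (\<lambda>a1 r. sweedler2 H (\<lambda>a2 a3. sweedler2 H (\<lambda>b1 s. sweedler2 H (\<lambda>b2 b3. \<psi> a2 b2 *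
      L ((\<tau> a1 \<otimes>\<^bsub>H,H\<^esub> b3) \<otimes>\<^bsub>T,T\<^esub> (\<tau> a3 \<otimes>\<^bsub>H,H\<^esub> b1))) s) b) r) a"
    unfolding \<psi>_def
    by (rule sweedler2_cong[OF cl(1)], rule sweedler2_tau[OF vec_space_ground], assumption, (intro lin; assumption)+)
  finally show ?thesis .
qed

section \<open>The algebra \<open>iota_algebra\<close> and the laws of the coaction\<close>

abbreviation "A \<equiv> iota_algebra H \<phi> \<tau>"
abbreviation "P \<equiv> H \<Otimes> T"

lemma A_space: "same_space A H"
  by (simp add: same_space_def iota_algebra_def)

lemma A_carrier: "carrier A = carrier H" and A_smult: "smult A = smult H"
  using A_space by (simp_all add: same_space_def)

lemma vec_space_P: "vec_space P"
  by (rule vec_space_tensor[OF vec_space_C])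

lemma mult_A: "mult A = psi.iota_mult" and one_A: "one A = one H"
  by (simp_all add: iota_algebra_def psi.iota_mult_def[abs_def] \<psi>_def)

lemma A_assoc_algebra: "assoc_algebra A"
proof (intro assoc_algebra.intro assoc_algebra_axioms.intro)
  show "vec_space A" using vec_space_same_space[OF A_space] vec_space_C by simp
  show "bilinear_on A A A (mult A)"
    unfolding mult_A bilinear_on_same_space[OF A_space A_space A_space] by (rule psi.iota_mult_bilinear)
qed (simp_all add: A_carrier mult_A one_A psi.iota_mult_assoc psi.iota_mult_one one_closed)

lemma AD: "A \<Otimes> D = P"
  by (rule tensor_space_same_space[OF A_space D_space])

lemma Psi_eq: "Psi H \<phi> \<tau> a = sweedler2 H (\<lambda>a1 r. sweedler2 H (\<lambda>a2 r. sweedler2 H (\<lambda>a3 r. sweedler2 H (\<lambda>a4 a5.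
    smult P (\<psi> a4 a2) (a3 \<otimes>\<^bsub>H,T\<^esub> (\<tau> a5 \<otimes>\<^bsub>H,H\<^esub> a1))) r) r) r) a"
  by (simp add: Psi_def sweedler5_def sweedler4_def sweedler3_def AD \<psi>_def
      pure_tensor_same_space[OF A_space D_space])

abbreviation "\<Psi> \<equiv> Psi H \<phi> \<tau>"

lemma Psi_linear: "linear_on H P \<Psi>"
proof -
  have "linear_on H P (\<lambda>a. \<Psi> a)"
    unfolding Psi_eq
    by (intro linear_on_sweedler2_param linear_on_sweedler2_arg vec_space_P vec_space_T vec_space_C linear_on_compose[OF _ tau_linear]
        linear_on_smult_left linear_on_smult_right linear_on_pure_left linear_on_pure_right
        psi.linear_on_pairing_left psi.linear_on_pairing_right
        linear_on_ident pure_tensor_closed tau_closed; assumption)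
  then show ?thesis by simp
qed

lemma Psi_closed: "a \<in> carrier H \<Longrightarrow> \<Psi> a \<in> carrier P"
  by (rule linear_on_closed[OF Psi_linear])

lemma linear_on_Psi:
  assumes L: "linear_on P ground L" and "a \<in> carrier H"
  shows "L (\<Psi> a) = sweedler2 H (\<lambda>a1 r. sweedler2 H (\<lambda>a2 r. sweedler2 H (\<lambda>a3 r. sweedler2 H (\<lambda>a4 a5.
    \<psi> a4 a2 * L (a3 \<otimes>\<^bsub>H,T\<^esub> (\<tau> a5 \<otimes>\<^bsub>H,H\<^esub> a1))) r) r) r) a"
  using assms
  by (simp add: Psi_eq linear_on_sweedler2[OF L vec_space_P] tau_closed
      sweedler2_closed[OF _ vec_space_P] smult_closed[OF vec_space_P] pure_tensor_closed linear_on_smult[OF L]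
      cong: sweedler2_cong_simp)

lemma linear_on_Psi_mult:
  assumes L: "linear_on P ground L" and cl: "x \<in> carrier H" "y \<in> carrier H"
  shows "L (\<Psi> (mult H x y)) =
    sweedler2 H (\<lambda>x1 r. sweedler2 H (\<lambda>x2 r. sweedler2 H (\<lambda>x3 r. sweedler2 H (\<lambda>x4 x5.
    sweedler2 H (\<lambda>y1 r. sweedler2 H (\<lambda>y2 r. sweedler2 H (\<lambda>y3 r. sweedler2 H (\<lambda>y4 y5.
    sweedler2 H (\<lambda>x6 x7. sweedler2 H (\<lambda>y6 y7. sweedler2 H (\<lambda>x8 x9. sweedler2 H (\<lambda>y8 y9.
      \<psi> x6 x8 * \<psi> y6 x9 * (\<psi> x7 y8 * \<psi> y7 y9) *
      L (mult H x3 y3 \<otimes>\<^bsub>H,T\<^esub> (mult H (\<tau> x5) (\<tau> y5) \<otimes>\<^bsub>H,H\<^esub> mult H x1 y1)))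
      y2) x2) y4) x4) r) r) r) y) r) r) r) x"
proof -
  note lin = psi_linear_intros linear_on_compose[OF _ L] cl
  have "L (\<Psi> (mult H x y)) =
    sweedler2 H (\<lambda>x1 r. sweedler2 H (\<lambda>x2 r. sweedler2 H (\<lambda>x3 r. sweedler2 H (\<lambda>x4 x5.
    sweedler2 H (\<lambda>y1 r. sweedler2 H (\<lambda>y2 r. sweedler2 H (\<lambda>y3 r. sweedler2 H (\<lambda>y4 y5.
      \<psi> (mult H x4 y4) (mult H x2 y2) *
      L (mult H x3 y3 \<otimes>\<^bsub>H,T\<^esub> (\<tau> (mult H x5 y5) \<otimes>\<^bsub>H,H\<^esub> mult H x1 y1))) r) r) r) y) r) r) r) x"
    unfolding linear_on_Psi[OF L mult_closed[OF cl]]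
    by (rule sweedler5_mult[OF _ _ _ _ _ cl]; intro lin; assumption)
  then show ?thesis
    using cl by (simp add: psi.pairing_mult_mult tau_mult sweedler2_distrib cong: sweedler2_cong_simp)
qed

lemma tensor_algebra_AD_bilinear: "bilinear_on P P P (mult (tensor_algebra A D))"
  and tensor_algebra_AD_pure: "\<lbrakk>a \<in> carrier H; s \<in> carrier T; b \<in> carrier H; t \<in> carrier T\<rbrakk> \<Longrightarrow>
    mult (tensor_algebra A D) (a \<otimes>\<^bsub>H,T\<^esub> s) (b \<otimes>\<^bsub>H,T\<^esub> t) = psi.iota_mult a b \<otimes>\<^bsub>H,T\<^esub> mult D s t"
proof -
  note AA = assoc_algebra.axioms(1)[OF A_assoc_algebra] assoc_algebra.mult_bilinear[OF A_assoc_algebra]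
    D_vec_space assoc_algebra.mult_bilinear[OF D_assoc_algebra]
  show "bilinear_on P P P (mult (tensor_algebra A D))"
    using tensor_algebra_mult_bilinear[OF AA] by (simp add: AD)
  show "mult (tensor_algebra A D) (a \<otimes>\<^bsub>H,T\<^esub> s) (b \<otimes>\<^bsub>H,T\<^esub> t) = psi.iota_mult a b \<otimes>\<^bsub>H,T\<^esub> mult D s t"
    if "a \<in> carrier H" "s \<in> carrier T" "b \<in> carrier H" "t \<in> carrier T"
    using tensor_algebra_mult_pure[OF AA, of a s b t] that
    by (simp add: A_carrier D_carrier mult_A pure_tensor_same_space[OF A_space D_space])
qed

lemma Psi_iota_mult:
  assumes cl: "a \<in> carrier H" "b \<in> carrier H"
  shows "\<Psi> (psi.iota_mult a b) = mult (tensor_algebra A D) (\<Psi> a) (\<Psi> b)" (is "?lhs = ?rhs")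
proof (rule functional_eqI[OF vec_space_P])
  note mAD = tensor_algebra_AD_bilinear
  show "?lhs \<in> carrier P" "?rhs \<in> carrier P"
    by (intro Psi_closed psi.iota_mult_closed bilinear_on_closed[OF mAD] cl)+
  fix L assume L: "linear_on P ground L"
  \<comment> \<open>Eight factors each: \<psi>(b8, a1) \<psi>(a6, a3) \<psi>(b5, a4) \<psi>(a7, b2)
    \<psi>(b6, b3). On the left the first comes from the product of A and the others from pairing
    two factors of a product. On the right, \<psi>(a6, a3) and \<psi>(b6, b3) belong to the two
    coactions, \<psi>(b5, a4) to the product of A, and the remaining two to the product of
    D.\<close>
  define F where "F l = \<psi> (l ! 15) (l ! 0) * (\<psi> (l ! 5) (l ! 2) * (\<psi> (l ! 12) (l ! 3) *
    (\<psi> (l ! 6) (l ! 9) * (\<psi> (l ! 13) (l ! 10) *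
    L (mult H (l ! 4) (l ! 11) \<otimes>\<^bsub>H,T\<^esub> (mult H (\<tau> (l ! 7)) (\<tau> (l ! 14)) \<otimes>\<^bsub>H,H\<^esub> mult H (l ! 1) (l ! 8)))))))" for l
  have F: "multilinear 16 F"
    by (rule multilinear_nthI, unfold numeral_nat F_def, elim less_SucE less_zeroE; simp;
      auto intro!: psi_linear_intros linear_on_compose[OF _ L])
  have "L ?lhs = split_sum [0,2,1,2,3,4,6,7,8,9,4,10,2,9] F [a,b]"
    unfolding psi.linear_on_iota_mult[OF linear_on_compose[OF Psi_linear L] cl]
    using cl by (simp add: linear_on_Psi_mult[OF L] F_def sweedler2_distrib mult_ac
        cong: sweedler2_cong_simp)
  also have "\<dots> = split_sum [0,1,2,3,5,6,7,8,2,8,5,0,13,8] F [a,b]"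
    by (rule split_sum_eqI[OF _ F]) (simp_all add: cl)
  also have "\<dots> = L ?rhs"
  proof -
    have R1: "L (mult (tensor_algebra A D) s (\<Psi> b)) =
      sweedler2 H (\<lambda>a1 r. sweedler2 H (\<lambda>a2 r. sweedler2 H (\<lambda>a3 r. sweedler2 H (\<lambda>a4 a5. \<psi> a4 a2 *
      L (mult (tensor_algebra A D) s (a3 \<otimes>\<^bsub>H,T\<^esub> (\<tau> a5 \<otimes>\<^bsub>H,H\<^esub> a1)))) r) r) r) b"
      if "s \<in> carrier P" for s
      by (intro linear_on_Psi linear_on_compose[OF _ L] bilinear_on_right[OF mAD] linear_on_ident that cl)
    have R2: "L (psi.iota_mult x y \<otimes>\<^bsub>H,T\<^esub> t) =
      sweedler2 H (\<lambda>a1 a2. sweedler2 H (\<lambda>b1 b2. \<psi> b2 a1 * L (mult H a2 b1 \<otimes>\<^bsub>H,T\<^esub> t)) y) x"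
      if "x \<in> carrier H" "y \<in> carrier H" "t \<in> carrier T" for x y t
      by (intro psi.linear_on_iota_mult linear_on_compose[OF _ L] linear_on_pure_left vec_space_T vec_space_C linear_on_ident that)
    have R3: "L (t \<otimes>\<^bsub>H,T\<^esub> mult D (\<tau> x \<otimes>\<^bsub>H,H\<^esub> y) (\<tau> z \<otimes>\<^bsub>H,H\<^esub> w)) =
      sweedler2 H (\<lambda>a1 a2. sweedler2 H (\<lambda>b1 b2. sweedler2 H (\<lambda>c1 c2. sweedler2 H (\<lambda>d1 d2.
       \<psi> a1 d2 * \<psi> c2 b1 * L (t \<otimes>\<^bsub>H,T\<^esub> (mult H (\<tau> a2) (\<tau> c1) \<otimes>\<^bsub>H,H\<^esub> mult H b2 d1))) w) z) y) x"
      if "x \<in> carrier H" "y \<in> carrier H" "z \<in> carrier H" "w \<in> carrier H" "t \<in> carrier H" for x y z w t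
      by (intro linear_on_mult_D_tau linear_on_compose[OF _ L] linear_on_pure_right vec_space_T vec_space_C linear_on_ident that)
    show ?thesis
      unfolding linear_on_Psi[OF linear_on_compose[OF bilinear_on_left[OF mAD linear_on_ident
          Psi_closed[OF cl(2)]] L] cl(1)]
      using cl by (simp add: R1 R2 tensor_algebra_AD_pure pure_tensor_closed mult_D_closed mult_closed tau_closed
          cong: sweedler2_cong_simp)
        (simp add: R3 pure_tensor_closed mult_closed tau_closed F_def sweedler2_distrib mult_ac
          cong: sweedler2_cong_simp)
  qed
  finally show "L ?lhs = L ?rhs" .
qed

lemma Psi_one: "\<Psi> (one H) = one H \<otimes>\<^bsub>H,T\<^esub> one D"
proof (rule functional_eqI[OF vec_space_P])
  show "\<Psi> (one H) \<in> carrier P" "one H \<otimes>\<^bsub>H,T\<^esub> one D \<in> carrier P"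
    by (intro Psi_closed pure_tensor_closed one_closed one_D_closed)+
  fix L assume L: "linear_on P ground L"
  have "L (\<Psi> (one H)) = \<psi> (one H) (one H) * L (one H \<otimes>\<^bsub>H,T\<^esub> (\<tau> (one H) \<otimes>\<^bsub>H,H\<^esub> one H))"
    unfolding linear_on_Psi[OF L one_closed]
    by (rule sweedler5_one; intro psi_linear_intros linear_on_compose[OF _ L]; assumption)
  then show "L (\<Psi> (one H)) = L (one H \<otimes>\<^bsub>H,T\<^esub> one D)"
    by (simp add: psi.pairing_one_left one_closed counit_one tau_one one_D)
qed

lemma Psi_coassoc:
  assumes a: "a \<in> carrier H"
  shows "tensor_assoc H T T (tensor_map H T P T \<Psi> id (\<Psi> a)) =
    tensor_map H T H (T \<Otimes> T) id (comult D) (\<Psi> a)" (is "?lhs = ?rhs")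
proof (rule functional_eqI[OF vec_space_tensor[OF vec_space_C]])
  have id: "linear_on T T id" "linear_on H H id" using linear_on_ident by (simp_all add: id_def)
  note map1 = linear_on_tensor_map[OF vec_space_C vec_space_T vec_space_P vec_space_T Psi_linear id(1)]
    and map2 = linear_on_tensor_map[OF vec_space_C vec_space_T vec_space_C vec_space_TT id(2) comult_D_linear]
    and assoc = linear_on_tensor_assoc[OF vec_space_C vec_space_T vec_space_T]
  show "?lhs \<in> carrier (H \<Otimes> T \<Otimes> T)" "?rhs \<in> carrier (H \<Otimes> T \<Otimes> T)"
    by (intro linear_on_closed[OF assoc] linear_on_closed[OF map1] linear_on_closed[OF map2] Psi_closed a)+
  fix L assume L: "linear_on (H \<Otimes> T \<Otimes> T) ground L"
  have L1: "L (tensor_assoc H T T (\<Psi> x \<otimes>\<^bsub>P,T\<^esub> t)) =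
    sweedler2 H (\<lambda>a1 r. sweedler2 H (\<lambda>a2 r. sweedler2 H (\<lambda>a3 r. sweedler2 H (\<lambda>a4 a5. \<psi> a4 a2 *
      L (a3 \<otimes>\<^bsub>H,T \<Otimes> T\<^esub> ((\<tau> a5 \<otimes>\<^bsub>H,H\<^esub> a1) \<otimes>\<^bsub>T,T\<^esub> t))) r) r) r) x"
    if "x \<in> carrier H" "t \<in> carrier T" for x t
  proof -
    have "linear_on P ground (\<lambda>s. L (tensor_assoc H T T (s \<otimes>\<^bsub>P,T\<^esub> t)))"
      by (intro linear_on_compose[OF _ L] linear_on_compose[OF _ assoc] linear_on_pure_left
          vec_space_P vec_space_T linear_on_ident that)
    from linear_on_Psi[OF this that(1)] show ?thesis
      using that by (simp add: tensor_assoc_pure[OF vec_space_C vec_space_T vec_space_T] pure_tensor_closed tau_closed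
          cong: sweedler2_cong_simp)
  qed
  have L2: "L (z \<otimes>\<^bsub>H,T \<Otimes> T\<^esub> comult D (\<tau> x \<otimes>\<^bsub>H,H\<^esub> y)) =
    sweedler2 H (\<lambda>a1 r. sweedler2 H (\<lambda>a2 a3. sweedler2 H (\<lambda>b1 s. sweedler2 H (\<lambda>b2 b3. \<psi> a2 b2 *
      L (z \<otimes>\<^bsub>H,T \<Otimes> T\<^esub> ((\<tau> a1 \<otimes>\<^bsub>H,H\<^esub> b3) \<otimes>\<^bsub>T,T\<^esub> (\<tau> a3 \<otimes>\<^bsub>H,H\<^esub> b1)))) s) y) r) x"
    if "x \<in> carrier H" "y \<in> carrier H" "z \<in> carrier H" for x y z
    by (intro linear_on_comult_D_tau linear_on_compose[OF _ L] linear_on_pure_right vec_space_C vec_space_TT linear_on_ident that)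
  \<comment> \<open>The nine factors are nested around a5: it is enclosed by \<psi>(a6, a4), the
    block \<tau>(a7) \<otimes> a3, the pairing \<psi>(a8, a2) and the block \<tau>(a9) \<otimes> a1.
    A second coaction supplies the inner pairing and block; the coproduct of D divides the outer
    factors in the same way.\<close>
  define F where "F l = \<psi> (l ! 7) (l ! 1) * (\<psi> (l ! 5) (l ! 3) *
    L (l ! 4 \<otimes>\<^bsub>H,T \<Otimes> T\<^esub> ((\<tau> (l ! 6) \<otimes>\<^bsub>H,H\<^esub> l ! 2) \<otimes>\<^bsub>T,T\<^esub> (\<tau> (l ! 8) \<otimes>\<^bsub>H,H\<^esub> l ! 0))))" for l
  have F: "multilinear 9 F"
    by (rule multilinear_nthI, unfold numeral_nat F_def, elim less_SucE less_zeroE; simp;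
      auto intro!: psi_linear_intros linear_on_compose[OF _ L] vec_space_TT)
  have "L ?lhs = split_sum [0,1,2,3,2,3,4,5] F [a]"
    unfolding linear_on_Psi[OF linear_on_compose[OF map1 linear_on_compose[OF assoc L]] a]
    using a by (simp add: tensor_map_pure[OF vec_space_C vec_space_T vec_space_P vec_space_T Psi_linear id(1)] pure_tensor_closed tau_closed L1
        F_def sweedler2_distrib mult_ac cong: sweedler2_cong_simp)
  also have "\<dots> = split_sum [0,1,2,3,4,5,0,1] F [a]"
    by (rule split_sum_eqI[OF _ F]) (simp_all add: a)
  also have "\<dots> = L ?rhs"
    unfolding linear_on_Psi[OF linear_on_compose[OF map2 L] a]
    using a by (simp add: tensor_map_pure[OF vec_space_C vec_space_T vec_space_C vec_space_TT id(2) comult_D_linear] pure_tensor_closed tau_closed L2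
        F_def sweedler2_distrib mult_ac cong: sweedler2_cong_simp)
  finally show "L ?lhs = L ?rhs" .
qed

lemma Psi_counit:
  assumes a: "a \<in> carrier H"
  shows "tensor_lift H T (\<lambda>x y. smult H (counit D y) x) (\<Psi> a) = a" (is "?lhs = a")
proof -
  have "bilinear_on H T H (\<lambda>x y. smult H (counit D y) x)"
    by (intro bilinear_onI linear_on_smult_left linear_on_smult_right vec_space_C counit_D_linear linear_on_ident;
      assumption)
  note u = tensor_universal[OF vec_space_C vec_space_T vec_space_C this]
  show ?thesis
  proof (rule functional_eqI[OF vec_space_C linear_on_closed[OF u(1) Psi_closed[OF a]] a])
    fix L assume L: "linear_on H ground L"
    note lin = psi_linear_intros linear_on_compose[OF _ L] a
    define F where "F l = \<psi> (l ! 3) (l ! 1) * (\<eta> (\<tau> (l ! 4)) (l ! 0) * L (l ! 2))" for l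
    have F: "multilinear 5 F"
      by (rule multilinear_nthI, unfold numeral_nat F_def, elim less_SucE less_zeroE; simp;
        auto intro!: lin)
    have "L ?lhs = split_sum [0,1,2,3] F [a]"
      unfolding linear_on_Psi[OF linear_on_compose[OF u(1) L] a]
      using a by (simp add: u(2) pure_tensor_closed tau_closed counit_D_pure linear_on_smult[OF L]
          F_def sweedler2_distrib mult_ac cong: sweedler2_cong_simp)
    \<comment> \<open>The factors a1, a2 come from x and a4, a5 from y, so that
      \<open>psi_eta\<close> removes both pairings around a3.\<close>
    also have "\<dots> = split_sum [0,1,2,0] F [a]"
      by (rule split_sum_eqI[OF _ F]) (simp_all add: a)
    also have "\<dots> = sweedler2 H (\<lambda>x r. sweedler2 H (\<lambda>a3 y. sweedler2 H (\<lambda>a4 a5. sweedler2 H (\<lambda>a1 a2.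
        \<psi> a4 a2 * \<eta> (\<tau> a5) a1) x) y * L a3) r) a"
      using a by (simp add: F_def sweedler2_distrib mult_ac cong: sweedler2_cong_simp)
    also have "\<dots> = sweedler2 H (\<lambda>x r. sweedler2 H (\<lambda>a3 y. counit H y * counit H x * L a3) r) a"
      using a by (simp add: psi_eta cong: sweedler2_cong_simp)
    also have "\<dots> = sweedler2 H (\<lambda>x r. counit H x * sweedler2 H (\<lambda>a3 y. counit H y * L a3) r) a"
      by (simp add: sweedler2_distrib mult_ac)
    also have "\<dots> = L a"
      using a by (simp add: sweedler2_counit L cong: sweedler2_cong_simp)
    finally show "L ?lhs = L a" .
  qed
qed

lemma Psi_comodule_algebra: "comodule_algebra A D \<Psi>"
proof (intro comodule_algebra.intro comodule_algebra_axioms.intro A_assoc_algebra D_bialgebra)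
  have "linear_on A (tensor_algebra A D) \<Psi>"
    using Psi_linear linear_on_same_space[OF A_space, of "tensor_algebra A D" "P"]
    by (simp add: same_space_def tensor_algebra_def AD)
  moreover have "\<Psi> (one A) = one (tensor_algebra A D)"
    by (simp add: one_A Psi_one tensor_algebra_def pure_tensor_same_space[OF A_space D_space])
  ultimately show "algebra_hom A (tensor_algebra A D) \<Psi>"
    unfolding algebra_hom_def by (simp add: A_carrier mult_A Psi_iota_mult)
  have P_space: "same_space (A \<Otimes> D) P" and TT_space: "same_space (D \<Otimes> D) (T \<Otimes> T)"
    by (simp_all add: same_space_def AD D_tensor)
  show "tensor_assoc A D D (tensor_map A D (A \<Otimes> D) D \<Psi> id (\<Psi> a)) =
      tensor_map A D A (D \<Otimes> D) id (comult D) (\<Psi> a)" if "a \<in> carrier A" for a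
    using Psi_coassoc[of a] that
    by (simp add: A_carrier tensor_assoc_same_space[OF A_space D_space D_space]
        tensor_map_same_space[OF A_space D_space P_space D_space]
        tensor_map_same_space[OF A_space D_space A_space TT_space])
  show "tensor_lift A D (\<lambda>x y. smult A (counit D y) x) (\<Psi> a) = a" if "a \<in> carrier A" for a
    using Psi_counit[of a] that
    by (simp add: A_carrier A_smult tensor_lift_same_space[OF A_space D_space])
qed

section \<open>The map \<xi> and its compatibility with the coaction\<close>

lemma xi_eq: "xi H \<tau> \<chi> a = sweedler2 H (\<lambda>a1 r. sweedler2 H (\<lambda>a2 a3.
    smult T (\<chi> a2) (\<tau> a3 \<otimes>\<^bsub>H,H\<^esub> a1)) r) a"
  by (simp add: xi_def sweedler3_def)

lemma xi_linear:
  assumes \<chi>: "linear_on H ground \<chi>"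
  shows "linear_on H T (xi H \<tau> \<chi>)"
proof -
  have "linear_on H T (\<lambda>a. xi H \<tau> \<chi> a)"
    unfolding xi_eq
    by (intro linear_on_sweedler2_param linear_on_sweedler2_arg vec_space_T vec_space_C linear_on_compose[OF _ tau_linear]
        linear_on_compose[OF _ \<chi>]
        linear_on_smult_left linear_on_smult_right linear_on_pure_left linear_on_pure_right
        linear_on_ident pure_tensor_closed tau_closed; assumption)
  then show ?thesis by simp
qed

lemma linear_on_xi:
  assumes L: "linear_on T ground L" and "a \<in> carrier H"
  shows "L (xi H \<tau> \<chi> a) = sweedler2 H (\<lambda>a1 r. sweedler2 H (\<lambda>a2 a3.
    \<chi> a2 * L (\<tau> a3 \<otimes>\<^bsub>H,H\<^esub> a1)) r) a"
  using assms
  by (simp add: xi_eq linear_on_sweedler2[OF L vec_space_T] tau_closed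
      sweedler2_closed[OF _ vec_space_T] smult_closed[OF vec_space_T] pure_tensor_closed linear_on_smult[OF L]
      cong: sweedler2_cong_simp)

lemma xi_Psi:
  assumes \<chi>: "linear_on H ground \<chi>" and a: "a \<in> carrier H"
  shows "tensor_map H T T T (xi H \<tau> \<chi>) id (\<Psi> a) = comult D (xi H \<tau> \<chi> a)" (is "?lhs = ?rhs")
proof (rule functional_eqI[OF vec_space_TT])
  have id: "linear_on T T id" using linear_on_ident by (simp_all add: id_def)
  note map = linear_on_tensor_map[OF vec_space_C vec_space_T vec_space_T vec_space_T xi_linear[OF \<chi>] id]
  show "?lhs \<in> carrier (T \<Otimes> T)" "?rhs \<in> carrier (T \<Otimes> T)"
    by (intro linear_on_closed[OF map] Psi_closed comult_D_closed linear_on_closed[OF xi_linear[OF \<chi>]] a)+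
  fix L assume L: "linear_on (T \<Otimes> T) ground L"
  have L1: "L (xi H \<tau> \<chi> x \<otimes>\<^bsub>T,T\<^esub> t) = sweedler2 H (\<lambda>a1 r. sweedler2 H (\<lambda>a2 a3.
      \<chi> a2 * L ((\<tau> a3 \<otimes>\<^bsub>H,H\<^esub> a1) \<otimes>\<^bsub>T,T\<^esub> t)) r) x"
    if "x \<in> carrier H" "t \<in> carrier T" for x t
    by (intro linear_on_xi linear_on_compose[OF _ L] linear_on_pure_left vec_space_T linear_on_ident that)
  \<comment> \<open>Seven factors nested around a4, which \<chi> evaluates: the inner block is
    \<tau>(a5) \<otimes> a3, the outer one \<tau>(a7) \<otimes> a1, and \<psi>(a6, a2) lies between
    them. On the left this pairing comes from the coaction, on the right from the coproduct of
    D.\<close>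
  define F where "F l = \<psi> (l ! 5) (l ! 1) * (\<chi> (l ! 3) *
    L ((\<tau> (l ! 4) \<otimes>\<^bsub>H,H\<^esub> l ! 2) \<otimes>\<^bsub>T,T\<^esub> (\<tau> (l ! 6) \<otimes>\<^bsub>H,H\<^esub> l ! 0)))" for l
  have F: "multilinear 7 F"
    by (rule multilinear_nthI, unfold numeral_nat F_def, elim less_SucE less_zeroE; simp;
      auto intro!: psi_linear_intros linear_on_compose[OF _ L] linear_on_compose[OF _ \<chi>])
  have "L ?lhs = split_sum [0,1,2,3,2,3] F [a]"
    unfolding linear_on_Psi[OF linear_on_compose[OF map L] a]
    using a by (simp add: tensor_map_pure[OF vec_space_C vec_space_T vec_space_T vec_space_T xi_linear[OF \<chi>] id] pure_tensor_closed tau_closed L1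
        F_def sweedler2_distrib mult_ac cong: sweedler2_cong_simp)
  also have "\<dots> = split_sum [0,1,2,3,0,1] F [a]"
    by (rule split_sum_eqI[OF _ F]) (simp_all add: a)
  also have "\<dots> = L ?rhs"
    unfolding linear_on_xi[OF linear_on_compose[OF comult_D_linear L] a]
    using a by (simp add: linear_on_comult_D_tau[OF L] F_def sweedler2_distrib mult_ac
        cong: sweedler2_cong_simp)
  finally show "L ?lhs = L ?rhs" .
qed

end

theorem proposition2p11:
  fixes H :: "('f::field, 'h::ab_group_add) hopf"
    and \<phi> :: "'h \<Rightarrow> 'h \<Rightarrow> 'f"
    and \<tau> :: "'h \<Rightarrow> 'h"
    and \<chi> :: "'h \<Rightarrow> 'f"
  assumes "hopf_algebra H"
    and "bij_betw (antipode H) (carrier H) (carrier H)"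
    and "hopf_pairing H \<phi>"
    and "hopf_endomorphism H \<tau>"
    and "twisted_compatible H \<phi> \<tau> \<chi>"
  shows "comodule_algebra (iota_algebra H \<phi> \<tau>) (iota_double H \<phi>) (Psi H \<phi> \<tau>) \<and>
    (\<forall>a\<in>carrier (iota_algebra H \<phi> \<tau>).
      tensor_map (iota_algebra H \<phi> \<tau>) (iota_double H \<phi>) (iota_double H \<phi>) (iota_double H \<phi>)
        (xi H \<tau> \<chi>) id (Psi H \<phi> \<tau> a) =
      comult (iota_double H \<phi>) (xi H \<tau> \<chi> a))"
proof -
  interpret hopf_algebra H by fact
  interpret twisted_setup H \<phi> \<tau>
    by unfold_locales (fact assms)+
  have "linear_on H ground \<chi>"
    using assms(5) by (simp add: twisted_compatible_def)
  then show ?thesis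
    using Psi_comodule_algebra xi_Psi
    by (simp add: A_carrier tensor_map_same_space[OF A_space D_space D_space D_space])
qed

end
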